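(* Let $x\le w$ in $W$ and let $\mathfrak w=s_1\cdots s_n$ be a reduced word of $w$, $s_i=s_{\alpha_i}$ with $\alpha_i\in\Pi$, such that either (A) $\lambda_{x,\mathfrak w}=\lambda(\mathscr C^-_{x,\mathfrak w})^*=(i_1,\ldots,i_d)$, or (B) $\lambda(\mathscr C^+_{x,\mathfrak w})=\lambda(\mathscr C^-_{x,\mathfrak w})^*=(i_1,\ldots,i_d)$, with $i_1<\cdots<i_d$. For $i=1,\ldots,n$ let $\beta_i=u_i(\alpha_i)$, where $u_i\in W$ is the product, in order, of the $s_j$ with $j<i$ and $j\notin\{i_1,\ldots,i_d\}$. Define $f_{n+1}=1$ and, for $i=n,n-1,\ldots,1$, \[ f_i=\begin{cases}(1-ve^{-\beta_i})\,f_{i+1} & \text{if } i\notin\{i_1,\ldots,i_d\},\\ \mathcal T_{\beta_i}(f_{i+1}) & \text{if } i\in\{i_1,\ldots,i_d\}.\end{cases} \] Then $c_{w,x}=f_1$; i.e. $c_{w,x}=(1-ve^{-\beta_1})\cdots\mathcal T_{\beta_{i_1}}\big(\cdots\mathcal T_{\beta_{i_d}}(\cdots(1-ve^{-\beta_n}))\cdots\big)$.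
   Context: Let $\Phi$ be the root system of a finite-dimensional simple complex Lie algebra, with positive roots $\Phi_+$, simple roots $\Pi=\{a_i\}_{i\in I}$, weight lattice $P$, Weyl group $W$ generated by $\sigma_i=s_{a_i}$, length $\ell$, Bruhat order $\le$. Let $v$ be an indeterminate, $\mathcal O_v=\mathbb C(v)\otimes\mathbb C[P]$, $W$ acting by $w(e^\lambda)=e^{w\lambda}$. For any $\beta\in\Phi$ define operators on $\mathcal O_v$: $\partial_\beta f=\frac{f-e^{-\beta}s_\beta(f)}{1-e^{-\beta}}$ and $\mathcal T_\beta=(1-ve^{-\beta})\partial_\beta-1$; for simple roots put $\partial_i=\partial_{a_i}$, $\mathcal T_i=\mathcal T_{a_i}$, $D_i=\partial_i-1$. The families $\{\mathcal T_i\},\{D_i\}$ satisfy the braid relations; $\mathcal T_w,D_w$ denote products along any reduced expression. The coefficients $c_{w,x}\in\mathbb Z[v]\otimes\mathbb Z[P]$ ($x\le w$) are the unique elements with $\mathcal T_w=\sum_{x\le w}c_{w,x}D_x$ as operators (elements of $\mathcal O_v$ acting by multiplication). Combinatorial notation: for a reduced word $\mathfrak w=s_1\cdots s_n$ of $w$ and $x\le w$, $\lambda_{x,\mathfrak w}$ is the set of $i$ with $x\le s_1\cdots\widehat{s_i}\cdots s_n$, written as an increasing tuple. A cover $y\to x$ means $y>x$ with nothing strictly between. Each maximal chain $\mathscr C: w=w_0\to\cdots\to w_d=x$ in $[x,w]$ has a label $\lambda(\mathscr C)=(i_1,\ldots,i_d)$, the unique sequence of distinct positions such that $w_k$ is obtained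 from $\mathfrak w$ by deleting $s_{i_1},\ldots,s_{i_k}$. By Björner–Wachs shellability there is a unique maximal chain $\mathscr C^+_{x,\mathfrak w}$ with strictly increasing label and a unique one $\mathscr C^-_{x,\mathfrak w}$ with strictly decreasing label. For a tuple $\lambda=(a_1,\ldots,a_d)$, $\lambda^*=(a_d,\ldots,a_1)$. *)

theory Defs
  imports "HOL-Analysis.Analysis" "HOL-Library.Poly_Mapping"
    "HOL-Computational_Algebra.Polynomial" "HOL-Computational_Algebra.Fraction_Field"
begin

definition refl :: "'a::euclidean_space \<Rightarrow> 'a \<Rightarrow> 'a" where
  "refl \<beta> y = y - (2 * (y \<bullet> \<beta>) / (\<beta> \<bullet> \<beta>)) *\<^sub>R \<beta>"

definition root_system :: "'a::euclidean_space set \<Rightarrow> bool" where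
  "root_system R \<longleftrightarrow> finite R \<and> 0 \<notin> R \<and> span R = UNIV \<and>
     (\<forall>\<alpha>\<in>R. \<forall>\<beta>\<in>R. refl \<alpha> \<beta> \<in> R \<and> 2 * (\<beta> \<bullet> \<alpha>) / (\<alpha> \<bullet> \<alpha>) \<in> \<int>) \<and>
     (\<forall>\<alpha>\<in>R. \<forall>c::real. c *\<^sub>R \<alpha> \<in> R \<longrightarrow> c = 1 \<or> c = -1)"

text \<open>Irreducible: not a disjoint union of two nonempty mutually orthogonal subsets.
  Irreducible reduced root systems are exactly the root systems of
  finite-dimensional simple complex Lie algebras.\<close>
definition irreducible_rs :: "'a::euclidean_space set \<Rightarrow> bool" where
  "irreducible_rs R \<longleftrightarrow> R \<noteq> {} \<and>
     \<not> (\<exists>R1 R2. R1 \<noteq> {} \<and> R2 \<noteq> {} \<and> R1 \<union> R2 = R \<and> R1 \<inter> R2 = {} \<and>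
              (\<forall>a\<in>R1. \<forall>b\<in>R2. a \<bullet> b = 0))"

definition is_base :: "'a::euclidean_space set \<Rightarrow> 'a set \<Rightarrow> bool" where
  "is_base R B \<longleftrightarrow> B \<subseteq> R \<and> independent B \<and>
     (\<forall>\<beta>\<in>R. \<exists>c. (\<forall>\<alpha>\<in>B. c \<alpha> \<in> \<int>) \<and> \<beta> = (\<Sum>\<alpha>\<in>B. c \<alpha> *\<^sub>R \<alpha>) \<and>
                ((\<forall>\<alpha>\<in>B. c \<alpha> \<ge> 0) \<or> (\<forall>\<alpha>\<in>B. c \<alpha> \<le> 0)))"

definition weight_lattice :: "'a::euclidean_space set \<Rightarrow> 'a set" where
  "weight_lattice R = {y. \<forall>\<alpha>\<in>R. 2 * (y \<bullet> \<alpha>) / (\<alpha> \<bullet> \<alpha>) \<in> \<int>}"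

definition wprod :: "'a::euclidean_space list \<Rightarrow> 'a \<Rightarrow> 'a" where
  "wprod ws = foldr (\<lambda>\<alpha> f. refl \<alpha> \<circ> f) ws id"

definition weyl :: "'a::euclidean_space set \<Rightarrow> ('a \<Rightarrow> 'a) set" where
  "weyl B = {wprod ws | ws. set ws \<subseteq> B}"

definition wlen :: "'a::euclidean_space set \<Rightarrow> ('a \<Rightarrow> 'a) \<Rightarrow> nat" where
  "wlen B w = (LEAST n. \<exists>ws. set ws \<subseteq> B \<and> length ws = n \<and> wprod ws = w)"

definition reduced_word :: "'a::euclidean_space set \<Rightarrow> 'a list \<Rightarrow> bool" where
  "reduced_word B ws \<longleftrightarrow> set ws \<subseteq> B \<and> length ws = wlen B (wprod ws)"

definition bruhat :: "'a::euclidean_space set \<Rightarrow> 'a set \<Rightarrow> ('a \<Rightarrow> 'a) \<Rightarrow> ('a \<Rightarrow> 'a) \<Rightarrow> bool" where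
  "bruhat R B x w \<longleftrightarrow> x \<in> weyl B \<and> w \<in> weyl B \<and>
     (\<lambda>y z. \<exists>\<beta>\<in>R. z = y \<circ> refl \<beta> \<and> wlen B y < wlen B z)\<^sup>*\<^sup>* x w"

section \<open>Combinatorics of subwords and maximal chains (positions are 0-based)\<close>

definition del_pos :: "'a list \<Rightarrow> nat set \<Rightarrow> 'a list" where
  "del_pos ws S = [ws ! i. i \<leftarrow> [0..<length ws], i \<notin> S]"

definition lam_set :: "'a::euclidean_space set \<Rightarrow> 'a set \<Rightarrow> ('a \<Rightarrow> 'a) \<Rightarrow> 'a list \<Rightarrow> nat set" where
  "lam_set R B x ws = {i. i < length ws \<and> bruhat R B x (wprod (del_pos ws {i}))}"

definition bruhat_cover :: "'a::euclidean_space set \<Rightarrow> 'a set \<Rightarrow> ('a \<Rightarrow> 'a) \<Rightarrow> ('a \<Rightarrow> 'a) \<Rightarrow> bool" where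
  "bruhat_cover R B y x \<longleftrightarrow> bruhat R B x y \<and> x \<noteq> y \<and>
     \<not> (\<exists>z. bruhat R B x z \<and> bruhat R B z y \<and> z \<noteq> x \<and> z \<noteq> y)"

definition max_chain :: "'a::euclidean_space set \<Rightarrow> 'a set \<Rightarrow> ('a \<Rightarrow> 'a) \<Rightarrow> ('a \<Rightarrow> 'a) \<Rightarrow> ('a \<Rightarrow> 'a) list \<Rightarrow> bool" where
  "max_chain R B x w cs \<longleftrightarrow> cs \<noteq> [] \<and> hd cs = w \<and> last cs = x \<and>
     (\<forall>k. Suc k < length cs \<longrightarrow> bruhat_cover R B (cs ! k) (cs ! Suc k))"

definition chain_label :: "'a::euclidean_space list \<Rightarrow> ('a \<Rightarrow> 'a) list \<Rightarrow> nat list" where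
  "chain_label ws cs = (THE ls. length ls + 1 = length cs \<and> distinct ls \<and>
      set ls \<subseteq> {..<length ws} \<and>
      (\<forall>k\<le>length ls. cs ! k = wprod (del_pos ws (set (take k ls)))))"

definition chain_plus :: "'a::euclidean_space set \<Rightarrow> 'a set \<Rightarrow> ('a \<Rightarrow> 'a) \<Rightarrow> 'a list \<Rightarrow> ('a \<Rightarrow> 'a) list" where
  "chain_plus R B x ws = (THE cs. max_chain R B x (wprod ws) cs \<and>
      sorted_wrt (<) (chain_label ws cs))"

definition chain_minus :: "'a::euclidean_space set \<Rightarrow> 'a set \<Rightarrow> ('a \<Rightarrow> 'a) \<Rightarrow> 'a list \<Rightarrow> ('a \<Rightarrow> 'a) list" where
  "chain_minus R B x ws = (THE cs. max_chain R B x (wprod ws) cs \<and>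
      sorted_wrt (>) (chain_label ws cs))"

section \<open>The ring O_v = C(v) \<otimes> C[P] and the operators\<close>

type_synonym Kv = "complex poly fract"

definition vv :: Kv where "vv = Fract [:0, 1:] 1"

abbreviation ex :: "'a::euclidean_space \<Rightarrow> ('a \<Rightarrow>\<^sub>0 Kv)" where
  "ex \<mu> \<equiv> Poly_Mapping.single \<mu> 1"

definition Ov :: "'a::euclidean_space set \<Rightarrow> ('a \<Rightarrow>\<^sub>0 Kv) set" where
  "Ov R = {f. Poly_Mapping.keys f \<subseteq> weight_lattice R}"

definition ZvZP :: "'a::euclidean_space set \<Rightarrow> ('a \<Rightarrow>\<^sub>0 Kv) set" where
  "ZvZP R = {f. Poly_Mapping.keys f \<subseteq> weight_lattice R \<and>
     (\<forall>\<mu>. Poly_Mapping.lookup f \<mu> \<in> range (\<lambda>p::int poly. Fract (map_poly of_int p) 1))}"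

definition wact :: "('a \<Rightarrow> 'a) \<Rightarrow> ('a \<Rightarrow>\<^sub>0 Kv) \<Rightarrow> ('a::euclidean_space \<Rightarrow>\<^sub>0 Kv)" where
  "wact w f = (\<Sum>y\<in>Poly_Mapping.keys f. Poly_Mapping.single (w y) (Poly_Mapping.lookup f y))"

definition dem :: "'a::euclidean_space set \<Rightarrow> 'a \<Rightarrow> ('a \<Rightarrow>\<^sub>0 Kv) \<Rightarrow> ('a \<Rightarrow>\<^sub>0 Kv)" where
  "dem R \<beta> f = (THE g. g \<in> Ov R \<and>
      (1 - ex (-\<beta>)) * g = f - ex (-\<beta>) * wact (refl \<beta>) f)"

definition Top :: "'a::euclidean_space set \<Rightarrow> 'a \<Rightarrow> ('a \<Rightarrow>\<^sub>0 Kv) \<Rightarrow> ('a \<Rightarrow>\<^sub>0 Kv)" where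
  "Top R \<beta> f = (1 - Poly_Mapping.single (-\<beta>) vv) * dem R \<beta> f - f"

definition Dop :: "'a::euclidean_space set \<Rightarrow> 'a \<Rightarrow> ('a \<Rightarrow>\<^sub>0 Kv) \<Rightarrow> ('a \<Rightarrow>\<^sub>0 Kv)" where
  "Dop R \<alpha> f = dem R \<alpha> f - f"

definition op_word :: "('a \<Rightarrow> 'b \<Rightarrow> 'b) \<Rightarrow> 'a list \<Rightarrow> 'b \<Rightarrow> 'b" where
  "op_word F ws = foldr (\<lambda>\<alpha> g. F \<alpha> \<circ> g) ws id"

definition op_elem :: "'a::euclidean_space set \<Rightarrow> ('a \<Rightarrow> 'b \<Rightarrow> 'b) \<Rightarrow> ('a \<Rightarrow> 'a) \<Rightarrow> 'b \<Rightarrow> 'b" where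
  "op_elem B F w = op_word F (SOME ws. reduced_word B ws \<and> wprod ws = w)"

text \<open>The coefficients c_{w,x}: T_w = sum_{x \<le> w} c_{w,x} D_x on O_v
  (c_{w,x} := 0 for x not \<le> w, for uniqueness of the function).\<close>
definition cwx :: "'a::euclidean_space set \<Rightarrow> 'a set \<Rightarrow> ('a \<Rightarrow> 'a) \<Rightarrow> ('a \<Rightarrow> 'a) \<Rightarrow> ('a \<Rightarrow>\<^sub>0 Kv)" where
  "cwx R B w = (THE c. (\<forall>x. bruhat R B x w \<longrightarrow> c x \<in> ZvZP R) \<and>
      (\<forall>x. \<not> bruhat R B x w \<longrightarrow> c x = 0) \<and>
      (\<forall>f\<in>Ov R. op_elem B (Top R) w f =
          (\<Sum>x\<in>{x. bruhat R B x w}. c x * op_elem B (Dop R) x f)))"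

definition beta_i :: "'a::euclidean_space list \<Rightarrow> nat set \<Rightarrow> nat \<Rightarrow> 'a" where
  "beta_i ws I i = wprod [ws ! j. j \<leftarrow> [0..<i], j \<notin> I] (ws ! i)"

definition f_rec :: "'a::euclidean_space set \<Rightarrow> 'a list \<Rightarrow> nat set \<Rightarrow> ('a \<Rightarrow>\<^sub>0 Kv)" where
  "f_rec R ws I = foldr (\<lambda>i g. if i \<in> I then Top R (beta_i ws I i) g
                              else (1 - Poly_Mapping.single (- beta_i ws I i) vv) * g)
                    [0..<length ws] 1"

end

(*
  Write w = s w' with w' < w.  The relation T_s c = T_s(c) + (1 - v e^(-a)) s(c) D_s of operators gives
  c_(w,x) = T_s(c_(w',x)) + [s x < x] (1 - v e^(-a)) s(c_(w',sx) - c_(w',x)).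
  The decreasing chain deletes the first letter s exactly when s x > x, and then only the first summand
  is present.  If s x < x, hypothesis (A) or (B) forces x not <= w', so that c_(w',x) = 0 and only
  (1 - v e^(-a)) s(c_(w',sx)) remains.  Both hypotheses pass to w', and the recursion becomes that of f_1.

  A set of positions can be deleted in decreasing order through reduced words iff reading the word from
  the right gives a distinguished subexpression (s_i u > u at every position, u the part already kept);
  this gives the decreasing chain and its uniqueness, and reversing words gives the increasing one.

  The braid relations are proved uniformly in the parameter of the Hecke operators: the difference E of
  the two sides satisfies E e^l = e^l' E for weights l generating the lattice, by a computation with one
  small orbit in each rank two type, and E kills e^(-rho), on which every simple operator acts by -1.
*)
theory Submission
  imports Defs "HOL-Library.Sublist"
begin

text \<open>The objects of the statement are descriptions: \<open>dem\<close>, the coefficients, the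
  labels and the two monotone chains are given by \<open>THE\<close>, the operator of a Weyl group
  element by \<open>SOME\<close> reduced word. Each needs existence, and uniqueness or independence
  of the choice, before the recursion can be used. For the coefficients uniqueness means that the
  D_x are linearly independent over the group ring. Up to factors that are not zero divisors, D_x is
  a combination of Weyl group elements with leading term x, and those are independent because a
  regular weight separates them. Why x is not below w' when s x < x: the first position lies in
  \<open>lam_set\<close> iff x is below w', and the decreasing chain keeps that position, which
  settles (A). For (B), an increasing deletion from w' to x, preceded by deletion of the first
  letter, would be one from w to x, against the uniqueness of the increasing chain, which also keeps
  the letter. T and D belong to one family \<open>Tq R q\<close>, with q = v and q = 0, so one proof
  of the braid relations serves both.\<close>

section \<open>Reflections\<close>

definition pairing :: "'a::euclidean_space \<Rightarrow> 'a \<Rightarrow> real" where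
  "pairing y b = 2 * (y \<bullet> b) / (b \<bullet> b)"

lemma refl_pairing: "refl b y = y - pairing y b *\<^sub>R b"
  by (simp add: refl_def pairing_def)

lemma pairing_add [simp]: "pairing (x + y) b = pairing x b + pairing y b"
  by (simp add: pairing_def inner_add_left algebra_simps add_divide_distrib)

lemma pairing_scale [simp]: "pairing (c *\<^sub>R y) b = c * pairing y b"
  by (simp add: pairing_def)

lemma pairing_zero [simp]: "pairing 0 b = 0"
  by (simp add: pairing_def)

lemma pairing_minus [simp]: "pairing (- y) b = - pairing y b"
  by (simp add: pairing_def)

lemma pairing_diff [simp]: "pairing (x - y) b = pairing x b - pairing y b"
  by (simp add: pairing_def inner_diff_left algebra_simps diff_divide_distrib)

lemma pairing_self [simp]: "b \<noteq> 0 \<Longrightarrow> pairing b b = 2"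
  by (simp add: pairing_def)

lemma linear_refl: "linear (refl b)"
  by (rule linearI) (simp_all add: refl_pairing algebra_simps)

lemma refl_self [simp]: "refl b b = - b"
  by (cases "b = 0") (simp_all add: refl_pairing algebra_simps scaleR_2)

lemma refl_minus_root [simp]: "refl (- b) = refl b"
  by (simp add: refl_def fun_eq_iff)

lemma refl_refl [simp]: "refl b (refl b y) = y"
  by (cases "b = 0") (simp_all add: refl_pairing algebra_simps)

lemma refl_comp_refl [simp]: "refl b \<circ> refl b = id"
  by (simp add: fun_eq_iff)

lemma refl_comp_left [simp]: "refl b \<circ> (refl b \<circ> f) = f"
  by (simp add: fun_eq_iff)

lemma inner_refl: "refl b x \<bullet> refl b y = x \<bullet> y"
proof (cases "b = 0")
  case False
  then show ?thesis
    by (simp add: refl_def inner_diff_left inner_diff_right inner_commute field_simps)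
qed (simp add: refl_def)

lemma orthogonal_refl: "orthogonal_transformation (refl b)"
  by (simp add: orthogonal_transformation_def linear_refl inner_refl)

lemma refl_conj: "orthogonal_transformation w \<Longrightarrow> w (refl b y) = refl (w b) (w y)"
  unfolding orthogonal_transformation_def
  by (simp add: refl_def linear_diff linear_cmul)

lemma refl_conj_comp: "orthogonal_transformation w \<Longrightarrow> w \<circ> refl b = refl (w b) \<circ> w"
  by (simp add: fun_eq_iff refl_conj)

section \<open>Words and deletion of letters\<close>

lemma wprod_Nil [simp]: "wprod [] = id"
  by (simp add: wprod_def)

lemma wprod_Cons [simp]: "wprod (a # ws) = refl a \<circ> wprod ws"
  by (simp add: wprod_def)

lemma wprod_append [simp]: "wprod (us @ vs) = wprod us \<circ> wprod vs"
  by (induction us) (simp_all add: comp_assoc)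

lemma orthogonal_wprod: "orthogonal_transformation (wprod ws)"
proof (induction ws)
  case Nil
  then show ?case by (simp add: orthogonal_transformation_id id_def)
next
  case (Cons a ws)
  then show ?case
    using orthogonal_transformation_compose[OF orthogonal_refl[of a] Cons.IH] by (simp only: wprod_Cons)
qed

lemma wprod_rev_left: "wprod (rev ws) (wprod ws y) = y"
  by (induction ws arbitrary: y) simp_all

lemma wprod_rev_right: "wprod ws (wprod (rev ws) y) = y"
  using wprod_rev_left[of "rev ws"] by simp

lemma inv_wprod: "inv (wprod ws) = wprod (rev ws)"
  by (rule inv_equality) (simp_all add: wprod_rev_left wprod_rev_right)

lemma del_pos_Nil [simp]: "del_pos [] S = []"
  by (simp add: del_pos_def)

text \<open>The form of deletion that inductions on words use: the tail sees the index set shifted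
  down by one.\<close>

lemma del_pos_Cons:
  "del_pos (a # ws) S = (if 0 \<in> S then [] else [a]) @ del_pos ws {i. Suc i \<in> S}"
proof -
  have e: "[0..<Suc n] = 0 # map Suc [0..<n]" for n
    by (simp add: map_Suc_upt upt_conv_Cons)
  show ?thesis
    by (simp add: del_pos_def e comp_def nth_Cons_Suc del: upt_Suc cong: if_cong)
qed

lemma del_pos_empty [simp]: "del_pos ws {} = ws"
  by (induction ws) (simp_all add: del_pos_Cons)

lemma subseq_del_pos_mono: "J \<subseteq> I \<Longrightarrow> subseq (del_pos ws I) (del_pos ws J)"
proof (induction ws arbitrary: I J)
  case (Cons a ws)
  have "subseq (del_pos ws {i. Suc i \<in> I}) (del_pos ws {i. Suc i \<in> J})"
    using Cons.prems by (intro Cons.IH) auto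
  then show ?case using Cons.prems by (auto simp: del_pos_Cons)
qed simp

lemma subseq_del_pos: "subseq (del_pos ws I) ws"
  using subseq_del_pos_mono[of "{}" I ws] by simp

lemma set_del_pos_subset: "set (del_pos ws I) \<subseteq> set ws"
  using subseq_del_pos[of ws I] by (metis notin_set_nthsI subseq_conv_nths subsetI)

lemma card_Suc_shift:
  assumes "finite I"
  shows "card I = (if 0 \<in> I then 1 else 0) + card {i. Suc i \<in> I}"
proof -
  have f: "finite {i. Suc i \<in> I}"
    using finite_vimageI[OF assms, of Suc] by (simp add: vimage_def)
  have c: "card (Suc ` {i. Suc i \<in> I}) = card {i. Suc i \<in> I}"
    by (simp add: card_image)
  have e: "I - {0} = Suc ` {i. Suc i \<in> I}"
    by (auto simp: image_iff) (metis not0_implies_Suc)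
  show ?thesis
  proof (cases "0 \<in> I")
    case True
    then show ?thesis using e c card.remove[OF assms True] by simp
  next
    case False
    then show ?thesis using e c by simp
  qed
qed

lemma length_del_pos: "I \<subseteq> {..<length ws} \<Longrightarrow> length (del_pos ws I) + card I = length ws"
proof (induction ws arbitrary: I)
  case (Cons a ws)
  have "length (del_pos ws {i. Suc i \<in> I}) + card {i. Suc i \<in> I} = length ws"
    using Cons.prems by (intro Cons.IH) auto
  moreover have "finite I" using Cons.prems finite_subset by blast
  ultimately show ?case by (simp add: del_pos_Cons card_Suc_shift[of I])
qed simp

section \<open>Heights and positive roots\<close>

locale based_root_system =
  fixes R B :: "'a::euclidean_space set"
  assumes root_sys: "root_system R" and base: "is_base R B"
begin

abbreviation "len \<equiv> wlen B"
abbreviation "red \<equiv> reduced_word B"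
abbreviation ble (infix "\<preceq>" 50) where "x \<preceq> w \<equiv> bruhat R B x w"

lemma finite_R: "finite R" and zero_notin_R: "0 \<notin> R" and span_R: "span R = UNIV"
  and refl_in_R: "\<alpha> \<in> R \<Longrightarrow> \<beta> \<in> R \<Longrightarrow> refl \<alpha> \<beta> \<in> R"
  and pairing_R: "\<alpha> \<in> R \<Longrightarrow> \<beta> \<in> R \<Longrightarrow> pairing \<beta> \<alpha> \<in> \<int>"
  and scale_R: "\<alpha> \<in> R \<Longrightarrow> c *\<^sub>R \<alpha> \<in> R \<Longrightarrow> c = 1 \<or> c = -1"
  using root_sys unfolding root_system_def pairing_def by auto

lemma B_R: "B \<subseteq> R" and indep_B: "independent B"
  using base unfolding is_base_def by auto

lemma B_R' [simp, intro]: "a \<in> B \<Longrightarrow> a \<in> R" using B_R by auto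

lemma finite_B: "finite B" using B_R finite_R finite_subset by blast

lemma nonzero_root: "\<alpha> \<in> R \<Longrightarrow> \<alpha> \<noteq> 0" using zero_notin_R by auto

lemma uminus_R: "\<alpha> \<in> R \<Longrightarrow> - \<alpha> \<in> R"
  using refl_in_R[of \<alpha> \<alpha>] by simp

lemma span_B [simp]: "span B = UNIV"
proof -
  have "R \<subseteq> span B"
  proof
    fix \<beta> assume "\<beta> \<in> R"
    then obtain c where "\<beta> = (\<Sum>\<alpha>\<in>B. c \<alpha> *\<^sub>R \<alpha>)"
      using base unfolding is_base_def by blast
    then show "\<beta> \<in> span B" by (simp add: span_base span_scale span_sum)
  qed
  then show ?thesis using span_R by (metis span_mono span_span top.extremum_unique)
qed

definition coef :: "'a \<Rightarrow> 'a \<Rightarrow> real" where "coef \<gamma> y = representation B y \<gamma>"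

text \<open>Positive roots are not collected in a set. The sign of \<open>ht\<close> decides
  positivity, because the simple coefficients of a root all have the same sign.\<close>

definition ht :: "'a \<Rightarrow> real" where "ht y = (\<Sum>\<gamma>\<in>B. coef \<gamma> y)"

lemma linear_coef: "linear (coef \<gamma>)"
  unfolding coef_def
  by (rule linearI) (simp_all add: representation_add[OF indep_B] representation_scale[OF indep_B])

lemma coef_base: "a \<in> B \<Longrightarrow> coef \<gamma> a = (if \<gamma> = a then 1 else 0)"
  by (simp add: coef_def representation_basis[OF indep_B])

lemma coef_expand: "(\<Sum>\<gamma>\<in>B. coef \<gamma> y *\<^sub>R \<gamma>) = y"
  unfolding coef_def
  by (rule sum_representation_eq[OF indep_B]) (auto simp: finite_B)

lemma linear_ht: "linear ht"
  unfolding ht_def[abs_def] by (intro linear_compose_sum ballI linear_coef)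

lemma ht_base [simp]: "a \<in> B \<Longrightarrow> ht a = 1"
  by (simp add: ht_def coef_base finite_B)

lemma coef_root:
  assumes "\<beta> \<in> R"
  shows "\<forall>\<gamma>\<in>B. coef \<gamma> \<beta> \<in> \<int>" and "(\<forall>\<gamma>\<in>B. coef \<gamma> \<beta> \<ge> 0) \<or> (\<forall>\<gamma>\<in>B. coef \<gamma> \<beta> \<le> 0)"
proof -
  obtain c where c: "\<forall>\<alpha>\<in>B. c \<alpha> \<in> \<int>" "\<beta> = (\<Sum>\<alpha>\<in>B. c \<alpha> *\<^sub>R \<alpha>)"
    "(\<forall>\<alpha>\<in>B. c \<alpha> \<ge> 0) \<or> (\<forall>\<alpha>\<in>B. c \<alpha> \<le> 0)"
    using base assms unfolding is_base_def by blast
  have "coef \<gamma> \<beta> = c \<gamma>" if "\<gamma> \<in> B" for \<gamma>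
  proof -
    have "coef \<gamma> \<beta> = (\<Sum>\<alpha>\<in>B. c \<alpha> * coef \<gamma> \<alpha>)"
      unfolding c(2) by (simp add: linear_sum[OF linear_coef] linear_cmul[OF linear_coef])
    also have "\<dots> = (\<Sum>\<alpha>\<in>B. if \<alpha> = \<gamma> then c \<gamma> else 0)"
      by (rule sum.cong) (auto simp: coef_base)
    finally show ?thesis using that finite_B by simp
  qed
  then show "\<forall>\<gamma>\<in>B. coef \<gamma> \<beta> \<in> \<int>" and "(\<forall>\<gamma>\<in>B. coef \<gamma> \<beta> \<ge> 0) \<or> (\<forall>\<gamma>\<in>B. coef \<gamma> \<beta> \<le> 0)"
    using c by auto
qed

lemma ht_Ints: "\<beta> \<in> R \<Longrightarrow> ht \<beta> \<in> \<int>"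
  using coef_root(1) unfolding ht_def by (simp add: Ints_sum)

lemma coef_nonneg:
  assumes "\<beta> \<in> R" "ht \<beta> > 0" "\<gamma> \<in> B"
  shows "coef \<gamma> \<beta> \<ge> 0"
proof (rule ccontr)
  assume "\<not> ?thesis"
  then have "\<forall>\<gamma>\<in>B. coef \<gamma> \<beta> \<le> 0" using coef_root(2)[OF assms(1)] assms(3) by auto
  then have "ht \<beta> \<le> 0" unfolding ht_def by (simp add: sum_nonpos)
  then show False using assms(2) by simp
qed

lemma ht_pos_if_coef_pos:
  assumes "\<beta> \<in> R" "\<gamma> \<in> B" "coef \<gamma> \<beta> > 0"
  shows "ht \<beta> > 0"
proof -
  have "\<forall>\<gamma>\<in>B. coef \<gamma> \<beta> \<ge> 0" using coef_root(2)[OF assms(1)] assms(2,3) by force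
  then show ?thesis unfolding ht_def using assms finite_B by (meson sum_pos2)
qed

text \<open>Some simple coefficient is non-zero, and it is positive for the root or for its
  negative, so \<open>ht_pos_if_coef_pos\<close> applies to one of them.\<close>

lemma ht_nonzero:
  assumes "\<beta> \<in> R" shows "ht \<beta> \<noteq> 0"
proof -
  have "\<exists>\<gamma>\<in>B. coef \<gamma> \<beta> \<noteq> 0"
  proof (rule ccontr)
    assume "\<not> ?thesis"
    then have "(\<Sum>\<gamma>\<in>B. coef \<gamma> \<beta> *\<^sub>R \<gamma>) = 0" by simp
    then show False using assms nonzero_root coef_expand by metis
  qed
  then obtain \<gamma> where \<gamma>: "\<gamma> \<in> B" "coef \<gamma> \<beta> \<noteq> 0" by blast
  show ?thesis
  proof (cases "coef \<gamma> \<beta> > 0")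
    case True then show ?thesis using ht_pos_if_coef_pos[OF assms] \<gamma> by force
  next
    case False
    then have "coef \<gamma> (-\<beta>) > 0" using \<gamma> by (simp add: linear_neg[OF linear_coef])
    then have "ht (-\<beta>) > 0" using ht_pos_if_coef_pos uminus_R assms \<gamma> by blast
    then show ?thesis by (simp add: linear_neg[OF linear_ht])
  qed
qed

lemma ht_refl_base: "a \<in> B \<Longrightarrow> ht (refl a y) = ht y - pairing y a"
  by (simp add: refl_pairing linear_diff[OF linear_ht] linear_cmul[OF linear_ht])

lemma ht_minus [simp]: "ht (- y) = - ht y"
  by (simp add: linear_neg[OF linear_ht])

text \<open>A simple reflection changes only one simple coefficient, so it cannot make a positive root
  other than its own negative.\<close>
lemma ht_refl_pos:
  assumes "a \<in> B" "\<beta> \<in> R" "ht \<beta> > 0" "\<beta> \<noteq> a"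
  shows "ht (refl a \<beta>) > 0"
proof -
  have "\<exists>\<gamma>\<in>B. \<gamma> \<noteq> a \<and> coef \<gamma> \<beta> \<noteq> 0"
  proof (rule ccontr)
    assume "\<not> ?thesis"
    then have "(\<Sum>\<gamma>\<in>B. coef \<gamma> \<beta> *\<^sub>R \<gamma>) = (\<Sum>\<gamma>\<in>B. if \<gamma> = a then coef a \<beta> *\<^sub>R a else 0)"
      by (intro sum.cong) auto
    then have e: "\<beta> = coef a \<beta> *\<^sub>R a" using assms(1) finite_B by (simp add: coef_expand)
    then have "coef a \<beta> = 1 \<or> coef a \<beta> = -1" using scale_R[of a "coef a \<beta>"] assms by auto
    then show False using e assms coef_nonneg[OF assms(2,3,1)] by auto
  qed
  then obtain \<gamma> where \<gamma>: "\<gamma> \<in> B" "\<gamma> \<noteq> a" "coef \<gamma> \<beta> \<noteq> 0" by blast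
  then have "coef \<gamma> (refl a \<beta>) > 0"
    using coef_nonneg[OF assms(2,3) \<gamma>(1)] assms(1)
    by (simp add: refl_pairing linear_diff[OF linear_coef] linear_cmul[OF linear_coef] coef_base)
  then show ?thesis using ht_pos_if_coef_pos refl_in_R assms \<gamma>(1) by blast
qed

section \<open>The Weyl group and its length function\<close>

lemma wprod_R: "set ws \<subseteq> B \<Longrightarrow> \<beta> \<in> R \<Longrightarrow> wprod ws \<beta> \<in> R"
  by (induction ws) (auto intro: refl_in_R)

lemma weyl_iff: "w \<in> weyl B \<longleftrightarrow> (\<exists>ws. set ws \<subseteq> B \<and> w = wprod ws)"
  by (auto simp: weyl_def)

lemma weyl_id [simp]: "id \<in> weyl B"
  unfolding weyl_iff by (rule exI[of _ "[]"]) simp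

lemma weyl_wprod [simp]: "set ws \<subseteq> B \<Longrightarrow> wprod ws \<in> weyl B"
  unfolding weyl_iff by blast

lemma weyl_comp: "u \<in> weyl B \<Longrightarrow> w \<in> weyl B \<Longrightarrow> u \<circ> w \<in> weyl B"
  unfolding weyl_iff by (metis le_sup_iff set_append wprod_append)

lemma weyl_refl_base: "a \<in> B \<Longrightarrow> refl a \<in> weyl B"
  unfolding weyl_iff by (rule exI[of _ "[a]"]) simp

lemma weyl_Cons [simp]: "a \<in> B \<Longrightarrow> w \<in> weyl B \<Longrightarrow> refl a \<circ> w \<in> weyl B"
  by (simp add: weyl_comp weyl_refl_base)

lemma weyl_inv: "w \<in> weyl B \<Longrightarrow> inv w \<in> weyl B"
  unfolding weyl_iff using inv_wprod by (metis set_rev)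

lemma weyl_orthogonal: "w \<in> weyl B \<Longrightarrow> orthogonal_transformation w"
  unfolding weyl_iff using orthogonal_wprod by blast

lemma weyl_linear: "w \<in> weyl B \<Longrightarrow> linear w"
  using weyl_orthogonal orthogonal_transformation_def by blast

lemma weyl_bij: "w \<in> weyl B \<Longrightarrow> bij w"
  using weyl_orthogonal orthogonal_transformation_bij by blast

lemma weyl_R: "w \<in> weyl B \<Longrightarrow> \<beta> \<in> R \<Longrightarrow> w \<beta> \<in> R"
  unfolding weyl_iff using wprod_R by blast

lemma weyl_inv_left [simp]: "w \<in> weyl B \<Longrightarrow> inv w (w y) = y"
  by (simp add: bij_is_inj weyl_bij)

lemma weyl_inv_right [simp]: "w \<in> weyl B \<Longrightarrow> w (inv w y) = y"
  by (simp add: bij_is_surj surj_f_inv_f weyl_bij)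

text \<open>Induction on the height. A positive root has positive inner product with some simple
  root, since its square norm is a nonnegative combination of these products. If the root is not
  simple, reflecting in that simple root lowers the height and keeps the root positive.\<close>

lemma root_conj_base:
  assumes "\<beta> \<in> R" shows "\<exists>w\<in>weyl B. \<exists>a\<in>B. \<beta> = w a"
proof -
  have pos: "\<exists>w\<in>weyl B. \<exists>a\<in>B. \<beta> = w a" if "\<beta> \<in> R" "ht \<beta> > 0" for \<beta>
    using that
  proof (induction "nat \<lfloor>ht \<beta>\<rfloor>" arbitrary: \<beta> rule: less_induct)
    case less
    show ?case
    proof (cases "\<beta> \<in> B")
      case True then show ?thesis by (intro bexI[of _ id] bexI[of _ \<beta>]) auto
    next
      case False
      have "\<exists>a\<in>B. \<beta> \<bullet> a > 0"
      proof (rule ccontr)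
        assume "\<not> ?thesis"
        then have "(\<Sum>\<gamma>\<in>B. coef \<gamma> \<beta> * (\<beta> \<bullet> \<gamma>)) \<le> 0"
          using coef_nonneg[OF less.prems] by (intro sum_nonpos mult_nonneg_nonpos) force+
        moreover have "\<beta> \<bullet> \<beta> = (\<Sum>\<gamma>\<in>B. coef \<gamma> \<beta> * (\<beta> \<bullet> \<gamma>))"
          by (subst (2) coef_expand[symmetric]) (simp add: inner_sum_right)
        ultimately show False using nonzero_root[OF less.prems(1)] inner_gt_zero_iff[of \<beta>] by linarith
      qed
      then obtain a where a: "a \<in> B" "\<beta> \<bullet> a > 0" by blast
      have "pairing \<beta> a > 0" using a nonzero_root[of a] by (simp add: pairing_def)
      then have lt: "ht (refl a \<beta>) < ht \<beta>" using ht_refl_base[OF a(1)] by simp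
      have p: "ht (refl a \<beta>) > 0" using ht_refl_pos a less.prems False by blast
      have r: "refl a \<beta> \<in> R" using refl_in_R a less.prems by blast
      \<comment> \<open>Heights of roots are integers, so the rounded measure really drops.\<close>
      have "nat \<lfloor>ht (refl a \<beta>)\<rfloor> < nat \<lfloor>ht \<beta>\<rfloor>"
        using lt p ht_Ints[OF r] ht_Ints[OF less.prems(1)] by (auto elim!: Ints_cases)
      then obtain w b where w: "w \<in> weyl B" "b \<in> B" "refl a \<beta> = w b"
        using less.hyps r p by blast
      then have "\<beta> = (refl a \<circ> w) b" by (metis comp_apply refl_refl)
      then show ?thesis using weyl_Cons[OF a(1) w(1)] w(2) by blast
    qed
  qed
  show ?thesis
  proof (cases "ht \<beta> > 0")
    case True then show ?thesis using pos assms by blast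
  next
    case False
    then have "ht (-\<beta>) > 0" using ht_nonzero[OF assms] by simp
    then obtain w a where w: "w \<in> weyl B" "a \<in> B" "-\<beta> = w a" using pos uminus_R assms by blast
    have "(w \<circ> refl a) a = - w a" by (simp add: linear_neg[OF weyl_linear[OF w(1)]])
    then have "\<beta> = (w \<circ> refl a) a" using w(3)[symmetric] by simp
    then show ?thesis using weyl_comp[OF w(1) weyl_refl_base[OF w(2)]] w(2) by blast
  qed
qed

text \<open>The reflection in \<open>w a\<close> is the conjugate of \<open>refl a\<close> by
  \<open>w\<close>.\<close>

lemma weyl_refl: "\<beta> \<in> R \<Longrightarrow> refl \<beta> \<in> weyl B"
proof -
  assume "\<beta> \<in> R"
  then obtain w a where w: "w \<in> weyl B" "a \<in> B" "\<beta> = w a" using root_conj_base by blast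
  have "refl \<beta> = w \<circ> refl a \<circ> inv w"
    using w by (auto simp: fun_eq_iff refl_conj[OF weyl_orthogonal])
  then show ?thesis using w by (simp add: weyl_comp weyl_refl_base weyl_inv)
qed

lemma weyl_comp_refl: "w \<in> weyl B \<Longrightarrow> \<beta> \<in> R \<Longrightarrow> w \<circ> refl \<beta> \<in> weyl B"
  by (simp add: weyl_comp weyl_refl)

text \<open>A linear map is determined by its restriction to the spanning set \<open>R\<close>,
  which the group maps into itself.\<close>

lemma finite_weyl: "finite (weyl B)"
proof -
  have "inj_on (\<lambda>w. restrict w R) (weyl B)"
  proof (rule inj_onI)
    fix u w assume uw: "u \<in> weyl B" "w \<in> weyl B" "restrict u R = restrict w R"
    then have "u x = w x" if "x \<in> R" for x using that by (metis restrict_apply)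
    then show "u = w"
      using linear_eq_on_span[OF weyl_linear weyl_linear, of u w R] uw span_R by (auto simp: fun_eq_iff)
  qed
  moreover have "(\<lambda>w. restrict w R) ` weyl B \<subseteq> (\<Pi>\<^sub>E i\<in>R. R)"
    using weyl_R by (auto simp: PiE_def Pi_def)
  moreover have "finite (\<Pi>\<^sub>E i\<in>R. R)" using finite_R by (simp add: finite_PiE)
  ultimately show ?thesis using inj_on_finite by blast
qed

section \<open>Length, strong exchange and descents\<close>

lemma len_le: "set ws \<subseteq> B \<Longrightarrow> len (wprod ws) \<le> length ws"
  unfolding wlen_def by (rule Least_le) blast

lemma reduced_exists: "w \<in> weyl B \<Longrightarrow> \<exists>ws. red ws \<and> wprod ws = w"
proof -
  assume "w \<in> weyl B"
  then have "\<exists>n. \<exists>ws. set ws \<subseteq> B \<and> length ws = n \<and> wprod ws = w" unfolding weyl_iff by blast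
  from LeastI_ex[OF this] show ?thesis unfolding reduced_word_def wlen_def by blast
qed

lemma reduced_B: "red ws \<Longrightarrow> set ws \<subseteq> B"
  and reduced_len: "red ws \<Longrightarrow> len (wprod ws) = length ws"
  by (auto simp: reduced_word_def)

lemma reducedI: "set ws \<subseteq> B \<Longrightarrow> length ws \<le> len (wprod ws) \<Longrightarrow> red ws"
  using len_le[of ws] by (auto simp: reduced_word_def)

lemma len_inv: "w \<in> weyl B \<Longrightarrow> len (inv w) = len w"
proof -
  have le: "len (inv w) \<le> len w" if w: "w \<in> weyl B" for w
  proof -
    obtain ws where "red ws" "wprod ws = w" using reduced_exists[OF w] by blast
    then show ?thesis using len_le[of "rev ws"] inv_wprod[of ws] reduced_B[of ws] reduced_len[of ws] by simp
  qed
  assume w: "w \<in> weyl B"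
  have "inv (inv w) = w" using w by (simp add: inv_inv_eq weyl_bij)
  then show ?thesis using le[OF w] le[OF weyl_inv[OF w]] by simp
qed

lemma reduced_rev: "red ws \<Longrightarrow> red (rev ws)"
  using len_inv[of "wprod ws"] by (simp add: reduced_word_def inv_wprod)

lemma reduced_Nil [simp]: "red []"
  using len_le[of "[]"] by (simp add: reduced_word_def)

lemma len_comp_le: "u \<in> weyl B \<Longrightarrow> w \<in> weyl B \<Longrightarrow> len (u \<circ> w) \<le> len u + len w"
proof -
  assume uw: "u \<in> weyl B" "w \<in> weyl B"
  obtain us where us: "red us" "wprod us = u" using reduced_exists[OF uw(1)] by blast
  obtain vs where vs: "red vs" "wprod vs = w" using reduced_exists[OF uw(2)] by blast
  show ?thesis
    using len_le[of "us @ vs"] us vs reduced_len[of us] reduced_len[of vs] reduced_B[of us] reduced_B[of vs]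
    by simp
qed

lemma reduced_appendD:
  assumes "red (us @ vs)" shows "red us" "red vs"
proof -
  have s: "set us \<subseteq> B" "set vs \<subseteq> B" using reduced_B[OF assms] by auto
  have "length us + length vs \<le> len (wprod us) + len (wprod vs)"
    using reduced_len[OF assms] len_comp_le[of "wprod us" "wprod vs"] s by simp
  then show "red us" "red vs" using len_le[of us] len_le[of vs] s by (auto intro!: reducedI)
qed

lemma reduced_ConsD: "red (a # ws) \<Longrightarrow> red ws" "red (a # ws) \<Longrightarrow> a \<in> B"
  using reduced_appendD(2)[of "[a]" ws] reduced_B[of "a # ws"] by auto

text \<open>Apply the remaining letters to \<beta> from the right. The image starts positive and
  ends negative, and a simple reflection changes the sign only of its own root; the letter at which
  this happens can be deleted. Positions are counted in the original word \<open>ws\<close>, as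
  chain labels require.\<close>

lemma strong_exchange:
  assumes "set ws \<subseteq> B" "\<beta> \<in> R" "ht \<beta> > 0" "ht (wprod (del_pos ws S) \<beta>) < 0"
  shows "\<exists>p<length ws. p \<notin> S \<and> wprod (del_pos ws S) \<circ> refl \<beta> = wprod (del_pos ws (insert p S))"
  using assms(1,4)
proof (induction ws arbitrary: S)
  case Nil then show ?case using assms(3) by simp
next
  case (Cons a ws)
  let ?S = "{i. Suc i \<in> S}"
  let ?u = "wprod (del_pos ws ?S)"
  have shift: "{i. Suc i \<in> insert (Suc p) S} = insert p ?S" for p by auto
  have e: "wprod (del_pos (a # ws) T) = (if 0 \<in> T then id else refl a) \<circ> wprod (del_pos ws {i. Suc i \<in> T})"
    for T by (simp add: del_pos_Cons)
  show ?case
  proof (cases "ht (?u \<beta>) < 0")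
    case True
    then obtain p where p: "p < length ws" "p \<notin> ?S" "?u \<circ> refl \<beta> = wprod (del_pos ws (insert p ?S))"
      using Cons by (meson set_subset_Cons subset_trans)
    then show ?thesis
      unfolding e by (intro exI[of _ "Suc p"]) (simp only: shift comp_assoc, auto)
  next
    case False
    have sB: "set (del_pos ws ?S) \<subseteq> B" using Cons.prems set_del_pos_subset by fastforce
    have g: "?u \<beta> \<in> R" using wprod_R sB assms(2) by blast
    then have "ht (?u \<beta>) > 0" using False ht_nonzero by force
    moreover have 0: "0 \<notin> S" using Cons.prems False by (auto simp: del_pos_Cons split: if_splits)
    ultimately have "?u \<beta> = a"
      using Cons.prems ht_refl_pos[of a "?u \<beta>"] g by (force simp: del_pos_Cons)
    then have "?u \<circ> refl \<beta> = refl a \<circ> ?u" using refl_conj_comp[OF orthogonal_wprod] by metis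
    moreover have "{i. Suc i \<in> insert 0 S} = ?S" by auto
    ultimately show ?thesis using 0 unfolding e by (intro exI[of _ 0]) (simp add: fun_eq_iff)
  qed
qed

lemma len_refl_less:
  assumes "y \<in> weyl B" "\<beta> \<in> R" "ht \<beta> > 0" "ht (y \<beta>) < 0"
  shows "len (y \<circ> refl \<beta>) < len y"
proof -
  obtain ws where ws: "red ws" "wprod ws = y" using reduced_exists assms by blast
  then obtain p where p: "p < length ws" "y \<circ> refl \<beta> = wprod (del_pos ws {p})"
    using strong_exchange[of ws \<beta> "{}"] assms reduced_B by auto
  have "len (wprod (del_pos ws {p})) \<le> length (del_pos ws {p})"
    using len_le set_del_pos_subset reduced_B ws by (meson subset_trans)
  also have "\<dots> < length ws" using length_del_pos[of "{p}" ws] p by simp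
  finally show ?thesis using ws p reduced_len[OF ws(1)] by simp
qed

text \<open>Apply \<open>len_refl_less\<close> to \<open>y \<circ> refl \<beta>\<close>, which makes
  \<beta> negative.\<close>

lemma len_refl_greater:
  assumes "y \<in> weyl B" "\<beta> \<in> R" "ht \<beta> > 0" "ht (y \<beta>) > 0"
  shows "len y < len (y \<circ> refl \<beta>)"
proof -
  have "ht ((y \<circ> refl \<beta>) \<beta>) < 0" using assms by (simp add: linear_neg[OF weyl_linear])
  then have "len (y \<circ> refl \<beta> \<circ> refl \<beta>) < len (y \<circ> refl \<beta>)"
    using assms by (intro len_refl_less) (auto intro: weyl_comp_refl)
  then show ?thesis by (simp add: comp_assoc)
qed

text \<open>This turns left descents into a sign condition on \<open>ht (inv w a)\<close>, since the
  length comparisons above concern right multiplication.\<close>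

lemma left_eq_right:
  "w \<in> weyl B \<Longrightarrow> refl a \<circ> w = w \<circ> refl (inv w a)"
  using refl_conj_comp[OF weyl_orthogonal, of w "inv w a"] by simp

lemma left_descent_iff:
  assumes "w \<in> weyl B" "a \<in> B"
  shows "len (refl a \<circ> w) < len w \<longleftrightarrow> ht (inv w a) < 0"
proof -
  let ?b = "inv w a"
  have b: "?b \<in> R" using assms weyl_inv weyl_R by blast
  show ?thesis
  proof (cases "ht ?b > 0")
    case True
    then have "len w < len (w \<circ> refl ?b)" using assms b by (intro len_refl_greater) auto
    then show ?thesis using True left_eq_right assms by simp
  next
    case False
    then have n: "ht (- ?b) > 0" using ht_nonzero[OF b] by simp
    have "len (w \<circ> refl (-?b)) < len w"
      using assms b n by (intro len_refl_less) (auto simp: linear_neg[OF weyl_linear] intro: uminus_R)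
    then show ?thesis using n left_eq_right assms by simp
  qed
qed

text \<open>Subadditivity bounds the change by one, and equal lengths would contradict the strict
  comparison given by the sign of \<open>ht (inv w a)\<close>.\<close>

lemma left_len_cases:
  assumes "w \<in> weyl B" "a \<in> B"
  obtains "len (refl a \<circ> w) = Suc (len w)" | "len w = Suc (len (refl a \<circ> w))"
proof -
  have r1: "len (refl a) \<le> 1" using len_le[of "[a]"] assms by simp
  have le: "len (refl a \<circ> v) \<le> Suc (len v)" if "v \<in> weyl B" for v
    using len_comp_le[of "refl a" v] r1 that assms weyl_refl_base by force
  have u: "len (refl a \<circ> w) \<le> Suc (len w)" "len w \<le> Suc (len (refl a \<circ> w))"
    using le[of w] le[of "refl a \<circ> w"] assms by auto
  have "len (refl a \<circ> w) \<noteq> len w"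
  proof
    assume e: "len (refl a \<circ> w) = len w"
    let ?b = "inv w a"
    have b: "?b \<in> R" using assms weyl_inv weyl_R by blast
    have "\<not> ht ?b < 0" using left_descent_iff[OF assms] e by simp
    then have "ht ?b > 0" using ht_nonzero[OF b] by simp
    then have "len w < len (w \<circ> refl ?b)" using assms b by (intro len_refl_greater) auto
    then show False using e left_eq_right assms by simp
  qed
  then show thesis using u that by linarith
qed

lemma reduced_Cons_iff:
  assumes "red ws" "a \<in> B"
  shows "red (a # ws) \<longleftrightarrow> len (wprod ws) < len (refl a \<circ> wprod ws)"
proof -
  have w: "wprod ws \<in> weyl B" using reduced_B[OF assms(1)] by simp
  show ?thesis
    by (rule left_len_cases[OF w assms(2)])
      (use reduced_B[OF assms(1)] reduced_len[OF assms(1)] assms in \<open>auto simp: reduced_word_def\<close>)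
qed

section \<open>Bruhat order\<close>

definition bstep :: "('a \<Rightarrow> 'a) \<Rightarrow> ('a \<Rightarrow> 'a) \<Rightarrow> bool" where
  "bstep y z \<longleftrightarrow> (\<exists>\<beta>\<in>R. z = y \<circ> refl \<beta> \<and> len y < len z)"

lemma bruhat_bstep: "x \<preceq> w \<longleftrightarrow> x \<in> weyl B \<and> w \<in> weyl B \<and> bstep\<^sup>*\<^sup>* x w"
  unfolding bruhat_def bstep_def[abs_def] ..

lemma bruhat_weyl: "x \<preceq> w \<Longrightarrow> x \<in> weyl B" "x \<preceq> w \<Longrightarrow> w \<in> weyl B"
  by (auto simp: bruhat_bstep)

lemma bruhat_refl [simp]: "w \<in> weyl B \<Longrightarrow> w \<preceq> w"
  by (simp add: bruhat_bstep)

lemma bruhat_trans [trans]: "x \<preceq> y \<Longrightarrow> y \<preceq> z \<Longrightarrow> x \<preceq> z"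
  by (auto simp: bruhat_bstep)

lemma bstep_weyl: "bstep y z \<Longrightarrow> y \<in> weyl B \<Longrightarrow> z \<in> weyl B"
  using weyl_comp_refl by (auto simp: bstep_def)

lemma bstep_weyl': "bstep y z \<Longrightarrow> z \<in> weyl B \<Longrightarrow> y \<in> weyl B"
proof -
  assume a: "bstep y z" "z \<in> weyl B"
  then obtain \<beta> where b: "\<beta> \<in> R" "z = y \<circ> refl \<beta>" by (auto simp: bstep_def)
  then have "y = z \<circ> refl \<beta>" by (simp add: comp_assoc)
  then show ?thesis using weyl_comp_refl a b by blast
qed

lemma bstep_bruhat: "bstep y z \<Longrightarrow> y \<in> weyl B \<Longrightarrow> y \<preceq> z"
  using bstep_weyl by (auto simp: bruhat_bstep)

lemma bruhat_len: "x \<preceq> w \<Longrightarrow> x = w \<or> len x < len w"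
proof -
  assume "x \<preceq> w"
  then have "bstep\<^sup>*\<^sup>* x w" by (simp add: bruhat_bstep)
  then show ?thesis by induction (auto simp: bstep_def)
qed

lemma bruhat_left: "a \<in> B \<Longrightarrow> w \<in> weyl B \<Longrightarrow> len w < len (refl a \<circ> w) \<Longrightarrow> w \<preceq> refl a \<circ> w"
proof (rule bstep_bruhat)
  assume a: "a \<in> B" "w \<in> weyl B" "len w < len (refl a \<circ> w)"
  then show "bstep w (refl a \<circ> w)"
    unfolding bstep_def using left_eq_right[OF a(2)] weyl_R[OF weyl_inv] B_R' by blast
qed

lemma bruhat_left': "a \<in> B \<Longrightarrow> w \<in> weyl B \<Longrightarrow> len (refl a \<circ> w) < len w \<Longrightarrow> refl a \<circ> w \<preceq> w"
  using bruhat_left[of a "refl a \<circ> w"] by simp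

text \<open>For positive \<beta>, passing from y to y s_\<beta> goes up iff \<open>y \<beta>\<close>
  is positive. The simple reflection in a keeps this root positive unless it is a itself, and then
  the step is left multiplication by that reflection.\<close>

lemma bstep_left:
  assumes "bstep y z" "y \<in> weyl B" "a \<in> B"
  shows "refl a \<circ> y = z \<or> bstep (refl a \<circ> y) (refl a \<circ> z)"
proof -
  obtain \<beta> where b: "\<beta> \<in> R" "z = y \<circ> refl \<beta>" "ht \<beta> > 0" "len y < len z"
  proof -
    obtain \<beta> where b: "\<beta> \<in> R" "z = y \<circ> refl \<beta>" "len y < len z" using assms by (auto simp: bstep_def)
    show thesis
    proof (cases "ht \<beta> > 0")
      case True then show thesis using b that by blast
    next
      case False
      then show thesis using b that[of "-\<beta>"] uminus_R ht_nonzero[OF b(1)] by auto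
    qed
  qed
  have g: "y \<beta> \<in> R" using weyl_R assms b by blast
  have p: "ht (y \<beta>) > 0"
    using len_refl_less[OF assms(2) b(1,3)] b ht_nonzero[OF g] by force
  show ?thesis
  proof (cases "y \<beta> = a")
    case True
    then have "refl a \<circ> y = z" using refl_conj_comp[OF weyl_orthogonal[OF assms(2)]] b by metis
    then show ?thesis ..
  next
    case False
    then have "ht ((refl a \<circ> y) \<beta>) > 0" using ht_refl_pos assms g p by simp
    then have "len (refl a \<circ> y) < len (refl a \<circ> y \<circ> refl \<beta>)"
      using b assms by (intro len_refl_greater) auto
    then show ?thesis using b by (auto simp: bstep_def comp_assoc)
  qed
qed

text \<open>Induction along a chain from \<open>x\<close> to \<open>w\<close>. The first alternative
  arises in the exceptional case of \<open>bstep_left\<close>, where the reflected element is the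
  next element of the chain.\<close>

lemma bruhat_mult_up:
  assumes "x \<preceq> w" "a \<in> B"
  shows "refl a \<circ> x \<preceq> w \<or> refl a \<circ> x \<preceq> refl a \<circ> w"
proof -
  have x: "x \<in> weyl B" and "bstep\<^sup>*\<^sup>* x w" using assms by (auto simp: bruhat_bstep)
  from this(2) show ?thesis
  proof induction
    case base show ?case by (intro disjI2 bruhat_refl weyl_Cons x assms)
  next
    case (step y z)
    have y: "y \<in> weyl B"
      using step.IH
    proof
      assume "refl a \<circ> x \<preceq> refl a \<circ> y"
      from weyl_Cons[OF assms(2) bruhat_weyl(2)[OF this]] show ?thesis by simp
    qed (rule bruhat_weyl(2))
    have yz: "y \<preceq> z" using step y bstep_bruhat by blast
    from step.IH show ?case
    proof
      assume "refl a \<circ> x \<preceq> y" then show ?thesis using yz bruhat_trans by blast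
    next
      assume h: "refl a \<circ> x \<preceq> refl a \<circ> y"
      from bstep_left[OF step.hyps(2) y assms(2)] show ?thesis
      proof
        assume "bstep (refl a \<circ> y) (refl a \<circ> z)"
        then show ?thesis using bruhat_trans[OF h bstep_bruhat[OF _ bruhat_weyl(2)[OF h]]] by blast
      next
        assume e: "refl a \<circ> y = z"
        show ?thesis using h unfolding e by (rule disjI1)
      qed
    qed
  qed
qed

text \<open>The counterpart of \<open>bruhat_mult_up\<close>, by an induction that extends the chain
  at its lower end.\<close>

lemma bruhat_mult_down:
  assumes "x \<preceq> w" "a \<in> B"
  shows "x \<preceq> refl a \<circ> w \<or> refl a \<circ> x \<preceq> refl a \<circ> w"
proof -
  have w: "w \<in> weyl B" and "bstep\<^sup>*\<^sup>* x w" using assms by (auto simp: bruhat_bstep)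
  from this(2) show ?thesis
  proof (induction rule: converse_rtranclp_induct)
    case base show ?case by (intro disjI2 bruhat_refl weyl_Cons w assms)
  next
    case (step y z)
    have z: "z \<in> weyl B"
      using step.IH
    proof
      assume "refl a \<circ> z \<preceq> refl a \<circ> w"
      from weyl_Cons[OF assms(2) bruhat_weyl(1)[OF this]] show ?thesis by simp
    qed (rule bruhat_weyl(1))
    have y: "y \<in> weyl B" using step z bstep_weyl' by blast
    have yz: "y \<preceq> z" using step y bstep_bruhat by blast
    from step.IH show ?case
    proof
      assume "z \<preceq> refl a \<circ> w" then show ?thesis using yz bruhat_trans by blast
    next
      assume h: "refl a \<circ> z \<preceq> refl a \<circ> w"
      from bstep_left[OF step.hyps(1) y assms(2)] show ?thesis
      proof
        assume "refl a \<circ> y = z"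
        then have e: "refl a \<circ> z = y" by auto
        show ?thesis using h unfolding e by (rule disjI1)
      next
        assume "bstep (refl a \<circ> y) (refl a \<circ> z)"
        then show ?thesis using bruhat_trans[OF bstep_bruhat[OF _ weyl_Cons[OF assms(2) y]] h] by blast
      qed
    qed
  qed
qed

text \<open>The lifting property. If s_a x < x, the first alternative of
  \<open>bruhat_mult_down\<close> implies the second; if s_a x > x, as in
  \<open>lifting_ascent\<close>, the second implies the first.\<close>

lemma lifting_descent:
  assumes "x \<preceq> w" "a \<in> B" "len (refl a \<circ> x) < len x"
  shows "refl a \<circ> x \<preceq> refl a \<circ> w"
  using bruhat_mult_down[OF assms(1,2)] bruhat_left'[OF assms(2) _ assms(3)] assms bruhat_weyl bruhat_trans
  by blast

lemma lifting_ascent: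
  assumes "x \<preceq> w" "a \<in> B" "len x < len (refl a \<circ> x)"
  shows "x \<preceq> refl a \<circ> w"
  using bruhat_mult_down[OF assms(1,2)] bruhat_left[OF assms(2) _ assms(3)] assms bruhat_weyl bruhat_trans
  by blast

lemma bruhat_Cons:
  assumes "red (a # ws)"
  shows "wprod ws \<preceq> wprod (a # ws)"
proof -
  have r: "red ws" "a \<in> B" using reduced_ConsD assms by auto
  have "wprod ws \<in> weyl B" using reduced_B[OF r(1)] by simp
  then show ?thesis unfolding wprod_Cons
    using assms reduced_Cons_iff[OF r] r by (intro bruhat_left) auto
qed

text \<open>Prefixing a letter to both words may leave the product below the old word instead of the
  new one, by \<open>bruhat_mult_up\<close>; either way it is below the new word. The subword itself
  may fail to be reduced.\<close>

lemma subword_bruhat: "subseq us ws \<Longrightarrow> red ws \<Longrightarrow> wprod us \<preceq> wprod ws"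
proof (induction us ws rule: list_emb.induct)
  case (list_emb_Nil ys)
  have "red ys \<Longrightarrow> id \<preceq> wprod ys"
  proof (induction ys)
    case (Cons y ys)
    show ?case by (rule bruhat_trans[OF Cons.IH[OF reduced_ConsD(1)[OF Cons.prems]] bruhat_Cons[OF Cons.prems]])
  qed (use weyl_id in simp)
  then show ?case using list_emb_Nil unfolding wprod_Nil .
next
  case (list_emb_Cons xs ys y)
  show ?case
    by (rule bruhat_trans[OF list_emb_Cons.IH[OF reduced_ConsD(1)[OF list_emb_Cons.prems]]
        bruhat_Cons[OF list_emb_Cons.prems]])
next
  case (list_emb_Cons2 x y xs ys)
  have r: "red ys" "y \<in> B" using reduced_ConsD list_emb_Cons2.prems by auto
  have "wprod (x # xs) \<preceq> wprod ys \<or> wprod (x # xs) \<preceq> wprod (y # ys)"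
    using bruhat_mult_up[OF list_emb_Cons2.IH[OF r(1)] r(2)] list_emb_Cons2.hyps by (simp only: wprod_Cons)
  then show ?case using bruhat_trans[OF _ bruhat_Cons[OF list_emb_Cons2.prems]] by blast
qed

end

section \<open>Monotone deletions\<close>

lemma del_pos_append:
  "del_pos (us @ vs) I = del_pos us I @ del_pos vs {i. i + length us \<in> I}"
  by (induction us arbitrary: I) (simp_all add: del_pos_Cons)

lemma del_pos_cong: "(\<And>i. i < length ws \<Longrightarrow> i \<in> I \<longleftrightarrow> i \<in> J) \<Longrightarrow> del_pos ws I = del_pos ws J"
proof (induction ws arbitrary: I J)
  case (Cons a ws)
  have "del_pos ws {i. Suc i \<in> I} = del_pos ws {i. Suc i \<in> J}"
    using Cons.prems by (intro Cons.IH) auto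
  then show ?case using Cons.prems[of 0] by (simp add: del_pos_Cons)
qed simp

lemma set_subseq_subset: "subseq us vs \<Longrightarrow> set us \<subseteq> set vs"
  by (metis notin_set_nthsI subseq_conv_nths subsetI)

text \<open>Reversing a word inverts its product and exchanges deletion from the left with deletion
  from the right; \<open>mirror\<close> carries the positions along.\<close>

definition mirror :: "nat \<Rightarrow> nat set \<Rightarrow> nat set" where
  "mirror n I = {i. i < n \<and> n - Suc i \<in> I}"

lemma mirror_mirror: "I \<subseteq> {..<n} \<Longrightarrow> mirror n (mirror n I) = I"
  by (auto simp: mirror_def)

lemma mirror_subset: "mirror n I \<subseteq> {..<n}"
  by (auto simp: mirror_def)

lemma del_pos_rev: "del_pos (rev ws) I = rev (del_pos ws (mirror (length ws) I))"
proof (induction ws)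
  case (Cons a ws)
  have "{i. Suc i \<in> mirror (Suc (length ws)) I} = mirror (length ws) I"
    by (auto simp: mirror_def)
  moreover have "0 \<in> mirror (Suc (length ws)) I \<longleftrightarrow> length ws \<in> I"
    by (simp add: mirror_def)
  ultimately show ?case
    using Cons by (simp add: del_pos_append del_pos_Cons)
qed simp

lemma shift_atLeast: "{i. Suc i \<in> I \<inter> {Suc j..}} = {i. Suc i \<in> I} \<inter> {j..}"
  by auto

lemma shift_lessThan: "{i. Suc i \<in> I \<inter> {..<Suc j}} = {i. Suc i \<in> I} \<inter> {..<j}"
  by auto

lemma shift_subset: "I \<subseteq> {..<Suc n} \<Longrightarrow> {i. Suc i \<in> I} \<subseteq> {..<n}"
  by auto

lemma eq_of_shift_eq:
  assumes "0 \<in> I \<longleftrightarrow> 0 \<in> J" "{i. Suc i \<in> I} = {i. Suc i \<in> J}"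
  shows "I = J"
proof (rule set_eqI)
  fix i show "i \<in> I \<longleftrightarrow> i \<in> J" using assms by (cases i) auto
qed

text \<open>Together with \<open>sorted_gt_ex\<close>: the prefixes of a decreasing list are the
  upper segments of its set. This trades the prefixes of a chain label for the cutoffs in
  \<open>dec_deletable\<close>.\<close>

lemma sorted_gt_take:
  "sorted_wrt (>) ls \<Longrightarrow> k \<le> length ls \<Longrightarrow> \<exists>j. set (take k ls) = set ls \<inter> {j..}" for ls :: "nat list"
proof (induction ls arbitrary: k)
  case (Cons a ls)
  show ?case
  proof (cases k)
    case 0
    have "set (a # ls) \<inter> {Suc a..} = {}" using Cons.prems(1) by force
    then show ?thesis using 0 by (intro exI[of _ "Suc a"]) simp
  next
    case (Suc k')
    then obtain j where j: "set (take k' ls) = set ls \<inter> {j..}" using Cons by fastforce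
    have "set ls \<inter> {a..} = {}" using Cons.prems(1) by force
    then show ?thesis using j Suc by (intro exI[of _ "min j a"]) (auto simp: min_def)
  qed
qed simp

lemma sorted_gt_ex:
  "sorted_wrt (>) ls \<Longrightarrow> \<exists>k\<le>length ls. set ls \<inter> {j..} = set (take k ls)" for ls :: "nat list"
proof (induction ls)
  case (Cons a ls)
  show ?case
  proof (cases "j \<le> a")
    case True
    obtain k where "k \<le> length ls" "set ls \<inter> {j..} = set (take k ls)" using Cons by auto
    then show ?thesis using True by (intro exI[of _ "Suc k"]) auto
  next
    case False
    then show ?thesis using Cons.prems by (intro exI[of _ 0]) force
  qed
qed simp

lemma sorted_lt_take:
  "sorted_wrt (<) ls \<Longrightarrow> k \<le> length ls \<Longrightarrow> \<exists>j. set (take k ls) = set ls \<inter> {..<j}" for ls :: "nat list"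
proof (induction ls arbitrary: k)
  case (Cons a ls)
  show ?case
  proof (cases k)
    case 0
    have "set (a # ls) \<inter> {..<a} = {}" using Cons.prems(1) by force
    then show ?thesis using 0 by (intro exI[of _ a]) simp
  next
    case (Suc k')
    then obtain j where j: "set (take k' ls) = set ls \<inter> {..<j}" using Cons by fastforce
    have "set ls \<inter> {..<Suc a} = {}" using Cons.prems(1) by force
    then have "insert a (set ls \<inter> {..<j}) = set (a # ls) \<inter> {..<max j (Suc a)}"
      by (cases "j \<le> a") auto
    then show ?thesis using j Suc by (intro exI[of _ "max j (Suc a)"]) simp
  qed
qed simp

lemma sorted_lt_ex:
  "sorted_wrt (<) ls \<Longrightarrow> \<exists>k\<le>length ls. set ls \<inter> {..<j} = set (take k ls)" for ls :: "nat list"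
proof (induction ls)
  case (Cons a ls)
  show ?case
  proof (cases "a < j")
    case True
    obtain k where "k \<le> length ls" "set ls \<inter> {..<j} = set (take k ls)" using Cons by auto
    then show ?thesis using True by (intro exI[of _ "Suc k"]) auto
  next
    case False
    then show ?thesis using Cons.prems by (intro exI[of _ 0]) force
  qed
qed simp

section \<open>Decreasing and increasing deletions through reduced words\<close>

context based_root_system
begin

text \<open>Letters are deleted from the right end. The cutoff \<open>j\<close> is the stage at
  which the positions of \<open>I\<close> from \<open>j\<close> on are gone; cutoff 0 is the
  complete deletion.\<close>

definition dec_deletable :: "'a list \<Rightarrow> nat set \<Rightarrow> bool" where
  "dec_deletable ws I \<longleftrightarrow> I \<subseteq> {..<length ws} \<and> (\<forall>j. red (del_pos ws (I \<inter> {j..})))"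

definition inc_deletable :: "'a list \<Rightarrow> nat set \<Rightarrow> bool" where
  "inc_deletable ws I \<longleftrightarrow> I \<subseteq> {..<length ws} \<and> (\<forall>j. red (del_pos ws (I \<inter> {..<j})))"

lemma dec_red: "dec_deletable ws I \<Longrightarrow> red (del_pos ws I)"
  unfolding dec_deletable_def by (metis Int_UNIV_right atLeast_0)

text \<open>At cutoff 1 the first letter is still present, even if it is deleted in the end. So it
  lengthens what is kept of the tail, which is the condition of a distinguished
  subexpression.\<close>

lemma dec_ConsD:
  assumes "dec_deletable (a # ws) I"
  shows "dec_deletable ws {i. Suc i \<in> I}" "red (a # del_pos ws {i. Suc i \<in> I})"
proof -
  have r: "red (a # del_pos ws ({i. Suc i \<in> I} \<inter> {j..}))" for j
  proof -
    have "red (del_pos (a # ws) (I \<inter> {Suc j..}))" using assms by (simp add: dec_deletable_def)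
    then show ?thesis by (simp only: del_pos_Cons shift_atLeast) simp
  qed
  show "red (a # del_pos ws {i. Suc i \<in> I})" using r[of 0] by simp
  show "dec_deletable ws {i. Suc i \<in> I}"
    using assms reduced_ConsD(1)[OF r] shift_subset[of I "length ws"] by (simp add: dec_deletable_def)
qed

lemma dec_ConsI:
  assumes "I \<subseteq> {..<Suc (length ws)}" "red (del_pos (a # ws) I)"
    "\<And>j. red (a # del_pos ws ({i. Suc i \<in> I} \<inter> {j..}))"
  shows "dec_deletable (a # ws) I"
  unfolding dec_deletable_def
proof (intro conjI allI)
  fix j
  show "red (del_pos (a # ws) (I \<inter> {j..}))"
  proof (cases j)
    case 0 then show ?thesis using assms(2) by simp
  next
    case (Suc k)
    then show ?thesis using assms(3)[of k] by (simp only: del_pos_Cons shift_atLeast) simp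
  qed
qed (use assms in simp)

text \<open>Reinserting a deleted letter \<open>a\<close> between a full prefix \<open>v\<close> and the remaining part \<open>u\<close> of the
  suffix multiplies by a reflection in a root that both \<open>v a > v\<close> and \<open>a u > u\<close> force to increase the
  length.\<close>
lemma len_reinsert:
  assumes "red (v @ [a])" "red (a # us)"
  shows "len (wprod (v @ us)) < len (wprod (v @ a # us))"
proof -
  let ?y = "wprod v" and ?u = "wprod us"
  have B: "set v \<subseteq> B" "a \<in> B" "set us \<subseteq> B" using reduced_B[OF assms(1)] reduced_B[OF assms(2)] by auto
  then have W: "?y \<in> weyl B" "?u \<in> weyl B" "inv ?u \<in> weyl B" by (simp_all add: weyl_inv)
  have b: "inv ?u a \<in> R" using W B weyl_R by blast
  have lu: "len ?u < len (refl a \<circ> ?u)"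
    using reduced_Cons_iff[OF reduced_ConsD(1)[OF assms(2)] B(2)] assms(2) by simp
  then have "\<not> ht (inv ?u a) < 0" using left_descent_iff[OF W(2) B(2)] by linarith
  then have p1: "ht (inv ?u a) > 0" using ht_nonzero[OF b] by linarith
  have "len (?y \<circ> refl a) = Suc (len ?y)"
    using reduced_len[OF assms(1)] reduced_len[OF reduced_appendD(1)[OF assms(1)]] by simp
  then have "\<not> ht (?y a) < 0" using len_refl_less[OF W(1), of a] B by auto
  then have p2: "ht (?y a) > 0" using ht_nonzero[OF wprod_R[OF B(1), of a]] B by auto
  have "len (?y \<circ> ?u) < len (?y \<circ> ?u \<circ> refl (inv ?u a))"
    using W b p1 p2 by (intro len_refl_greater) (auto intro: weyl_comp)
  then show ?thesis using left_eq_right[OF W(2), of a] by (simp add: comp_assoc)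
qed

text \<open>It suffices to test the last stage behind a full prefix. The first letter of
  \<open>ws\<close> is moved into the prefix; if it is a deleted letter, \<open>len_reinsert\<close>
  shows that putting it back lengthens the product, so the longer word is reduced and the induction
  continues.\<close>

lemma dec_prefix:
  assumes "dec_deletable ws I" "red (v @ ws)" "red (v @ del_pos ws I)"
  shows "red (v @ del_pos ws (I \<inter> {j..}))"
  using assms
proof (induction ws arbitrary: v I j)
  case (Cons a ws)
  let ?I = "{i. Suc i \<in> I}"
  note D = dec_ConsD[OF Cons.prems(1)]
  have pre: "red (v @ [a])" using Cons.prems(2) reduced_appendD(1)[of "v @ [a]" ws] by simp
  show ?case
  proof (cases j)
    case 0 then show ?thesis using Cons.prems(3) by simp
  next
    case (Suc k)
    have "red ((v @ [a]) @ del_pos ws ?I)"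
    proof (cases "0 \<in> I")
      case True
      then have r: "red (v @ del_pos ws ?I)" using Cons.prems(3) by (simp add: del_pos_Cons)
      have "set (v @ a # del_pos ws ?I) \<subseteq> B" using reduced_B[OF D(2)] reduced_B[OF pre] by auto
      then have "red (v @ a # del_pos ws ?I)"
        using len_reinsert[OF pre D(2)] reduced_len[OF r] by (intro reducedI) simp_all
      then show ?thesis by simp
    next
      case False
      then show ?thesis using Cons.prems(3) by (simp add: del_pos_Cons)
    qed
    then have "red ((v @ [a]) @ del_pos ws (?I \<inter> {k..}))"
      using D(1) Cons.prems(2) by (intro Cons.IH) simp_all
    then show ?thesis using Suc by (simp only: del_pos_Cons shift_atLeast) simp
  qed
qed simp

text \<open>A greedy choice: if s_a x > x, then x lies below the tail and the first letter is
  deleted; otherwise s_a x lies below the tail and the letter is kept. In both cases the letter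
  lengthens the part kept of the tail, so \<open>dec_prefix\<close> with the prefix
  \<open>[a]\<close> gives the intermediate stages.\<close>

lemma dec_exists:
  assumes "red ws" "x \<preceq> wprod ws"
  shows "\<exists>I. dec_deletable ws I \<and> wprod (del_pos ws I) = x"
  using assms
proof (induction ws arbitrary: x)
  case Nil
  then have "x \<preceq> id" unfolding wprod_Nil by blast
  then have "x = id" using bruhat_len[of x id] reduced_len[of "[]"] by auto
  then show ?case by (intro exI[of _ "{}"]) (simp add: dec_deletable_def)
next
  case (Cons a ws)
  have r: "red ws" and a: "a \<in> B" using reduced_ConsD Cons.prems by auto
  have x: "x \<in> weyl B" using Cons.prems bruhat_weyl by blast
  have e: "refl a \<circ> wprod (a # ws) = wprod ws" by simp
  have dec_a: "red (a # del_pos ws I) \<Longrightarrow> red (a # del_pos ws (I \<inter> {j..}))" if "dec_deletable ws I" for I j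
    using dec_prefix[of ws I "[a]" j] that Cons.prems(1) by simp
  show ?case
  proof (rule left_len_cases[OF x a])
    assume l: "len (refl a \<circ> x) = Suc (len x)"
    then have "x \<preceq> wprod ws" using lifting_ascent[OF Cons.prems(2) a] unfolding e by simp
    then obtain I where I: "dec_deletable ws I" "wprod (del_pos ws I) = x" using Cons.IH[OF r] by blast
    let ?J = "insert 0 (Suc ` I)"
    have s: "{i. Suc i \<in> ?J} = I" by auto
    have ra: "red (a # del_pos ws I)"
      using reduced_Cons_iff[OF dec_red[OF I(1)] a] I l by simp
    have "dec_deletable (a # ws) ?J"
    proof (rule dec_ConsI)
      show "?J \<subseteq> {..<Suc (length ws)}" using I(1) by (auto simp: dec_deletable_def)
      show "red (del_pos (a # ws) ?J)" using dec_red[OF I(1)] by (simp only: del_pos_Cons s) simp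
    qed (simp only: s dec_a[OF I(1) ra])
    moreover have "wprod (del_pos (a # ws) ?J) = x" using I by (simp only: del_pos_Cons s) simp
    ultimately show ?thesis by blast
  next
    assume l: "len x = Suc (len (refl a \<circ> x))"
    then have "refl a \<circ> x \<preceq> wprod ws" using lifting_descent[OF Cons.prems(2) a] unfolding e by simp
    then obtain I where I: "dec_deletable ws I" "wprod (del_pos ws I) = refl a \<circ> x" using Cons.IH[OF r] by blast
    let ?J = "Suc ` I"
    have s: "{i. Suc i \<in> ?J} = I" by auto
    have ra: "red (a # del_pos ws I)"
      using reduced_Cons_iff[OF dec_red[OF I(1)] a] I l by simp
    have "dec_deletable (a # ws) ?J"
    proof (rule dec_ConsI)
      show "?J \<subseteq> {..<Suc (length ws)}" using I(1) by (auto simp: dec_deletable_def)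
      show "red (del_pos (a # ws) ?J)" using ra by (simp only: del_pos_Cons s) simp
    qed (simp only: s dec_a[OF I(1) ra])
    moreover have "wprod (del_pos (a # ws) ?J) = x" using I by (simp only: del_pos_Cons s) simp
    ultimately show ?thesis by blast
  qed
qed

text \<open>With u the part kept of the tail, s_a u > u holds by \<open>dec_ConsD\<close>, and x is
  u or s_a u according to whether the letter is deleted.\<close>

lemma dec_zero_iff:
  assumes "dec_deletable (a # ws) I" "x = wprod (del_pos (a # ws) I)"
  shows "0 \<in> I \<longleftrightarrow> len x < len (refl a \<circ> x)"
proof -
  note D = dec_ConsD[OF assms(1)]
  let ?u = "wprod (del_pos ws {i. Suc i \<in> I})"
  have lt: "len ?u < len (refl a \<circ> ?u)"
    using reduced_Cons_iff[OF reduced_ConsD(1)[OF D(2)] reduced_ConsD(2)[OF D(2)]] D(2) by simp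
  show ?thesis
  proof (cases "0 \<in> I")
    case True
    then have "x = ?u" using assms(2) by (simp add: del_pos_Cons)
    then show ?thesis using lt True by simp
  next
    case False
    then have "x = refl a \<circ> ?u" using assms(2) by (simp add: del_pos_Cons)
    then show ?thesis using lt False by simp
  qed
qed

text \<open>By \<open>dec_zero_iff\<close> the product alone decides whether the first letter is
  deleted; then the tail is treated in the same way.\<close>

lemma dec_unique:
  assumes "dec_deletable ws I" "dec_deletable ws J" "wprod (del_pos ws I) = wprod (del_pos ws J)"
  shows "I = J"
  using assms
proof (induction ws arbitrary: I J)
  case Nil then show ?case by (simp add: dec_deletable_def)
next
  case (Cons a ws)
  have z: "0 \<in> I \<longleftrightarrow> 0 \<in> J"
    using dec_zero_iff[OF Cons.prems(1) refl] dec_zero_iff[OF Cons.prems(2) Cons.prems(3)] by simp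
  have "wprod (del_pos ws {i. Suc i \<in> I}) = wprod (del_pos ws {i. Suc i \<in> J})"
  proof (cases "0 \<in> I")
    case True
    then show ?thesis using Cons.prems(3) z by (simp add: del_pos_Cons)
  next
    case False
    then have "refl a \<circ> wprod (del_pos ws {i. Suc i \<in> I}) = refl a \<circ> wprod (del_pos ws {i. Suc i \<in> J})"
      using Cons.prems(3) z by (simp add: del_pos_Cons fun_eq_iff)
    then show ?thesis by (metis refl_comp_left)
  qed
  then have "{i. Suc i \<in> I} = {i. Suc i \<in> J}"
    by (intro Cons.IH dec_ConsD(1)[OF Cons.prems(1)] dec_ConsD(1)[OF Cons.prems(2)])
  then show ?case by (rule eq_of_shift_eq[OF z])
qed

text \<open>The inverse of y s_\<beta> is obtained from the inverse of y by right multiplication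
  with the reflection in the root \<open>y \<beta>\<close>, and inversion preserves length.\<close>

lemma bruhat_inv:
  assumes "x \<preceq> w" shows "inv x \<preceq> inv w"
proof -
  have inv_step: "inv y \<preceq> inv z" if "bstep y z" "y \<in> weyl B" for y z
  proof -
    obtain \<beta> where b: "\<beta> \<in> R" "z = y \<circ> refl \<beta>" "len y < len z"
      using \<open>bstep y z\<close> unfolding bstep_def by blast
    have z: "z \<in> weyl B" using that bstep_weyl by blast
    have "inv z = refl \<beta> \<circ> inv y"
      using b(2) that(2) by (intro inv_equality) simp_all
    also have "\<dots> = inv y \<circ> refl (y \<beta>)"
      using left_eq_right[OF weyl_inv[OF that(2)], of \<beta>] that(2) by (simp add: inv_inv_eq weyl_bij)
    finally have "bstep (inv y) (inv z)"
      unfolding bstep_def using b len_inv z that(2) weyl_R by metis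
    then show ?thesis using bstep_bruhat weyl_inv that(2) by blast
  qed
  have x: "x \<in> weyl B" and "bstep\<^sup>*\<^sup>* x w" using assms by (auto simp: bruhat_bstep)
  from this(2) show ?thesis
  proof induction
    case base show ?case by (rule bruhat_refl[OF weyl_inv[OF x]])
  next
    case (step y z)
    have "y \<in> weyl B" using step.hyps(1) by induction (use x bstep_weyl in blast)+
    then show ?case using bruhat_trans[OF step.IH inv_step[OF step.hyps(2)]] by blast
  qed
qed

lemma inc_imp_dec_rev:
  assumes "inc_deletable ws I" shows "dec_deletable (rev ws) (mirror (length ws) I)"
  unfolding dec_deletable_def
proof (intro conjI allI)
  let ?n = "length ws"
  fix j
  have "del_pos (rev ws) (mirror ?n I \<inter> {j..}) = rev (del_pos ws (I \<inter> {..<?n - j}))"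
    unfolding del_pos_rev by (intro arg_cong[where f = rev] del_pos_cong) (auto simp: mirror_def)
  then show "red (del_pos (rev ws) (mirror ?n I \<inter> {j..}))"
    using assms reduced_rev by (simp add: inc_deletable_def)
qed (use mirror_subset in simp)

lemma dec_rev_imp_inc:
  assumes "dec_deletable (rev ws) K" shows "inc_deletable ws (mirror (length ws) K)"
  unfolding inc_deletable_def
proof (intro conjI allI)
  let ?n = "length ws"
  fix j
  have "rev (del_pos (rev ws) (K \<inter> {?n - j..})) = del_pos ws (mirror ?n K \<inter> {..<j})"
    unfolding del_pos_rev rev_rev_ident by (intro del_pos_cong) (auto simp: mirror_def)
  then show "red (del_pos ws (mirror ?n K \<inter> {..<j}))"
    using assms reduced_rev by (metis dec_deletable_def)
qed (rule mirror_subset)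

text \<open>\<open>dec_exists\<close> for the inverse element and the reversed word.\<close>

lemma inc_exists:
  assumes "red ws" "x \<preceq> wprod ws"
  shows "\<exists>I. inc_deletable ws I \<and> wprod (del_pos ws I) = x"
proof -
  have x: "x \<in> weyl B" using assms bruhat_weyl by blast
  obtain K where K: "dec_deletable (rev ws) K" "wprod (del_pos (rev ws) K) = inv x"
    using dec_exists[OF reduced_rev[OF assms(1)]] bruhat_inv[OF assms(2)] inv_wprod by metis
  let ?I = "mirror (length ws) K"
  have "inv x = inv (wprod (del_pos ws ?I))" using K(2) by (simp add: del_pos_rev inv_wprod)
  then have "wprod (del_pos ws ?I) = x"
    using x by (metis inv_inv_eq inv_wprod rev_rev_ident weyl_bij)
  then show ?thesis using dec_rev_imp_inc[OF K(1)] by blast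
qed

lemma inc_unique:
  assumes "inc_deletable ws I" "inc_deletable ws J" "wprod (del_pos ws I) = wprod (del_pos ws J)"
  shows "I = J"
proof -
  let ?n = "length ws"
  have m: "mirror ?n (mirror ?n I) = I" "mirror ?n (mirror ?n J) = J"
    using assms mirror_mirror by (auto simp: inc_deletable_def)
  have "wprod (del_pos (rev ws) (mirror ?n I)) = wprod (del_pos (rev ws) (mirror ?n J))"
    unfolding del_pos_rev m inv_wprod[symmetric] assms(3) ..
  then have "mirror ?n I = mirror ?n J"
    using dec_unique inc_imp_dec_rev assms by blast
  then show ?thesis using m by metis
qed

lemma inc_ConsD:
  assumes "inc_deletable (a # ws) I" shows "inc_deletable ws {i. Suc i \<in> I}"
  unfolding inc_deletable_def
proof (intro conjI allI)
  fix j
  have "red (del_pos (a # ws) (I \<inter> {..<Suc j}))" using assms unfolding inc_deletable_def by blast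
  then show "red (del_pos ws ({i. Suc i \<in> I} \<inter> {..<j}))"
    unfolding del_pos_Cons shift_lessThan by (rule reduced_appendD(2))
qed (use assms shift_subset in \<open>simp add: inc_deletable_def\<close>)

text \<open>The empty stage is the reduced word itself, and every later stage is a stage of the
  tail. This is how an element below the tail receives an increasing deletion that removes the first
  letter.\<close>

lemma inc_insert_0:
  assumes "inc_deletable ws I" "red (a # ws)" shows "inc_deletable (a # ws) (insert 0 (Suc ` I))"
  unfolding inc_deletable_def
proof (intro conjI allI)
  fix j
  have s: "{i. Suc i \<in> insert 0 (Suc ` I)} = I" by auto
  show "red (del_pos (a # ws) (insert 0 (Suc ` I) \<inter> {..<j}))"
  proof (cases j)
    case 0 then show ?thesis using assms(2) by simp
  next
    case (Suc k)
    have "red (del_pos ws (I \<inter> {..<k}))" using assms(1) by (simp add: inc_deletable_def)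
    then show ?thesis unfolding Suc del_pos_Cons shift_lessThan s by simp
  qed
qed (use assms in \<open>auto simp: inc_deletable_def\<close>)

section \<open>Labels of maximal chains\<close>

text \<open>The first deletion on the decreasing way from y down to x gives an element of length one
  less that lies between them; in a cover it must be x.\<close>

lemma cover_len:
  assumes "bruhat_cover R B y x" shows "len y = Suc (len x)"
proof -
  have xy: "x \<preceq> y" "x \<noteq> y" and none: "\<And>z. x \<preceq> z \<Longrightarrow> z \<preceq> y \<Longrightarrow> z = x \<or> z = y"
    using assms by (auto simp: bruhat_cover_def)
  obtain ws where ws: "red ws" "wprod ws = y" using reduced_exists bruhat_weyl xy by blast
  obtain I where I: "dec_deletable ws I" "wprod (del_pos ws I) = x" using dec_exists ws xy by blast
  have f: "finite I" "I \<subseteq> {..<length ws}" using I(1) finite_subset by (auto simp: dec_deletable_def)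
  have "I \<noteq> {}" using I ws xy by auto
  let ?m = "Max I"
  have m: "?m \<in> I" using f \<open>I \<noteq> {}\<close> by simp
  \<comment> \<open>The stage with cutoff \<open>Max I\<close> removes exactly one letter.\<close>
  have "I \<inter> {?m..} = {?m}" using f m Max_ge[OF f(1)] by (auto intro: antisym)
  then have r: "red (del_pos ws {?m})" using I(1) unfolding dec_deletable_def by metis
  let ?z = "wprod (del_pos ws {?m})"
  have zy: "?z \<preceq> y" using subword_bruhat[OF subseq_del_pos ws(1)] ws(2) by blast
  have xz: "x \<preceq> ?z" using subword_bruhat[OF subseq_del_pos_mono r, of I] m I by auto
  have l: "Suc (len ?z) = len y"
    using length_del_pos[of "{?m}" ws] m f reduced_len[OF r] reduced_len[OF ws(1)] ws(2) by auto
  then have "?z = x" using none[OF xz zy] by auto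
  then show ?thesis using l by simp
qed

lemma cover_of_len:
  assumes "x \<preceq> y" "len y = Suc (len x)" shows "bruhat_cover R B y x"
proof -
  have "x \<noteq> y" using assms by auto
  moreover have "z = x \<or> z = y" if "x \<preceq> z" "z \<preceq> y" for z
    using bruhat_len[OF that(1)] bruhat_len[OF that(2)] assms(2) by auto
  ultimately show ?thesis using assms(1) unfolding bruhat_cover_def by blast
qed

text \<open>Lengths in a cover differ by one, so the last step of a chain of reflections from x to y
  is already the whole chain. The root is then replaced by its negative if necessary.\<close>

lemma cover_reflection:
  assumes "bruhat_cover R B y x"
  obtains \<beta> where "\<beta> \<in> R" "ht \<beta> > 0" "ht (y \<beta>) < 0" "x = y \<circ> refl \<beta>"
proof -
  have l: "len y = Suc (len x)" using cover_len assms by blast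
  have "x \<noteq> y" and x: "x \<in> weyl B" and y: "y \<in> weyl B" and "bstep\<^sup>*\<^sup>* x y"
    using assms by (auto simp: bruhat_cover_def bruhat_bstep)
  then obtain z where z: "bstep\<^sup>*\<^sup>* x z" "bstep z y" by (metis rtranclp.cases)
  have "z \<in> weyl B" using bstep_weyl' z y by blast
  then have "x \<preceq> z" using z x by (simp add: bruhat_bstep)
  moreover have "len z < len y" using z by (auto simp: bstep_def)
  ultimately have "x = z" using bruhat_len[of x z] l by auto
  then obtain \<beta> where b: "\<beta> \<in> R" "y = x \<circ> refl \<beta>" using z by (auto simp: bstep_def)
  obtain \<gamma> where g: "\<gamma> \<in> R" "ht \<gamma> > 0" "y = x \<circ> refl \<gamma>"
  proof (cases "ht \<beta> > 0")
    case True then show thesis using b that by blast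
  next
    case False then show thesis using b that[of "-\<beta>"] uminus_R ht_nonzero[OF b(1)] by auto
  qed
  have e: "x = y \<circ> refl \<gamma>" unfolding g(3) comp_assoc by simp
  have yg: "y \<gamma> \<in> R" using weyl_R y g by blast
  have "\<not> ht (y \<gamma>) > 0" using len_refl_greater[OF y g(1,2)] l unfolding e[symmetric] by linarith
  then have "ht (y \<gamma>) < 0" using ht_nonzero[OF yg] by linarith
  then show thesis using that g e by blast
qed

text \<open>These are the labels of saturated chains: as all stages are reduced, each deletion
  lowers the length by exactly one.\<close>

definition good :: "'a list \<Rightarrow> nat list \<Rightarrow> bool" where
  "good ws ls \<longleftrightarrow> distinct ls \<and> set ls \<subseteq> {..<length ws} \<and>
     (\<forall>k\<le>length ls. red (del_pos ws (set (take k ls))))"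

definition chain_of :: "'a list \<Rightarrow> nat list \<Rightarrow> ('a \<Rightarrow> 'a) list" where
  "chain_of ws ls = map (\<lambda>k. wprod (del_pos ws (set (take k ls)))) [0..<Suc (length ls)]"

text \<open>The body of the description in \<open>chain_label\<close>.\<close>

definition is_label :: "'a list \<Rightarrow> ('a \<Rightarrow> 'a) list \<Rightarrow> nat list \<Rightarrow> bool" where
  "is_label ws cs ls \<longleftrightarrow> length ls + 1 = length cs \<and> distinct ls \<and> set ls \<subseteq> {..<length ws} \<and>
      (\<forall>k\<le>length ls. cs ! k = wprod (del_pos ws (set (take k ls))))"

text \<open>At the first place where the two deletions differ, one removes the letter a and the
  other a later letter. Cancelling would express a reduced product of a and the rest by a word with
  fewer letters, which is the fact \<open>no\<close>.\<close>

lemma del_unique: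
  assumes "red (del_pos ws S)" "p < length ws" "q < length ws" "p \<notin> S" "q \<notin> S"
    "wprod (del_pos ws (insert p S)) = wprod (del_pos ws (insert q S))"
  shows "p = q"
  using assms
proof (induction ws arbitrary: S p q)
  case (Cons a ws)
  let ?S = "{i. Suc i \<in> S}"
  have s0: "{i. Suc i \<in> insert 0 S} = ?S" by auto
  have s: "{i. Suc i \<in> insert (Suc k) S} = insert k ?S" for k by auto
  have e: "wprod (del_pos (a # ws) T) = (if 0 \<in> T then id else refl a) \<circ> wprod (del_pos ws {i. Suc i \<in> T})"
    for T by (simp add: del_pos_Cons)
  have rS: "red (del_pos ws ?S)"
    using Cons.prems(1) unfolding del_pos_Cons by (rule reduced_appendD(2))
  have no: False
    if "0 \<notin> S" "k < length ws" "k \<notin> ?S"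
      "wprod (del_pos ws ?S) = refl a \<circ> wprod (del_pos ws (insert k ?S))" for k
  proof -
    have r: "red (a # del_pos ws ?S)" using Cons.prems(1) that(1) by (simp add: del_pos_Cons)
    have sb: "subseq (del_pos ws (insert k ?S)) (del_pos ws ?S)"
      by (rule subseq_del_pos_mono) blast
    have "wprod (a # del_pos ws ?S) = wprod (del_pos ws (insert k ?S))" using that(4) by simp
    then have "Suc (length (del_pos ws ?S)) \<le> length (del_pos ws (insert k ?S))"
      using reduced_len[OF r] len_le[OF subset_trans[OF set_subseq_subset[OF sb] reduced_B[OF rS]]] by simp
    moreover have "length (del_pos ws (insert k ?S)) \<le> length (del_pos ws ?S)"
      by (rule list_emb_length[OF sb])
    ultimately show False by simp
  qed
  show ?case
  proof (cases p)
    case 0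
    show ?thesis
    proof (cases q)
      case (Suc k)
      have z: "0 \<notin> S" using Cons.prems(4) 0 by simp
      have "wprod (del_pos ws ?S) = refl a \<circ> wprod (del_pos ws (insert k ?S))"
        using Cons.prems(6) z unfolding 0 Suc e s s0 by (simp add: fun_eq_iff)
      then show ?thesis using no[of k] z Suc Cons.prems(3,5) by simp
    qed (use 0 in simp)
  next
    case p: (Suc k)
    show ?thesis
    proof (cases q)
      case 0
      have z: "0 \<notin> S" using Cons.prems(5) 0 by simp
      have "wprod (del_pos ws ?S) = refl a \<circ> wprod (del_pos ws (insert k ?S))"
        using Cons.prems(6) z unfolding 0 p e s s0 by (simp add: fun_eq_iff)
      then show ?thesis using no[of k] z p Cons.prems(2,4) by simp
    next
      case q: (Suc l)
      have "wprod (del_pos ws (insert k ?S)) = wprod (del_pos ws (insert l ?S))"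
        using Cons.prems(6) unfolding p q e s
        by (cases "0 \<in> S") (simp_all add: fun_eq_iff, metis refl_refl)
      then have "k = l" using Cons.prems p q rS by (intro Cons.IH[of ?S]) auto
      then show ?thesis using p q by simp
    qed
  qed
qed simp

lemma set_take_Suc: "k < length ls \<Longrightarrow> set (take (Suc k) ls) = insert (ls ! k) (set (take k ls))"
  by (simp add: take_Suc_conv_app_nth)

lemma nth_notin_take: "distinct ls \<Longrightarrow> k < length ls \<Longrightarrow> ls ! k \<notin> set (take k ls)"
  by (auto simp: in_set_conv_nth nth_eq_iff_index_eq)

text \<open>Prefixes are compared one by one: the competing label need not be known to be
  \<open>good\<close>, because its prefix already agrees with that of \<open>ls\<close> when
  \<open>del_unique\<close> is applied.\<close>

lemma label_unique:
  assumes "good ws ls" "is_label ws cs ls" "is_label ws cs ls'"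
  shows "ls' = ls"
proof -
  have len: "length ls' = length ls" using assms by (simp add: is_label_def)
  have "take k ls' = take k ls" if "k \<le> length ls" for k
    using that
  proof (induction k)
    case (Suc k)
    let ?S = "set (take k ls)"
    have k: "k < length ls" "k < length ls'" using Suc len by auto
    have IH: "take k ls' = take k ls" using Suc by simp
    have "wprod (del_pos ws (insert (ls' ! k) ?S)) = wprod (del_pos ws (insert (ls ! k) ?S))"
      using assms(2,3) set_take_Suc[OF k(1)] set_take_Suc[OF k(2)] IH Suc.prems len
      unfolding is_label_def by metis
    moreover have "red (del_pos ws ?S)" using assms(1) k by (simp add: good_def)
    moreover have "ls ! k \<notin> ?S" "ls' ! k \<notin> ?S"
      using nth_notin_take[of ls k] nth_notin_take[of ls' k] assms k IH by (auto simp: is_label_def)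
    moreover have "ls ! k < length ws" "ls' ! k < length ws"
      using assms(2,3) nth_mem[OF k(1)] nth_mem[OF k(2)] unfolding is_label_def by blast+
    ultimately have "ls' ! k = ls ! k" using del_unique by blast
    then show ?case using IH k by (simp add: take_Suc_conv_app_nth)
  qed simp
  from this[of "length ls"] show ?thesis using len by simp
qed

lemma chain_label_eq:
  assumes "good ws ls" "is_label ws cs ls"
  shows "chain_label ws cs = ls"
proof -
  have "chain_label ws cs = (THE ls. is_label ws cs ls)"
    by (simp add: chain_label_def is_label_def)
  also have "\<dots> = ls" using assms label_unique by (intro the_equality) auto
  finally show ?thesis .
qed

text \<open>A label is built along the chain: each cover is a reflection that shortens the current
  element, so \<open>strong_exchange\<close> names a letter to delete.\<close>

lemma max_chain_label:
  assumes "red ws" "max_chain R B x (wprod ws) cs"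
  shows "\<exists>ls. is_label ws cs ls \<and> good ws ls"
proof -
  have cs: "cs \<noteq> []" "cs ! 0 = wprod ws"
    and cov: "\<And>k. Suc k < length cs \<Longrightarrow> bruhat_cover R B (cs ! k) (cs ! Suc k)"
    using assms(2) by (auto simp: max_chain_def hd_conv_nth)
  have "\<exists>ls. length ls = k \<and> distinct ls \<and> set ls \<subseteq> {..<length ws} \<and>
      (\<forall>m\<le>k. red (del_pos ws (set (take m ls))) \<and> cs ! m = wprod (del_pos ws (set (take m ls))))"
    if "k < length cs" for k
    using that
  proof (induction k)
    case 0 then show ?case using assms(1) cs by simp
  next
    case (Suc k)
    then obtain ls where ls: "length ls = k" "distinct ls" "set ls \<subseteq> {..<length ws}"
      "\<And>m. m \<le> k \<Longrightarrow> red (del_pos ws (set (take m ls))) \<and> cs ! m = wprod (del_pos ws (set (take m ls)))"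
      by (meson Suc_lessD)
    let ?S = "set ls" and ?y = "cs ! k" and ?z = "cs ! Suc k"
    have y: "red (del_pos ws ?S)" "?y = wprod (del_pos ws ?S)" using ls(4)[of k] ls(1) by auto
    obtain \<beta> where b: "\<beta> \<in> R" "ht \<beta> > 0" "ht (?y \<beta>) < 0" "?z = ?y \<circ> refl \<beta>"
      using cover_reflection cov Suc.prems by blast
    then obtain p where p: "p < length ws" "p \<notin> ?S" "?z = wprod (del_pos ws (insert p ?S))"
      using strong_exchange[OF reduced_B[OF assms(1)] b(1,2), of ?S] unfolding y(2) by auto
    \<comment> \<open>The cover lowers the length by one, as the deletion does for the word; hence
      the shortened word stays reduced.\<close>
    have "length (del_pos ws (insert p ?S)) \<le> len ?z"
      using cover_len[OF cov[OF Suc.prems]] reduced_len[OF y(1)] length_del_pos[OF ls(3)]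
        length_del_pos[of "insert p ?S" ws] ls(3) p unfolding y(2) by simp
    then have r: "red (del_pos ws (insert p ?S))"
      unfolding p(3) by (rule reducedI[OF subset_trans[OF set_del_pos_subset reduced_B[OF assms(1)]]])
    have "set (take m (ls @ [p])) = (if m = Suc k then insert p ?S else set (take m ls))" if "m \<le> Suc k" for m
      using that ls(1) by auto
    then show ?case using ls p r by (intro exI[of _ "ls @ [p]"]) (auto simp: le_Suc_eq)
  qed
  from this[of "length cs - 1"] cs(1) obtain ls where
    "length ls = length cs - 1 \<and> distinct ls \<and> set ls \<subseteq> {..<length ws} \<and>
      (\<forall>m\<le>length cs - 1. red (del_pos ws (set (take m ls))) \<and> cs ! m = wprod (del_pos ws (set (take m ls))))"
    by auto
  then show ?thesis using cs(1) by (intro exI[of _ ls]) (auto simp: is_label_def good_def)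
qed

lemma is_label_chain_of: "good ws ls \<Longrightarrow> is_label ws (chain_of ws ls) ls"
  unfolding is_label_def chain_of_def good_def by (auto simp: nth_append simp del: upt_Suc)

lemma max_chain_chain_of:
  assumes "good ws ls"
  shows "max_chain R B (wprod (del_pos ws (set ls))) (wprod ws) (chain_of ws ls)"
proof -
  have l: "length (chain_of ws ls) = Suc (length ls)" by (simp add: chain_of_def)
  have n: "chain_of ws ls ! k = wprod (del_pos ws (set (take k ls)))" if "k \<le> length ls" for k
    using is_label_chain_of[OF assms] that by (simp add: is_label_def)
  have "bruhat_cover R B (chain_of ws ls ! k) (chain_of ws ls ! Suc k)" if "k < length ls" for k
  proof -
    let ?S = "set (take k ls)" and ?S' = "set (take (Suc k) ls)"
    have r: "red (del_pos ws ?S)" "red (del_pos ws ?S')" using assms that by (auto simp: good_def)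
    have sub: "?S \<subseteq> ?S'" by (rule set_take_subset_set_take) simp
    have s: "?S' \<subseteq> {..<length ws}" using assms set_take_subset[of "Suc k" ls] by (auto simp: good_def)
    have c: "card ?S' = Suc (card ?S)"
      using set_take_Suc[OF that] nth_notin_take[OF _ that] assms by (simp add: good_def)
    have "len (wprod (del_pos ws ?S)) = Suc (len (wprod (del_pos ws ?S')))"
      using reduced_len[OF r(1)] reduced_len[OF r(2)] length_del_pos[OF s]
        length_del_pos[OF subset_trans[OF sub s]] c by simp
    then show ?thesis
      using cover_of_len subword_bruhat[OF subseq_del_pos_mono[OF sub] r(1)] n that by simp
  qed
  moreover have "hd (chain_of ws ls) = wprod ws" using n[of 0] l by (cases "chain_of ws ls") auto
  moreover have "last (chain_of ws ls) = wprod (del_pos ws (set ls))"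
    using n[of "length ls"] l by (subst last_conv_nth) auto
  ultimately show ?thesis using l unfolding max_chain_def by auto
qed

lemma max_chain_good:
  assumes "red ws" "max_chain R B x (wprod ws) cs" "ls = chain_label ws cs"
  shows "good ws ls" "cs = chain_of ws ls" "x = wprod (del_pos ws (set ls))"
proof -
  obtain l where l: "is_label ws cs l" "good ws l" using max_chain_label assms by blast
  then have e: "ls = l" using chain_label_eq assms(3) by simp
  show "good ws ls" using l e by simp
  show "cs = chain_of ws ls"
    using l is_label_chain_of[OF l(2)] unfolding e is_label_def
    by (intro nth_equalityI) auto
  then have "last cs = wprod (del_pos ws (set ls))"
    using max_chain_chain_of[OF \<open>good ws ls\<close>] by (simp add: max_chain_def)
  then show "x = wprod (del_pos ws (set ls))" using assms(2) by (simp add: max_chain_def)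
qed

lemma good_dec:
  assumes "sorted_wrt (>) ls" shows "good ws ls \<longleftrightarrow> dec_deletable ws (set ls)"
proof
  assume "good ws ls"
  then show "dec_deletable ws (set ls)" using sorted_gt_ex[OF assms] unfolding good_def dec_deletable_def by metis
next
  have "distinct ls" using assms by (induction ls) auto
  moreover assume "dec_deletable ws (set ls)"
  ultimately show "good ws ls" using sorted_gt_take[OF assms] unfolding good_def dec_deletable_def by metis
qed

lemma good_inc:
  assumes "sorted_wrt (<) ls" shows "good ws ls \<longleftrightarrow> inc_deletable ws (set ls)"
proof
  assume "good ws ls"
  then show "inc_deletable ws (set ls)" using sorted_lt_ex[OF assms] unfolding good_def inc_deletable_def by metis
next
  have "distinct ls" using assms strict_sorted_iff by blast
  moreover assume "inc_deletable ws (set ls)"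
  ultimately show "good ws ls" using sorted_lt_take[OF assms] unfolding good_def inc_deletable_def by metis
qed

text \<open>\<open>dec_exists\<close> provides a chain with decreasing label and
  \<open>dec_unique\<close> shows it to be the only one, so the description in
  \<open>chain_minus\<close> selects it.\<close>

lemma chain_minus_label:
  assumes "red ws" "x \<preceq> wprod ws" "ls = chain_label ws (chain_minus R B x ws)"
  shows "sorted_wrt (>) ls" "dec_deletable ws (set ls)" "wprod (del_pos ws (set ls)) = x"
proof -
  obtain I where I: "dec_deletable ws I" "wprod (del_pos ws I) = x" using dec_exists assms by blast
  let ?l = "rev (sorted_list_of_set I)"
  have f: "finite I" using I(1) finite_subset by (auto simp: dec_deletable_def)
  have s: "sorted_wrt (>) ?l" "set ?l = I" using f by (simp_all add: sorted_wrt_rev)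
  have g: "good ws ?l" using good_dec[OF s(1)] s(2) I by metis
  have "chain_minus R B x ws = chain_of ws ?l"
    unfolding chain_minus_def
  proof (rule the_equality)
    show "max_chain R B x (wprod ws) (chain_of ws ?l) \<and> sorted_wrt (>) (chain_label ws (chain_of ws ?l))"
      using max_chain_chain_of[OF g] chain_label_eq[OF g is_label_chain_of[OF g]] s I by simp
  next
    fix cs assume cs: "max_chain R B x (wprod ws) cs \<and> sorted_wrt (>) (chain_label ws cs)"
    let ?m = "chain_label ws cs"
    note m = max_chain_good[OF assms(1) conjunct1[OF cs] refl]
    have "dec_deletable ws (set ?m)" using m(1) good_dec cs by blast
    then have "set ?m = I" using dec_unique I m(3) by metis
    then have "rev ?m = sorted_list_of_set I"
      using cs f by (intro strict_sorted_equal) (auto simp: sorted_wrt_rev)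
    then show "cs = chain_of ws ?l" using m(2) by (metis rev_rev_ident)
  qed
  then have "ls = ?l" using assms(3) chain_label_eq[OF g is_label_chain_of[OF g]] by simp
  then show "sorted_wrt (>) ls" "dec_deletable ws (set ls)" "wprod (del_pos ws (set ls)) = x"
    using s I by auto
qed

lemma chain_plus_label:
  assumes "red ws" "x \<preceq> wprod ws" "ls = chain_label ws (chain_plus R B x ws)"
  shows "sorted_wrt (<) ls" "inc_deletable ws (set ls)" "wprod (del_pos ws (set ls)) = x"
proof -
  obtain I where I: "inc_deletable ws I" "wprod (del_pos ws I) = x" using inc_exists assms by blast
  let ?l = "sorted_list_of_set I"
  have f: "finite I" using I(1) finite_subset by (auto simp: inc_deletable_def)
  have s: "sorted_wrt (<) ?l" "set ?l = I" using f by simp_all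
  have g: "good ws ?l" using good_inc[OF s(1)] s(2) I by metis
  have "chain_plus R B x ws = chain_of ws ?l"
    unfolding chain_plus_def
  proof (rule the_equality)
    show "max_chain R B x (wprod ws) (chain_of ws ?l) \<and> sorted_wrt (<) (chain_label ws (chain_of ws ?l))"
      using max_chain_chain_of[OF g] chain_label_eq[OF g is_label_chain_of[OF g]] s I by simp
  next
    fix cs assume cs: "max_chain R B x (wprod ws) cs \<and> sorted_wrt (<) (chain_label ws cs)"
    let ?m = "chain_label ws cs"
    note m = max_chain_good[OF assms(1) conjunct1[OF cs] refl]
    have "inc_deletable ws (set ?m)" using m(1) good_inc cs by blast
    then have "set ?m = I" using inc_unique I m(3) by metis
    then have "?m = ?l" using cs f by (intro strict_sorted_equal) auto
    then show "cs = chain_of ws ?l" using m(2) by metis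
  qed
  then have "ls = ?l" using assms(3) chain_label_eq[OF g is_label_chain_of[OF g]] by simp
  then show "sorted_wrt (<) ls" "inc_deletable ws (set ls)" "wprod (del_pos ws (set ls)) = x"
    using s I by auto
qed

end

section \<open>The group ring of the weight lattice\<close>

abbreviation "sg \<equiv> Poly_Mapping.single"

lemma pm_decomp: "(\<Sum>\<mu>\<in>Poly_Mapping.keys f. sg \<mu> (Poly_Mapping.lookup f \<mu>)) = f"
proof (rule poly_mapping_eqI)
  fix k
  have "(\<Sum>\<mu>\<in>Poly_Mapping.keys f. Poly_Mapping.lookup (sg \<mu> (Poly_Mapping.lookup f \<mu>)) k)
      = (\<Sum>\<mu>\<in>Poly_Mapping.keys f. if \<mu> = k then Poly_Mapping.lookup f k else 0)"
    by (intro sum.cong) (auto simp: lookup_single)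
  then show "Poly_Mapping.lookup (\<Sum>\<mu>\<in>Poly_Mapping.keys f. sg \<mu> (Poly_Mapping.lookup f \<mu>)) k
      = Poly_Mapping.lookup f k"
    by (simp add: lookup_sum in_keys_iff)
qed

text \<open>The coefficient set is a parameter, so that the closure properties serve both
  \<open>Ov R\<close> and the integral form \<open>ZvZP R\<close>.\<close>

definition grp_over :: "'a set \<Rightarrow> 'b::zero set \<Rightarrow> ('a \<Rightarrow>\<^sub>0 'b) set" where
  "grp_over L S = {f. Poly_Mapping.keys f \<subseteq> L \<and> (\<forall>\<mu>. Poly_Mapping.lookup f \<mu> \<in> S)}"

lemma grp_over_UNIV [simp]: "f \<in> grp_over UNIV UNIV"
  by (simp add: grp_over_def)

lemma grp_over_mono: "S \<subseteq> S' \<Longrightarrow> f \<in> grp_over L S \<Longrightarrow> f \<in> grp_over L S'"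
  by (auto simp: grp_over_def)

definition add_closed :: "'b::monoid_add set \<Rightarrow> bool" where
  "add_closed S \<longleftrightarrow> 0 \<in> S \<and> (\<forall>x\<in>S. \<forall>y\<in>S. x + y \<in> S)"

lemma add_closed_UNIV [simp]: "add_closed UNIV"
  by (simp add: add_closed_def)

lemma grp_over_add:
  "add_closed S \<Longrightarrow> f \<in> grp_over L S \<Longrightarrow> g \<in> grp_over L S \<Longrightarrow> f + g \<in> grp_over L S"
  using keys_add[of f g] by (auto simp: grp_over_def lookup_add add_closed_def)

lemma grp_over_single: "add_closed S \<Longrightarrow> \<mu> \<in> L \<Longrightarrow> c \<in> S \<Longrightarrow> sg \<mu> c \<in> grp_over L S"
  by (auto simp: grp_over_def lookup_single when_def add_closed_def)

lemma grp_over_zero: "add_closed S \<Longrightarrow> 0 \<in> grp_over L S"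
  by (auto simp: grp_over_def add_closed_def)

text \<open>The sum case carries the membership of both summands, because the laws of
  \<open>dem\<close> are available only for elements supported on the weight lattice.\<close>

lemma grp_over_induct [consumes 2, case_names zero single add]:
  fixes f :: "'a \<Rightarrow>\<^sub>0 'b::comm_monoid_add"
  assumes "f \<in> grp_over L S" and S: "add_closed S"
    and zero: "Q 0"
    and single: "\<And>\<mu> c. \<mu> \<in> L \<Longrightarrow> c \<in> S \<Longrightarrow> Q (sg \<mu> c)"
    and add: "\<And>f g. f \<in> grp_over L S \<Longrightarrow> g \<in> grp_over L S \<Longrightarrow> Q f \<Longrightarrow> Q g \<Longrightarrow> Q (f + g)"
  shows "Q f"
proof -
  have k: "Poly_Mapping.keys f \<subseteq> L" and l: "Poly_Mapping.lookup f \<mu> \<in> S" for \<mu>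
    using assms(1) by (auto simp: grp_over_def)
  have "(\<Sum>\<mu>\<in>A. sg \<mu> (Poly_Mapping.lookup f \<mu>)) \<in> grp_over L S \<and>
      Q (\<Sum>\<mu>\<in>A. sg \<mu> (Poly_Mapping.lookup f \<mu>))" if "A \<subseteq> L" "finite A" for A
    using that(2,1)
  proof induction
    case empty then show ?case using zero S by (simp add: grp_over_zero)
  next
    case (insert x A)
    have x: "x \<in> L" and A: "A \<subseteq> L" using insert.prems by auto
    note IH = insert.IH[OF A]
    show ?case unfolding sum.insert[OF insert.hyps]
      using grp_over_add[OF S grp_over_single[OF S x l] conjunct1[OF IH]]
        add[OF grp_over_single[OF S x l] conjunct1[OF IH] single[OF x l] conjunct2[OF IH]] by blast
  qed
  from this[OF k finite_keys] show ?thesis unfolding pm_decomp by simp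
qed

lemma pm_induct [case_names single add]:
  fixes f :: "'a \<Rightarrow>\<^sub>0 'b::comm_monoid_add"
  assumes "\<And>\<mu> c. Q (sg \<mu> c)" "\<And>f g. Q f \<Longrightarrow> Q g \<Longrightarrow> Q (f + g)"
  shows "Q f"
proof (rule grp_over_induct[of f UNIV UNIV])
  show "Q 0" using assms(1)[of undefined 0] by simp
qed (use assms in auto)

lemma grp_over_mult:
  fixes S :: "'b::semiring_0 set" and L :: "'a::monoid_add set"
  assumes S: "add_closed S" "\<And>x y. x \<in> S \<Longrightarrow> y \<in> S \<Longrightarrow> x * y \<in> S"
    and L: "\<And>x y. x \<in> L \<Longrightarrow> y \<in> L \<Longrightarrow> x + y \<in> L"
    and fg: "f \<in> grp_over L S" "g \<in> grp_over L S"
  shows "f * g \<in> grp_over L S"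
  using fg(1) S(1)
proof (induction f rule: grp_over_induct)
  case (single \<mu> c)
  note mc = single
  from fg(2) S(1) show ?case
  proof (induction g rule: grp_over_induct)
    case (single \<nu> d)
    then show ?case using mc S L by (simp add: mult_single grp_over_single)
  next
    case (add f g)
    then show ?case using grp_over_add[OF S(1)] by (simp add: distrib_left)
  qed (use S in \<open>simp_all add: grp_over_zero\<close>)
next
  case (add f g)
  then show ?case using grp_over_add[OF S(1)] by (simp add: distrib_right)
qed (use S in \<open>simp_all add: grp_over_zero\<close>)

lemma wact_single [simp]: "wact w (sg \<mu> c) = sg (w \<mu>) c"
  by (cases "c = 0") (simp_all add: wact_def)

lemma wact_add: "wact w (f + g) = wact w f + wact w g"
  unfolding wact_def by (rule setsum_keys_plus_distrib) (simp_all add: single_add)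

lemma wact_0 [simp]: "wact w 0 = 0"
  by (simp add: wact_def)

lemma wact_minus: "wact w (- f) = - wact w f"
  using wact_add[of w f "-f"] by (simp add: eq_neg_iff_add_eq_0 add.commute)

lemma wact_diff: "wact w (f - g) = wact w f - wact w g"
  using wact_add[of w f "-g"] by (simp add: wact_minus)

lemma wact_sum: "wact w (sum h A) = (\<Sum>i\<in>A. wact w (h i))"
  by (induction A rule: infinite_finite_induct) (simp_all add: wact_add)

lemma wact_comp: "wact u (wact w f) = wact (u \<circ> w) f"
  by (induction f rule: pm_induct) (simp_all add: wact_add)

lemma wact_id [simp]: "wact id f = f"
  by (induction f rule: pm_induct) (simp_all add: wact_add)

lemma wact_mult:
  assumes "linear w" shows "wact w (f * g) = wact w f * wact w g"
proof (induction f rule: pm_induct)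
  case (single \<mu> c)
  show ?case
  proof (induction g rule: pm_induct)
    case (single \<nu> d)
    then show ?case using assms by (simp add: mult_single linear_add)
  qed (simp add: wact_add distrib_left)
qed (simp add: wact_add distrib_right)

lemma wact_one: "linear w \<Longrightarrow> wact w 1 = 1"
  using wact_single[of w 0 1] by (simp add: linear_0)

lemma wact_grp_over:
  assumes "add_closed S" "\<And>\<mu>. \<mu> \<in> L \<Longrightarrow> w \<mu> \<in> L" "f \<in> grp_over L S"
  shows "wact w f \<in> grp_over L S"
  using assms(3,1)
proof (induction f rule: grp_over_induct)
  case zero then show ?case using assms by (simp add: grp_over_zero)
next
  case (single \<mu> c) then show ?case using assms by (simp add: grp_over_single)
next
  case (add f g) then show ?case using grp_over_add[OF assms(1)] by (simp add: wact_add)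
qed

lemma lookup_single_mult:
  fixes h :: "'a::ab_group_add \<Rightarrow>\<^sub>0 'b::comm_semiring_1"
  shows "Poly_Mapping.lookup (sg \<nu> c * h) \<mu> = c * Poly_Mapping.lookup h (\<mu> - \<nu>)"
proof (induction h rule: pm_induct)
  case (single k d)
  then show ?case by (auto simp: mult_single lookup_single when_def algebra_simps)
qed (simp add: distrib_left lookup_add)

text \<open>Cancellation by such elements replaces passage to a field of fractions of the group
  ring.\<close>

definition nzd :: "'r::comm_ring_1 \<Rightarrow> bool" where
  "nzd g \<longleftrightarrow> (\<forall>h. g * h = 0 \<longrightarrow> h = 0)"

lemma nzd_cancel: "nzd g \<Longrightarrow> g * x = g * y \<Longrightarrow> x = y"
  unfolding nzd_def using right_diff_distrib[of g x y] by (metis eq_iff_diff_eq_0)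

lemma nzd_mult: "nzd f \<Longrightarrow> nzd g \<Longrightarrow> nzd (f * g)"
  unfolding nzd_def by (metis mult.assoc)

lemma nzd_one [simp]: "nzd 1"
  by (simp add: nzd_def)

lemma nzd_uminus: "nzd g \<Longrightarrow> nzd (- g)"
  by (simp add: nzd_def)

lemma nzd_ex: "nzd (ex \<mu>)"
proof -
  have e: "ex (-\<mu>) * (ex \<mu> * h) = h" for h
    by (simp add: mult.assoc[symmetric] mult_single)
  show ?thesis unfolding nzd_def using e by (metis mult_zero_right)
qed

text \<open>If the product vanishes, the coefficients of \<open>h\<close> are constant along rays in
  the direction \<beta>, and a non-zero one would make the support infinite.\<close>

lemma nzd_one_minus_ex:
  assumes "\<beta> \<noteq> 0" shows "nzd (1 - ex (-\<beta>))"
  unfolding nzd_def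
proof (intro allI impI, rule ccontr)
  fix h :: "'a \<Rightarrow>\<^sub>0 Kv" assume h: "(1 - ex (-\<beta>)) * h = 0" "h \<noteq> 0"
  then obtain \<mu> where m: "Poly_Mapping.lookup h \<mu> \<noteq> 0"
    by (metis lookup_zero poly_mapping_eqI)
  have "ex (-\<beta>) * h = h" using h(1) by (simp add: left_diff_distrib)
  then have "Poly_Mapping.lookup h (\<nu> + \<beta>) = Poly_Mapping.lookup h \<nu>" for \<nu>
    using lookup_single_mult[of "-\<beta>" 1 h \<nu>] by simp
  then have s: "Poly_Mapping.lookup h (\<mu> + real n *\<^sub>R \<beta>) = Poly_Mapping.lookup h \<mu>" for n
    by (induction n) (simp_all add: algebra_simps, metis add.commute add.left_commute)
  have "inj (\<lambda>n::nat. \<mu> + real n *\<^sub>R \<beta>)" using assms by (intro injI) simp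
  moreover have "range (\<lambda>n::nat. \<mu> + real n *\<^sub>R \<beta>) \<subseteq> Poly_Mapping.keys h"
    using s m by (auto simp: in_keys_iff)
  ultimately show False
    using finite_subset[OF _ finite_keys] finite_imageD infinite_UNIV_nat by blast
qed

text \<open>The Demazure-Lusztig operator with parameter q; by \<open>Tq_quad\<close> it satisfies
  (T + 1)(T - q) = 0.\<close>

definition Tq :: "'a::euclidean_space set \<Rightarrow> Kv \<Rightarrow> 'a \<Rightarrow> ('a \<Rightarrow>\<^sub>0 Kv) \<Rightarrow> ('a \<Rightarrow>\<^sub>0 Kv)" where
  "Tq R q \<beta> f = (1 - sg (-\<beta>) q) * dem R \<beta> f - f"

lemma Top_eq: "Top R = Tq R vv" and Dop_eq: "Dop R = Tq R 0"
  by (simp_all add: fun_eq_iff Top_def Dop_def Tq_def)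

definition is_subring :: "'b::ring_1 set \<Rightarrow> bool" where
  "is_subring S \<longleftrightarrow> 0 \<in> S \<and> 1 \<in> S \<and> (\<forall>x\<in>S. \<forall>y\<in>S. x + y \<in> S \<and> x * y \<in> S) \<and> (\<forall>x\<in>S. - x \<in> S)"

text \<open>A telescoping sum: it gives explicit quotients for differences along one
  \<beta>-string.\<close>

lemma geometric_single:
  fixes \<beta> :: "'a::euclidean_space" and c :: Kv
  shows "(1 - ex (-\<beta>)) * (\<Sum>k<n. sg (\<mu> - real k *\<^sub>R \<beta>) c) = sg \<mu> c - sg (\<mu> - real n *\<^sub>R \<beta>) c"
proof (induction n)
  case (Suc n)
  have e: "- \<beta> + (\<mu> - real n *\<^sub>R \<beta>) = \<mu> - real (Suc n) *\<^sub>R \<beta>" by (simp add: algebra_simps)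
  have "(1 - ex (-\<beta>)) * sg (\<mu> - real n *\<^sub>R \<beta>) c = sg (\<mu> - real n *\<^sub>R \<beta>) c - sg (\<mu> - real (Suc n) *\<^sub>R \<beta>) c"
    by (simp only: left_diff_distrib mult_1 mult_single e)
  then show ?case using Suc by (simp add: distrib_left)
qed simp

context based_root_system
begin

abbreviation "P \<equiv> weight_lattice R"

lemma P_iff: "\<mu> \<in> P \<longleftrightarrow> (\<forall>\<alpha>\<in>R. pairing \<mu> \<alpha> \<in> \<int>)"
  by (simp add: weight_lattice_def pairing_def)

lemma P_zero [simp]: "0 \<in> P" and P_add: "\<mu> \<in> P \<Longrightarrow> \<nu> \<in> P \<Longrightarrow> \<mu> + \<nu> \<in> P"
  and P_diff: "\<mu> \<in> P \<Longrightarrow> \<nu> \<in> P \<Longrightarrow> \<mu> - \<nu> \<in> P" and P_uminus: "\<mu> \<in> P \<Longrightarrow> - \<mu> \<in> P"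
  by (simp_all add: P_iff)

lemma R_P: "\<alpha> \<in> R \<Longrightarrow> \<alpha> \<in> P"
  by (simp add: P_iff pairing_R)

lemma P_scale: "\<mu> \<in> P \<Longrightarrow> c \<in> \<int> \<Longrightarrow> c *\<^sub>R \<mu> \<in> P"
  by (simp add: P_iff)

lemma P_refl: "\<alpha> \<in> R \<Longrightarrow> \<mu> \<in> P \<Longrightarrow> refl \<alpha> \<mu> \<in> P"
  using P_diff[of \<mu> "pairing \<mu> \<alpha> *\<^sub>R \<alpha>"] P_scale[OF R_P] by (simp add: refl_pairing P_iff)

lemma P_weyl: "w \<in> weyl B \<Longrightarrow> \<mu> \<in> P \<Longrightarrow> w \<mu> \<in> P"
proof -
  have "set ws \<subseteq> B \<Longrightarrow> \<mu> \<in> P \<Longrightarrow> wprod ws \<mu> \<in> P" for ws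
    by (induction ws) (simp_all add: P_refl)
  then show "w \<in> weyl B \<Longrightarrow> \<mu> \<in> P \<Longrightarrow> w \<mu> \<in> P" by (auto simp: weyl_iff)
qed

abbreviation "\<O> S \<equiv> grp_over P S"

lemma Ov_eq: "Ov R = \<O> UNIV"
  by (auto simp: Ov_def grp_over_def)

lemma is_subring_add_closed: "is_subring S \<Longrightarrow> add_closed S"
  by (simp add: is_subring_def add_closed_def)

lemma OS:
  fixes S :: "Kv set"
  assumes "is_subring S"
  shows OS_zero: "0 \<in> \<O> S" and OS_one: "1 \<in> \<O> S" and OS_add: "f \<in> \<O> S \<Longrightarrow> g \<in> \<O> S \<Longrightarrow> f + g \<in> \<O> S"
    and OS_mult: "f \<in> \<O> S \<Longrightarrow> g \<in> \<O> S \<Longrightarrow> f * g \<in> \<O> S" and OS_uminus: "f \<in> \<O> S \<Longrightarrow> - f \<in> \<O> S"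
    and OS_diff: "f \<in> \<O> S \<Longrightarrow> g \<in> \<O> S \<Longrightarrow> f - g \<in> \<O> S"
    and OS_single: "\<mu> \<in> P \<Longrightarrow> c \<in> S \<Longrightarrow> sg \<mu> c \<in> \<O> S"
    and OS_ex: "\<mu> \<in> P \<Longrightarrow> ex \<mu> \<in> \<O> S"
    and OS_wact: "w \<in> weyl B \<Longrightarrow> f \<in> \<O> S \<Longrightarrow> wact w f \<in> \<O> S"
proof -
  have S: "0 \<in> S" "1 \<in> S" "\<And>x y. x \<in> S \<Longrightarrow> y \<in> S \<Longrightarrow> x * y \<in> S" "\<And>x. x \<in> S \<Longrightarrow> - x \<in> S"
    using assms by (auto simp: is_subring_def)
  note ac = is_subring_add_closed[OF assms]
  show "0 \<in> \<O> S" using ac by (simp add: grp_over_zero)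
  show sgl: "\<mu> \<in> P \<Longrightarrow> c \<in> S \<Longrightarrow> sg \<mu> c \<in> \<O> S" for \<mu> c using ac by (simp add: grp_over_single)
  then show "\<mu> \<in> P \<Longrightarrow> ex \<mu> \<in> \<O> S" using S by simp
  show "1 \<in> \<O> S" using sgl[of 0 1] S by simp
  show a: "f \<in> \<O> S \<Longrightarrow> g \<in> \<O> S \<Longrightarrow> f + g \<in> \<O> S" for f g by (rule grp_over_add[OF ac])
  show "f \<in> \<O> S \<Longrightarrow> g \<in> \<O> S \<Longrightarrow> f * g \<in> \<O> S" by (rule grp_over_mult[OF ac S(3) P_add])
  show m: "f \<in> \<O> S \<Longrightarrow> - f \<in> \<O> S" for f using S by (auto simp: grp_over_def in_keys_iff)
  show "f \<in> \<O> S \<Longrightarrow> g \<in> \<O> S \<Longrightarrow> f - g \<in> \<O> S" using a[of f "-g"] m by simp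
  show "w \<in> weyl B \<Longrightarrow> f \<in> \<O> S \<Longrightarrow> wact w f \<in> \<O> S" by (rule wact_grp_over[OF ac P_weyl])
qed

lemma subring_UNIV [simp]: "is_subring UNIV"
  by (simp add: is_subring_def)

lemmas OU [simp, intro] = OS[OF subring_UNIV]

lemma refl_wact_OU [simp, intro]: "\<beta> \<in> R \<Longrightarrow> f \<in> \<O> UNIV \<Longrightarrow> wact (refl \<beta>) f \<in> \<O> UNIV"
  by (simp add: weyl_refl)

lemma OU_single [simp, intro]: "\<mu> \<in> P \<Longrightarrow> sg \<mu> (c::Kv) \<in> \<O> UNIV"
  by simp

lemma OU_subset: "f \<in> \<O> S \<Longrightarrow> f \<in> \<O> UNIV"
  by (rule grp_over_mono) auto

lemma OS_sum: "is_subring (S::Kv set) \<Longrightarrow> (\<And>i. i \<in> A \<Longrightarrow> h i \<in> \<O> S) \<Longrightarrow> sum h A \<in> \<O> S"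
  by (induction A rule: infinite_finite_induct) (simp_all add: OS_zero OS_add)

section \<open>Demazure operators\<close>

definition is_dem :: "'a \<Rightarrow> ('a \<Rightarrow>\<^sub>0 Kv) \<Rightarrow> ('a \<Rightarrow>\<^sub>0 Kv) \<Rightarrow> bool" where
  "is_dem \<beta> f g \<longleftrightarrow> (1 - ex (-\<beta>)) * g = f - ex (-\<beta>) * wact (refl \<beta>) f"

text \<open>The string from \<mu> to its reflection has n + 1 terms; the factor e^(-\<beta>) before
  the reflected term moves the end of the telescope one step beyond it.\<close>

lemma is_dem_pos:
  assumes "pairing \<mu> \<beta> = real n"
  shows "is_dem \<beta> (sg \<mu> c) (\<Sum>k<Suc n. sg (\<mu> - real k *\<^sub>R \<beta>) c)"
proof -
  have "- \<beta> + refl \<beta> \<mu> = \<mu> - real (Suc n) *\<^sub>R \<beta>"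
    using assms by (simp add: refl_pairing algebra_simps)
  then show ?thesis unfolding is_dem_def geometric_single by (simp add: mult_single)
qed

text \<open>For negative pairing the sum runs strictly between \<mu> and its reflection and enters
  with a minus sign. It is empty for pairing -1, hence the \<open>Suc\<close>.\<close>

lemma is_dem_neg:
  assumes "pairing \<mu> \<beta> = - real (Suc n)"
  shows "is_dem \<beta> (sg \<mu> c) (- (\<Sum>k<n. sg (\<mu> + real n *\<^sub>R \<beta> - real k *\<^sub>R \<beta>) c))"
proof -
  have "- \<beta> + refl \<beta> \<mu> = \<mu> + real n *\<^sub>R \<beta>"
    unfolding refl_pairing assms by (simp add: algebra_simps)
  then show ?thesis unfolding is_dem_def minus_mult_right[symmetric] geometric_single by (simp add: mult_single)
qed

text \<open>The quotient is assembled from strings with the same coefficients, so it stays in the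
  subring. This is what keeps the integral form stable.\<close>

lemma is_dem_ex:
  assumes "is_subring S" "\<beta> \<in> R" "f \<in> \<O> S"
  shows "\<exists>g\<in>\<O> S. is_dem \<beta> f g"
proof -
  from assms(3) is_subring_add_closed[OF assms(1)] show ?thesis
  proof (induction f rule: grp_over_induct)
    case zero
    show ?case using OS_zero[OF assms(1)] by (intro bexI[of _ 0]) (simp add: is_dem_def)
  next
    case (single \<mu> c)
    then obtain z where z: "pairing \<mu> \<beta> = of_int z" using assms(2) by (auto simp: P_iff elim!: Ints_cases)
    have mem: "sg (\<mu> + c1 *\<^sub>R \<beta> - real k *\<^sub>R \<beta>) c \<in> \<O> S" if "c1 \<in> \<int>" for k c1
      using single that R_P[OF assms(2)] by (intro OS_single[OF assms(1)] P_diff P_add P_scale) auto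
    show ?case
    proof (cases "z \<ge> 0")
      case True
      then have "pairing \<mu> \<beta> = real (nat z)" using z by simp
      from is_dem_pos[OF this, of c] show ?thesis
        using mem[of 0] by (intro bexI[rotated]) (auto intro!: OS_sum[OF assms(1)] simp del: sum.lessThan_Suc)
    next
      case False
      then have "pairing \<mu> \<beta> = - real (Suc (nat (- z - 1)))" using z by simp
      from is_dem_neg[OF this, of c] show ?thesis
        using mem by (intro bexI[rotated]) (auto intro!: OS_sum[OF assms(1)] OS_uminus[OF assms(1)])
    qed
  next
    case (add f g)
    then obtain f' g' where "f' \<in> \<O> S" "g' \<in> \<O> S" "is_dem \<beta> f f'" "is_dem \<beta> g g'" by blast
    then show ?case
      by (intro bexI[of _ "f' + g'"] OS_add[OF assms(1)]) (simp_all add: is_dem_def wact_add algebra_simps)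
  qed
qed

text \<open>Cancellation works in the whole ring, so \<open>is_dem\<close> can omit the membership
  in \<open>Ov R\<close> that occurs in \<open>dem\<close>.\<close>

lemma is_dem_unique: "\<beta> \<in> R \<Longrightarrow> is_dem \<beta> f g \<Longrightarrow> is_dem \<beta> f g' \<Longrightarrow> g = g'"
  unfolding is_dem_def using nzd_cancel[OF nzd_one_minus_ex[OF nonzero_root]] by metis

lemma dem_eqI:
  assumes "\<beta> \<in> R" "g \<in> \<O> UNIV" "is_dem \<beta> f g" shows "dem R \<beta> f = g"
  unfolding dem_def Ov_eq is_dem_def[symmetric]
  by (rule the_equality) (use assms is_dem_unique in blast)+

lemma dem_OS:
  assumes "is_subring S" "\<beta> \<in> R" "f \<in> \<O> S"
  shows "dem R \<beta> f \<in> \<O> S"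
proof -
  obtain g where g: "g \<in> \<O> S" "is_dem \<beta> f g" using is_dem_ex assms by blast
  then show ?thesis using dem_eqI[OF assms(2) OU_subset g(2)] by simp
qed

lemma is_dem_dem:
  assumes "\<beta> \<in> R" "f \<in> \<O> UNIV" shows "is_dem \<beta> f (dem R \<beta> f)"
proof -
  obtain g where g: "g \<in> \<O> UNIV" "is_dem \<beta> f g" using is_dem_ex[OF subring_UNIV] assms by blast
  then show ?thesis using dem_eqI[OF assms(1) g] by simp
qed

lemma dem_eq: "\<beta> \<in> R \<Longrightarrow> f \<in> \<O> UNIV \<Longrightarrow>
    (1 - ex (-\<beta>)) * dem R \<beta> f = f - ex (-\<beta>) * wact (refl \<beta>) f"
  using is_dem_dem by (simp add: is_dem_def)

lemma dem_OU [simp, intro]: "\<beta> \<in> R \<Longrightarrow> f \<in> \<O> UNIV \<Longrightarrow> dem R \<beta> f \<in> \<O> UNIV"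
  by (rule dem_OS) auto

lemma dem_add: "\<beta> \<in> R \<Longrightarrow> f \<in> \<O> UNIV \<Longrightarrow> g \<in> \<O> UNIV \<Longrightarrow> dem R \<beta> (f + g) = dem R \<beta> f + dem R \<beta> g"
  by (rule dem_eqI) (simp_all add: is_dem_def distrib_left dem_eq wact_add)

text \<open>The twisted Leibniz rule, checked after multiplication by 1 - e^(-\<beta>).\<close>

lemma dem_mult:
  assumes "\<beta> \<in> R" "c \<in> \<O> UNIV" "f \<in> \<O> UNIV"
  shows "dem R \<beta> (c * f) = dem R \<beta> c * f + wact (refl \<beta>) c * (dem R \<beta> f - f)"
proof (rule dem_eqI)
  let ?e = "ex (-\<beta>)" and ?s = "wact (refl \<beta>)"
  have "(1 - ?e) * (dem R \<beta> c * f + ?s c * (dem R \<beta> f - f)) =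
      ((1 - ?e) * dem R \<beta> c) * f + ?s c * ((1 - ?e) * dem R \<beta> f) - (1 - ?e) * ?s c * f"
    by (simp only: algebra_simps)
  also have "\<dots> = c * f - ?e * (?s c * ?s f)"
    unfolding dem_eq[OF assms(1,2)] dem_eq[OF assms(1,3)] by (simp only: algebra_simps) simp
  finally show "is_dem \<beta> (c * f) (dem R \<beta> c * f + ?s c * (dem R \<beta> f - f))"
    unfolding is_dem_def wact_mult[OF linear_refl] .
qed (use assms in simp_all)

lemma dem_conj:
  assumes "w \<in> weyl B" "\<beta> \<in> R" "f \<in> \<O> UNIV"
  shows "wact w (dem R \<beta> f) = dem R (w \<beta>) (wact w f)"
proof (rule dem_eqI[symmetric])
  have l: "linear w" using assms weyl_linear by blast
  have "wact w ((1 - ex (-\<beta>)) * dem R \<beta> f) = wact w (f - ex (-\<beta>) * wact (refl \<beta>) f)"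
    using dem_eq[OF assms(2,3)] by simp
  then show "is_dem (w \<beta>) (wact w f) (wact w (dem R \<beta> f))"
    unfolding is_dem_def wact_mult[OF l] wact_diff wact_one[OF l] wact_single wact_comp
      refl_conj_comp[OF weyl_orthogonal[OF assms(1)]] linear_neg[OF l] .
qed (use assms weyl_R in auto)

lemma dem_one: "\<beta> \<in> R \<Longrightarrow> dem R \<beta> 1 = 1"
  by (rule dem_eqI) (simp_all add: is_dem_def wact_one[OF linear_refl])

lemma dem_const_mult:
  assumes "\<beta> \<in> R" "f \<in> \<O> UNIV" shows "dem R \<beta> (sg 0 c * f) = sg 0 c * dem R \<beta> f"
proof (rule dem_eqI)
  have "wact (refl \<beta>) (sg 0 c) = sg 0 c" by (simp add: linear_0[OF linear_refl])
  then show "is_dem \<beta> (sg 0 c * f) (sg 0 c * dem R \<beta> f)"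
    unfolding is_dem_def wact_mult[OF linear_refl] mult.left_commute[of _ "sg 0 c"] dem_eq[OF assms]
    by (simp add: right_diff_distrib)
qed (use assms in auto)

text \<open>Applying the reflection to the defining equation shows that both sides have the same
  product with 1 - e^\<beta>, which can be cancelled.\<close>

lemma wact_dem:
  assumes "\<beta> \<in> R" "f \<in> \<O> UNIV" shows "wact (refl \<beta>) (dem R \<beta> f) = dem R \<beta> f"
proof -
  let ?e = "ex (-\<beta>)" and ?s = "wact (refl \<beta>)"
  have ee: "ex \<beta> * ?e = 1" by (simp add: mult_single)
  have ss: "?s (?s f) = f" by (simp add: wact_comp)
  have "?s ((1 - ?e) * dem R \<beta> f) = ?s (f - ?e * ?s f)" using dem_eq[OF assms] by simp
  then have 1: "(1 - ex \<beta>) * ?s (dem R \<beta> f) = ?s f - ex \<beta> * f"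
    by (simp add: wact_mult[OF linear_refl] wact_diff wact_one[OF linear_refl] ss linear_neg[OF linear_refl])
  have "(1 - ex \<beta>) * dem R \<beta> f = - ex \<beta> * ((1 - ?e) * dem R \<beta> f)"
    using ee by (simp add: algebra_simps mult.assoc[symmetric])
  also have "\<dots> = ?s f - ex \<beta> * f"
    unfolding dem_eq[OF assms] using ee by (simp add: algebra_simps mult.assoc[symmetric])
  finally have 2: "(1 - ex \<beta>) * ?s (dem R \<beta> f) = (1 - ex \<beta>) * dem R \<beta> f" using 1 by simp
  have "nzd (1 - ex \<beta>)" using nzd_one_minus_ex[of "-\<beta>"] nonzero_root assms by simp
  then show ?thesis using nzd_cancel 2 by blast
qed

section \<open>Demazure-Lusztig operators\<close>

lemma Tq_OS:
  assumes "is_subring S" "q \<in> S" "\<beta> \<in> R" "f \<in> \<O> S" shows "Tq R q \<beta> f \<in> \<O> S"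
  unfolding Tq_def using assms
  by (intro OS_diff OS_mult OS_one OS_single dem_OS P_uminus R_P) auto

lemma Tq_OU [simp, intro]: "\<beta> \<in> R \<Longrightarrow> f \<in> \<O> UNIV \<Longrightarrow> Tq R q \<beta> f \<in> \<O> UNIV"
  by (rule Tq_OS) auto

lemma Tq_add: "\<beta> \<in> R \<Longrightarrow> f \<in> \<O> UNIV \<Longrightarrow> g \<in> \<O> UNIV \<Longrightarrow> Tq R q \<beta> (f + g) = Tq R q \<beta> f + Tq R q \<beta> g"
  by (simp add: Tq_def dem_add algebra_simps)

lemma Tq_zero [simp]: "\<beta> \<in> R \<Longrightarrow> Tq R q \<beta> 0 = 0"
  using Tq_add[of \<beta> 0 0 q] by simp

lemma Tq_sum:
  "\<beta> \<in> R \<Longrightarrow> (\<And>i. i \<in> A \<Longrightarrow> h i \<in> \<O> UNIV) \<Longrightarrow> Tq R q \<beta> (sum h A) = (\<Sum>i\<in>A. Tq R q \<beta> (h i))"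
  by (induction A rule: infinite_finite_induct) (simp_all add: Tq_add OS_sum)

lemma Tq_const_mult:
  "\<beta> \<in> R \<Longrightarrow> f \<in> \<O> UNIV \<Longrightarrow> Tq R q \<beta> (sg 0 c * f) = sg 0 c * Tq R q \<beta> f"
  unfolding Tq_def by (simp only: dem_const_mult) (simp only: algebra_simps)

lemma single_split: "sg \<mu> (q::Kv) = sg 0 q * ex \<mu>"
  by (simp add: mult_single)

text \<open>The Bernstein relation. The difference of the two sides is q f times the defining
  equation of \<open>dem R \<beta> c\<close>.\<close>

lemma Tq_bernstein:
  assumes "\<beta> \<in> R" "c \<in> \<O> UNIV" "f \<in> \<O> UNIV"
  shows "Tq R q \<beta> (c * f) = wact (refl \<beta>) c * Tq R q \<beta> f + (1 - sg 0 q) * (dem R \<beta> c - c) * f"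
proof -
  let ?e = "ex (-\<beta>)" and ?s = "wact (refl \<beta>)" and ?k = "sg 0 q"
  have "Tq R q \<beta> (c * f) - (?s c * Tq R q \<beta> f + (1 - ?k) * (dem R \<beta> c - c) * f)
     = ?k * f * ((1 - ?e) * dem R \<beta> c - (c - ?e * ?s c))"
    unfolding Tq_def dem_mult[OF assms] single_split[of "-\<beta>" q] by (simp only: algebra_simps) simp
  then show ?thesis using dem_eq[OF assms(1,2)] by simp
qed

text \<open>The Leibniz rule sorted by D instead of T; for q = v this yields the recursion for the
  coefficients.\<close>

lemma Tq_mult_D:
  assumes "\<beta> \<in> R" "c \<in> \<O> UNIV" "f \<in> \<O> UNIV"
  shows "Tq R q \<beta> (c * f) = Tq R q \<beta> c * f + (1 - sg (-\<beta>) q) * wact (refl \<beta>) c * Tq R 0 \<beta> f"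
  unfolding Tq_def dem_mult[OF assms] by (simp add: algebra_simps)

lemma Tq_conj:
  assumes "w \<in> weyl B" "\<beta> \<in> R" "f \<in> \<O> UNIV"
  shows "wact w (Tq R q \<beta> f) = Tq R q (w \<beta>) (wact w f)"
  using assms weyl_linear[OF assms(1)]
  by (simp add: Tq_def wact_mult wact_diff wact_one dem_conj linear_neg)

text \<open>\<open>dem R \<beta> f\<close> is invariant under the reflection and therefore passes
  through \<open>dem\<close>, while \<open>dem\<close> sends 1 - q e^(-\<beta>) to 1 + q.\<close>

lemma Tq_quad:
  assumes "\<beta> \<in> R" "f \<in> \<O> UNIV"
  shows "Tq R q \<beta> (Tq R q \<beta> f) = sg 0 q * f - (1 - sg 0 q) * Tq R q \<beta> f"
proof -
  let ?b = "1 - sg (-\<beta>) q" and ?d = "dem R \<beta> f"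
  have d: "?d \<in> \<O> UNIV" and b: "?b \<in> \<O> UNIV" using assms by (auto intro: P_uminus R_P)
  have m: "-\<beta> \<in> P" using assms by (auto intro: P_uminus R_P)
  have "dem R \<beta> (?b * ?d) = dem R \<beta> (?d * ?b)" by (simp add: mult.commute)
  have "pairing (-\<beta>) \<beta> = - real (Suc 1)" using nonzero_root assms by simp
  from is_dem_neg[OF this, of q] have "is_dem \<beta> (sg (-\<beta>) q) (- sg 0 q)" by simp
  then have "dem R \<beta> (sg (-\<beta>) q) = - sg 0 q" using assms by (intro dem_eqI) auto
  moreover have "dem R \<beta> ?b + dem R \<beta> (sg (-\<beta>) q) = dem R \<beta> 1"
    using assms b m by (simp add: dem_add[symmetric])
  ultimately have db: "dem R \<beta> ?b = 1 + sg 0 q" using dem_one[OF assms(1)] by (simp add: algebra_simps)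
  have "is_dem \<beta> ?d ?d"
    unfolding is_dem_def wact_dem[OF assms] by (simp add: algebra_simps)
  then have dd: "dem R \<beta> ?d = ?d" using dem_eqI assms d by blast
  have "dem R \<beta> (?d * ?b) = ?d * dem R \<beta> ?b"
    unfolding dem_mult[OF assms(1) d b] wact_dem[OF assms] dd by (simp add: algebra_simps)
  then have bd: "dem R \<beta> (?b * ?d) = ?d * (1 + sg 0 q)" unfolding db by (simp add: mult.commute)
  have "dem R \<beta> (?b * ?d - f) + ?d = dem R \<beta> (?b * ?d)"
    using assms b d by (simp add: dem_add[symmetric])
  then have "dem R \<beta> (?b * ?d - f) = ?d * (1 + sg 0 q) - ?d" unfolding bd by (simp add: algebra_simps)
  then show ?thesis unfolding Tq_def[of R q \<beta> "Tq R q \<beta> f"] unfolding Tq_def by (simp add: algebra_simps)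
qed

text \<open>These are the pairings met on the weights chosen for the braid relations; the values 2
  and -2 occur only in type G2.\<close>

lemma Tq_ex:
  assumes "\<beta> \<in> R" "\<mu> \<in> P" "f \<in> \<O> UNIV"
  shows "pairing \<mu> \<beta> = 0 \<Longrightarrow> Tq R q \<beta> (ex \<mu> * f) = ex \<mu> * Tq R q \<beta> f"
    and "pairing \<mu> \<beta> = 1 \<Longrightarrow> Tq R q \<beta> (ex \<mu> * f) = ex (\<mu> - \<beta>) * Tq R q \<beta> f + (1 - sg 0 q) * (ex (\<mu> - \<beta>) * f)"
    and "pairing \<mu> \<beta> = -1 \<Longrightarrow> Tq R q \<beta> (ex \<mu> * f) = ex (\<mu> + \<beta>) * Tq R q \<beta> f - (1 - sg 0 q) * (ex \<mu> * f)"
    and "pairing \<mu> \<beta> = 2 \<Longrightarrow> Tq R q \<beta> (ex \<mu> * f) = ex (\<mu> - \<beta> - \<beta>) * Tq R q \<beta> f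
        + (1 - sg 0 q) * (ex (\<mu> - \<beta>) * f + ex (\<mu> - \<beta> - \<beta>) * f)"
    and "pairing \<mu> \<beta> = -2 \<Longrightarrow> Tq R q \<beta> (ex \<mu> * f) = ex (\<mu> + \<beta> + \<beta>) * Tq R q \<beta> f
        - (1 - sg 0 q) * (ex \<mu> * f + ex (\<mu> + \<beta>) * f)"
proof -
  have m: "Tq R q \<beta> (ex \<mu> * f) = ex (\<mu> - pairing \<mu> \<beta> *\<^sub>R \<beta>) * Tq R q \<beta> f
      + (1 - sg 0 q) * (dem R \<beta> (ex \<mu>) - ex \<mu>) * f"
    using Tq_bernstein[OF assms(1) _ assms(3), of "ex \<mu>"] assms(2) by (simp add: refl_pairing)
  have bP: "\<beta> \<in> P" using assms R_P by blast
  note mem = P_add P_diff bP assms(2)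
  {
    assume p: "pairing \<mu> \<beta> = 0"
    have "dem R \<beta> (ex \<mu>) = ex \<mu>"
      using is_dem_pos[of \<mu> \<beta> 0 1] p mem assms(1) by (intro dem_eqI) auto
    then show "Tq R q \<beta> (ex \<mu> * f) = ex \<mu> * Tq R q \<beta> f" unfolding m p by simp
  next
    assume p: "pairing \<mu> \<beta> = 1"
    have "dem R \<beta> (ex \<mu>) = ex \<mu> + ex (\<mu> - \<beta>)"
      using is_dem_pos[of \<mu> \<beta> 1 1] p mem assms(1) by (intro dem_eqI) auto
    then show "Tq R q \<beta> (ex \<mu> * f) = ex (\<mu> - \<beta>) * Tq R q \<beta> f + (1 - sg 0 q) * (ex (\<mu> - \<beta>) * f)"
      unfolding m p by (simp add: mult.assoc)
  next
    assume p: "pairing \<mu> \<beta> = -1"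
    have "dem R \<beta> (ex \<mu>) = 0"
      using is_dem_neg[of \<mu> \<beta> 0 1] p mem assms(1) by (intro dem_eqI) auto
    then show "Tq R q \<beta> (ex \<mu> * f) = ex (\<mu> + \<beta>) * Tq R q \<beta> f - (1 - sg 0 q) * (ex \<mu> * f)"
      unfolding m p by (simp add: mult.assoc)
  next
    assume p: "pairing \<mu> \<beta> = 2"
    have d: "dem R \<beta> (ex \<mu>) = ex \<mu> + ex (\<mu> - \<beta>) + ex (\<mu> - \<beta> - \<beta>)"
      using is_dem_pos[of \<mu> \<beta> 2 1] p mem assms(1)
      by (intro dem_eqI) (auto simp: numeral_2_eq_2 scaleR_2 diff_diff_eq scaleR_left_distrib)
    show "Tq R q \<beta> (ex \<mu> * f) = ex (\<mu> - \<beta> - \<beta>) * Tq R q \<beta> f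
        + (1 - sg 0 q) * (ex (\<mu> - \<beta>) * f + ex (\<mu> - \<beta> - \<beta>) * f)"
      unfolding m p d by (simp add: scaleR_2 diff_diff_eq algebra_simps)
  next
    assume p: "pairing \<mu> \<beta> = -2"
    have d: "dem R \<beta> (ex \<mu>) = - ex (\<mu> + \<beta>)"
      using is_dem_neg[of \<mu> \<beta> 1 1] p mem assms(1) by (intro dem_eqI) auto
    show "Tq R q \<beta> (ex \<mu> * f) = ex (\<mu> + \<beta> + \<beta>) * Tq R q \<beta> f
        - (1 - sg 0 q) * (ex \<mu> * f + ex (\<mu> + \<beta>) * f)"
      unfolding m p d by (simp add: scaleR_2 add.assoc algebra_simps)
  }
qed

end

section \<open>Rank two computations\<close>

text \<open>Additivity and the quadratic relation are all that the commutator computations need.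
  \<open>k\<close> is later instantiated with 1 - q but kept as an independent symbol here, so that
  terms have a normal form.\<close>

locale hecke_pair =
  fixes M :: "'r::comm_ring_1 set" and S T :: "'r \<Rightarrow> 'r" and q k :: 'r
  assumes M: "x \<in> M \<Longrightarrow> y \<in> M \<Longrightarrow> x + y \<in> M" "x \<in> M \<Longrightarrow> y \<in> M \<Longrightarrow> x - y \<in> M"
      "x \<in> M \<Longrightarrow> y \<in> M \<Longrightarrow> x * y \<in> M" "q \<in> M" "k \<in> M" "x \<in> M \<Longrightarrow> S x \<in> M" "x \<in> M \<Longrightarrow> T x \<in> M"
    and S: "x \<in> M \<Longrightarrow> y \<in> M \<Longrightarrow> S (x + y) = S x + S y" "x \<in> M \<Longrightarrow> y \<in> M \<Longrightarrow> S (x - y) = S x - S y"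
      "x \<in> M \<Longrightarrow> S (q * x) = q * S x" "x \<in> M \<Longrightarrow> S (k * x) = k * S x" "x \<in> M \<Longrightarrow> S (S x) = q * x - k * S x"
    and T: "x \<in> M \<Longrightarrow> y \<in> M \<Longrightarrow> T (x + y) = T x + T y" "x \<in> M \<Longrightarrow> y \<in> M \<Longrightarrow> T (x - y) = T x - T y"
      "x \<in> M \<Longrightarrow> T (q * x) = q * T x" "x \<in> M \<Longrightarrow> T (k * x) = k * T x" "x \<in> M \<Longrightarrow> T (T x) = q * x - k * T x"
begin

text \<open>The elements \<open>p\<close> play the part of exponentials. The three predicates record
  \<open>Tq_ex\<close> for pairing 0, for a pair of weights with pairings 1 and -1, and for a string
  with pairings 2, 0, -2.\<close>

definition fixes_weight :: "('r \<Rightarrow> 'r) \<Rightarrow> 'r \<Rightarrow> bool" where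
  "fixes_weight F p \<longleftrightarrow> p \<in> M \<and> (\<forall>x\<in>M. F (p * x) = p * F x)"

definition swaps_weights :: "('r \<Rightarrow> 'r) \<Rightarrow> 'r \<Rightarrow> 'r \<Rightarrow> bool" where
  "swaps_weights F p p' \<longleftrightarrow> p \<in> M \<and> p' \<in> M \<and>
     (\<forall>x\<in>M. F (p * x) = p' * F x + k * (p' * x) \<and> F (p' * x) = p * F x - k * (p' * x))"

definition string_weights :: "('r \<Rightarrow> 'r) \<Rightarrow> 'r \<Rightarrow> 'r \<Rightarrow> 'r \<Rightarrow> bool" where
  "string_weights F p p0 p' \<longleftrightarrow> p \<in> M \<and> p0 \<in> M \<and> p' \<in> M \<and>
     (\<forall>x\<in>M. F (p * x) = p' * F x + k * (p0 * x + p' * x) \<and> F (p0 * x) = p0 * F x \<and>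
        F (p' * x) = p * F x - k * (p' * x + p0 * x))"

lemmas weight_defs = fixes_weight_def swaps_weights_def string_weights_def

text \<open>Here and below, the weight is pushed to the left until every term is a weight times a
  word; in the longer cases the quadratic relations make the lower terms cancel. The weight comes
  out as its image under the longest element of the dihedral group.\<close>

lemma commutator_A1A1:
  assumes "swaps_weights S p1 p2" "fixes_weight T p1" "fixes_weight T p2" "x \<in> M"
  shows "S (T (p1 * x)) - T (S (p1 * x)) = p2 * (S (T x) - T (S x))"
  using assms by (simp add: weight_defs M S T) (simp add: algebra_simps)

lemma commutator_A2:
  assumes "swaps_weights S p1 p2" "fixes_weight T p1" "swaps_weights T p2 p3" "fixes_weight S p3" "x \<in> M"
  shows "S (T (S (p1 * x))) - T (S (T (p1 * x))) = p3 * (S (T (S x)) - T (S (T x)))"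
    and "S (T (S (p2 * x))) - T (S (T (p2 * x))) = p2 * (S (T (S x)) - T (S (T x)))"
  using assms by (simp_all add: weight_defs M S T) (simp_all add: algebra_simps)

lemma commutator_B2:
  assumes "swaps_weights S p1 p2" "fixes_weight T p1" "swaps_weights T p2 p3" "swaps_weights S p3 p4"
    "fixes_weight T p4" "x \<in> M"
  shows "S (T (S (T (p1 * x)))) - T (S (T (S (p1 * x)))) = p4 * (S (T (S (T x))) - T (S (T (S x))))"
    and "S (T (S (T (p2 * x)))) - T (S (T (S (p2 * x)))) = p3 * (S (T (S (T x))) - T (S (T (S x))))"
  using assms by (simp_all add: weight_defs M S T) (simp_all add: algebra_simps)

lemma commutator_G2:
  assumes "swaps_weights S p1 p2" "fixes_weight T p1" "swaps_weights T p2 p3" "string_weights S p3 p4 p5"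
    "fixes_weight T p4" "swaps_weights T p5 p6" "swaps_weights S p6 p7" "fixes_weight T p7" "x \<in> M"
  shows "S (T (S (T (S (T (p1 * x)))))) - T (S (T (S (T (S (p1 * x)))))) =
      p7 * (S (T (S (T (S (T x))))) - T (S (T (S (T (S x))))))"
    and "S (T (S (T (S (T (p2 * x)))))) - T (S (T (S (T (S (p2 * x)))))) =
      p6 * (S (T (S (T (S (T x))))) - T (S (T (S (T (S x))))))"
  using assms by (simp_all add: weight_defs M S T) (simp_all add: algebra_simps)

end

text \<open>For a reduced word of u these are the positive roots that the inverse of u makes
  negative.\<close>

fun roots_of :: "'a::euclidean_space list \<Rightarrow> 'a list" where
  "roots_of [] = []"
| "roots_of (c # cs) = c # map (refl c) (roots_of cs)"

lemma op_word_Nil [simp]: "op_word F [] f = f"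
  by (simp add: op_word_def)

lemma op_word_Cons [simp]: "op_word F (a # ws) f = F a (op_word F ws f)"
  by (simp add: op_word_def)

lemma op_word_append: "op_word F (us @ vs) f = op_word F us (op_word F vs f)"
  by (induction us) simp_all

section \<open>Stripping descents, Cartan integers, weights with given pairings\<close>

context based_root_system
begin

text \<open>The first root is the first letter, so that letter is a left descent of w. Removing it
  turns the other roots into those of the remaining word.\<close>

lemma strip_descents:
  assumes "w \<in> weyl B" "set us \<subseteq> B" "\<forall>r\<in>set (roots_of us). ht (inv w r) < 0"
  shows "len (wprod (rev us) \<circ> w) + length us = len w"
  using assms
proof (induction us arbitrary: w)
  case (Cons c cs)
  have c: "c \<in> B" using Cons.prems by simp
  let ?w = "refl c \<circ> w"
  have w: "?w \<in> weyl B" using weyl_Cons[OF c Cons.prems(1)] .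
  have i: "inv ?w r = inv w (refl c r)" for r
  proof -
    have "inv ?w = inv w \<circ> refl c"
      using Cons.prems(1) by (intro inv_equality) simp_all
    then show ?thesis by simp
  qed
  have "len ?w < len w" using left_descent_iff[OF Cons.prems(1) c] Cons.prems(3) by simp
  then have l: "len w = Suc (len ?w)" by (rule_tac left_len_cases[OF Cons.prems(1) c]) auto
  have "len (wprod (rev cs) \<circ> ?w) + length cs = len ?w"
  proof (rule Cons.IH[OF w])
    show "\<forall>r\<in>set (roots_of cs). ht (inv ?w r) < 0" unfolding i using Cons.prems(3) by auto
  qed (use Cons.prems(2) in simp)
  moreover have "wprod (rev (c # cs)) \<circ> w = wprod (rev cs) \<circ> ?w" by (simp add: fun_eq_iff)
  ultimately show ?case using l by (simp only: list.size)
qed simp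

lemma descent_imp_neg: "w \<in> weyl B \<Longrightarrow> a \<in> B \<Longrightarrow> len (refl a \<circ> w) < len w \<Longrightarrow> ht (inv w a) < 0"
  using left_descent_iff by blast

text \<open>The root s_a b is positive, and its coefficient at a is minus the pairing.\<close>

lemma cartan_nonpos:
  assumes "a \<in> B" "b \<in> B" "a \<noteq> b"
  obtains n :: nat where "pairing b a = - real n"
proof -
  have r: "refl a b \<in> R" using assms refl_in_R by auto
  have "ht (refl a b) > 0" using assms by (intro ht_refl_pos) auto
  then have "coef a (refl a b) \<ge> 0" using coef_nonneg r assms by blast
  then have "pairing b a \<le> 0"
    using assms by (simp add: refl_pairing linear_diff[OF linear_coef] linear_cmul[OF linear_coef] coef_base)
  moreover obtain z where "pairing b a = of_int z"
    using pairing_R[of a b] assms by (auto elim!: Ints_cases)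
  ultimately have "pairing b a = - real (nat (- z))" by simp
  then show thesis by (rule that)
qed

text \<open>Strict Cauchy-Schwarz for the independent vectors a and b bounds the product of the two
  Cartan integers by 3, and one of them vanishes only if the other does.\<close>

lemma cartan_cases:
  assumes "a \<in> B" "b \<in> B" "a \<noteq> b"
  shows "(pairing a b, pairing b a) \<in> {(0,0), (-1,-1), (-1,-2), (-1,-3), (-2,-1), (-3,-1)}"
proof -
  obtain n where n: "pairing b a = - real n" using cartan_nonpos assms by blast
  obtain m where m: "pairing a b = - real m" using cartan_nonpos assms by metis
  have pos: "a \<bullet> a > 0" "b \<bullet> b > 0" using assms nonzero_root by auto
  \<comment> \<open>The multiple of b made orthogonal to a. It is non-zero by its coefficient at b,
    and its square norm is \<open>a \<bullet> a\<close> times the Gram determinant.\<close>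
  let ?d = "(a \<bullet> a) *\<^sub>R b - (a \<bullet> b) *\<^sub>R a"
  have "coef b ?d = a \<bullet> a"
    using assms by (simp add: linear_diff[OF linear_coef] linear_cmul[OF linear_coef] coef_base)
  then have "?d \<noteq> 0" using pos linear_0[OF linear_coef, of b] by fastforce
  then have "?d \<bullet> ?d > 0" by simp
  then have "(a \<bullet> a) * ((a \<bullet> a) * (b \<bullet> b) - (a \<bullet> b)\<^sup>2) > 0"
    by (simp add: inner_diff_left inner_diff_right inner_commute power2_eq_square algebra_simps)
  then have cs: "(a \<bullet> b)\<^sup>2 < (a \<bullet> a) * (b \<bullet> b)" using pos by (simp add: zero_less_mult_iff)
  have "real n * real m = pairing b a * pairing a b" using n m by simp
  also have "\<dots> = 4 * (a \<bullet> b)\<^sup>2 / ((a \<bullet> a) * (b \<bullet> b))"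
    by (simp add: pairing_def inner_commute power2_eq_square)
  also have "\<dots> < 4" using cs pos by (simp add: divide_less_eq)
  finally have "real (n * m) < real 4" by simp
  then have nm: "n * m < 4" by linarith
  have z: "n = 0 \<longleftrightarrow> m = 0"
  proof -
    have "pairing b a = 0 \<longleftrightarrow> pairing a b = 0" using pos by (auto simp: pairing_def inner_commute)
    then show ?thesis using n m by simp
  qed
  have "(m, n) \<in> {(0,0), (1,1), (1,2), (1,3), (2,1), (3,1)}"
  proof (cases "n = 0")
    case False
    then have "m \<ge> 1" "n \<ge> 1" using z by auto
    then have "m \<le> n * m" "n \<le> n * m" by auto
    then have "m < 4" "n < 4" using nm le_less_trans by blast+
    then have "m \<in> {1,2,3}" "n \<in> {1,2,3}" using \<open>m \<ge> 1\<close> \<open>n \<ge> 1\<close> by auto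
    then show ?thesis using nm by auto
  qed (use z in simp)
  then show ?thesis using n m by auto
qed

text \<open>The values on \<open>B\<close> extend to a linear functional; \<open>adjoint h 1\<close>
  is the vector that represents it.\<close>

lemma dual_vector_exists: "\<exists>y. \<forall>a\<in>B. pairing y a = g a"
proof -
  obtain h :: "'a \<Rightarrow> real" where h: "linear h" "\<forall>a\<in>B. h a = g a * (a \<bullet> a) / 2"
    using linear_independent_extend[OF indep_B, of "\<lambda>a. g a * (a \<bullet> a) / 2"] by blast
  have "pairing (adjoint h 1) a = g a" if "a \<in> B" for a
  proof -
    have "adjoint h 1 \<bullet> a = h a" using adjoint_works[OF h(1), of a 1] by (simp add: inner_commute)
    also have "\<dots> = g a * (a \<bullet> a) / 2" using h(2) that by blast
    finally have e: "adjoint h 1 \<bullet> a = g a * (a \<bullet> a) / 2" .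
    have "a \<bullet> a \<noteq> 0" using nonzero_root[of a] that by auto
    then show ?thesis unfolding pairing_def e by simp
  qed
  then show ?thesis by blast
qed

lemma pairing_orthogonal: "orthogonal_transformation w \<Longrightarrow> pairing (w x) (w y) = pairing x y"
  by (simp add: pairing_def orthogonal_transformation_def)

text \<open>Integrality on the simple roots is preserved by the Weyl group, and every root is
  conjugate to a simple one.\<close>

lemma weight_if_simple:
  assumes "\<forall>a\<in>B. pairing \<mu> a \<in> \<int>" shows "\<mu> \<in> P"
proof -
  have inv: "set ws \<subseteq> B \<Longrightarrow> \<forall>a\<in>B. pairing (wprod ws \<mu>) a \<in> \<int>" for ws
  proof (induction ws)
    case (Cons c ws)
    have "pairing (wprod (c # ws) \<mu>) a = pairing (wprod ws \<mu>) a - pairing (wprod ws \<mu>) c * pairing c a" for a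
      by (simp add: refl_pairing)
    then show ?case using Cons pairing_R by auto
  qed (use assms in simp)
  show ?thesis unfolding P_iff
  proof
    fix \<alpha> assume "\<alpha> \<in> R"
    then obtain w a where w: "w \<in> weyl B" "a \<in> B" "\<alpha> = w a" using root_conj_base by blast
    then obtain ws where ws: "set ws \<subseteq> B" "w = wprod ws" by (auto simp: weyl_iff)
    have "pairing \<mu> \<alpha> = pairing (wprod (rev ws) \<mu>) a"
      using pairing_orthogonal[OF orthogonal_wprod[of ws], of "wprod (rev ws) \<mu>" a] w(3) ws(2)
      by (simp add: wprod_rev_right)
    then show "pairing \<mu> \<alpha> \<in> \<int>" using inv[of "rev ws"] ws w by simp
  qed
qed

lemma weight_exists:
  assumes "\<And>a. a \<in> B \<Longrightarrow> g a \<in> \<int>"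
  obtains \<mu> where "\<mu> \<in> P" "\<And>a. a \<in> B \<Longrightarrow> pairing \<mu> a = g a"
  using dual_vector_exists[of g] weight_if_simple assms by metis

section \<open>Words of operators and braid relations\<close>

abbreviation "Tw q ws \<equiv> op_word (Tq R q) ws"

lemma Tw_OU [simp, intro]: "set ws \<subseteq> B \<Longrightarrow> f \<in> \<O> UNIV \<Longrightarrow> Tw q ws f \<in> \<O> UNIV"
  by (induction ws) auto

lemma Tw_add:
  "set ws \<subseteq> B \<Longrightarrow> f \<in> \<O> UNIV \<Longrightarrow> g \<in> \<O> UNIV \<Longrightarrow> Tw q ws (f + g) = Tw q ws f + Tw q ws g"
  by (induction ws) (simp_all add: Tq_add)

lemma Tw_const_mult:
  "set ws \<subseteq> B \<Longrightarrow> f \<in> \<O> UNIV \<Longrightarrow> Tw q ws (sg 0 c * f) = sg 0 c * Tw q ws f"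
  by (induction ws) (simp_all add: Tq_const_mult)

lemma Tw_fixed:
  assumes "set ws \<subseteq> B" "\<mu> \<in> P" "f \<in> \<O> UNIV" "\<And>c. c \<in> set ws \<Longrightarrow> pairing \<mu> c = 0"
  shows "Tw q ws (ex \<mu> * f) = ex \<mu> * Tw q ws f"
  using assms
proof (induction ws)
  case (Cons c ws)
  then show ?case using Tq_ex(1)[of c \<mu> "Tw q ws f" q] by simp
qed simp

text \<open>The pairing of -\<rho> with each letter is -1, where \<open>dem\<close> is an empty sum,
  so only the summand -f of the operator survives.\<close>

lemma Tw_sign:
  assumes "set ws \<subseteq> B" "\<rho> \<in> P" "\<And>c. c \<in> set ws \<Longrightarrow> pairing \<rho> c = 1"
  shows "Tw q ws (ex (-\<rho>)) = (-1) ^ length ws * ex (-\<rho>)"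
  using assms
proof (induction ws)
  case (Cons c ws)
  have c: "c \<in> R" using Cons.prems by auto
  have "pairing (-\<rho>) c = - real (Suc 0)" using Cons.prems by simp
  from is_dem_neg[OF this, of 1] have "dem R c (ex (-\<rho>)) = 0" using c by (intro dem_eqI) auto
  then have t: "Tq R q c (ex (-\<rho>)) = - ex (-\<rho>)" by (simp add: Tq_def)
  have s: "(-1) ^ n = sg (0::'a) ((-1) ^ n :: Kv)" for n
    by (induction n) (simp_all add: single_uminus)
  have "Tw q (c # ws) (ex (-\<rho>)) = Tq R q c ((-1) ^ length ws * ex (-\<rho>))" using Cons by simp
  also have "\<dots> = (-1) ^ length ws * Tq R q c (ex (-\<rho>))"
    unfolding s using c Cons.prems by (intro Tq_const_mult) (auto intro: P_uminus)
  finally show ?case by (simp add: t)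
qed simp

text \<open>An operator \<open>E\<close> that commutes with the \<open>e\<^sup>\<lambda>\<close> up to changing \<open>\<lambda>\<close> and that kills \<open>e\<^sup>-\<^sup>\<rho>\<close>
  is zero; the difference of the two sides of a braid relation is such an operator.\<close>
lemma braid_from_commutators:
  assumes ab: "a \<in> B" "b \<in> B" and us: "set us \<subseteq> {a,b}" and vs: "set vs \<subseteq> {a,b}" and len: "length us = length vs"
    and l1: "\<kappa>1 \<in> P" "pairing \<kappa>1 a = 1" "pairing \<kappa>1 b = 0"
    and l2: "\<kappa>2 \<in> P" "pairing \<kappa>2 b = 1"
    and E1: "\<And>f. f \<in> \<O> UNIV \<Longrightarrow> Tw q us (ex \<kappa>1 * f) - Tw q vs (ex \<kappa>1 * f) = ex \<nu>1 * (Tw q us f - Tw q vs f)"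
    and E2: "\<And>f. f \<in> \<O> UNIV \<Longrightarrow> Tw q us (ex \<kappa>2 * f) - Tw q vs (ex \<kappa>2 * f) = ex \<nu>2 * (Tw q us f - Tw q vs f)"
    and f: "f \<in> \<O> UNIV"
  shows "Tw q us f = Tw q vs f"
proof -
  have usB: "set us \<subseteq> B" "set vs \<subseteq> B" using ab us vs by auto
  define E where "E f = Tw q us f - Tw q vs f" for f
  define Q where "Q \<kappa> \<longleftrightarrow> \<kappa> \<in> P \<and> (\<exists>\<nu>. \<forall>f\<in>\<O> UNIV. E (ex \<kappa> * f) = ex \<nu> * E f)" for \<kappa>
  have Qadd: "Q (\<kappa> + \<mu>)" if "Q \<kappa>" "Q \<mu>" for \<kappa> \<mu>
  proof -
    obtain \<nu> \<nu>' where n: "\<And>f. f \<in> \<O> UNIV \<Longrightarrow> E (ex \<kappa> * f) = ex \<nu> * E f"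
      "\<And>f. f \<in> \<O> UNIV \<Longrightarrow> E (ex \<mu> * f) = ex \<nu>' * E f" using \<open>Q \<kappa>\<close> \<open>Q \<mu>\<close> unfolding Q_def by blast
    have m: "\<kappa> \<in> P" "\<mu> \<in> P" using that by (auto simp: Q_def)
    have "E (ex (\<kappa> + \<mu>) * f) = ex (\<nu> + \<nu>') * E f" if "f \<in> \<O> UNIV" for f
    proof -
      have e: "ex (x + y) * g = ex x * (ex y * g)" for x y and g :: "'a \<Rightarrow>\<^sub>0 Kv"
        by (simp add: mult.assoc[symmetric] mult_single)
      show ?thesis unfolding e using n that m by simp
    qed
    then show ?thesis unfolding Q_def using m P_add by blast
  qed
  have Qneg: "Q (- \<kappa>)" if "Q \<kappa>" for \<kappa>
  proof -
    obtain \<nu> where n: "\<And>f. f \<in> \<O> UNIV \<Longrightarrow> E (ex \<kappa> * f) = ex \<nu> * E f" using \<open>Q \<kappa>\<close> unfolding Q_def by blast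
    have m: "-\<kappa> \<in> P" using that P_uminus by (auto simp: Q_def)
    have "E (ex (-\<kappa>) * f) = ex (-\<nu>) * E f" if "f \<in> \<O> UNIV" for f
    proof -
      have "E f = E (ex \<kappa> * (ex (-\<kappa>) * f))" by (simp add: mult.assoc[symmetric] mult_single)
      also have "\<dots> = ex \<nu> * E (ex (-\<kappa>) * f)" using n that m by simp
      finally show ?thesis by (simp add: mult.assoc[symmetric] mult_single)
    qed
    then show ?thesis unfolding Q_def using m by blast
  qed
  have Qfix: "Q \<kappa>" if "\<kappa> \<in> P" "pairing \<kappa> a = 0" "pairing \<kappa> b = 0" for \<kappa>
  proof -
    have "E (ex \<kappa> * f) = ex \<kappa> * E f" if "f \<in> \<O> UNIV" for f
    proof -
      have "pairing \<kappa> c = 0" if "c \<in> set us \<union> set vs" for c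
        using that us vs \<open>pairing \<kappa> a = 0\<close> \<open>pairing \<kappa> b = 0\<close> by auto
      then show ?thesis
        unfolding E_def using Tw_fixed[OF usB(1) \<open>\<kappa> \<in> P\<close> that, of q] Tw_fixed[OF usB(2) \<open>\<kappa> \<in> P\<close> that, of q]
        by (simp add: right_diff_distrib)
    qed
    then show ?thesis unfolding Q_def using that by blast
  qed
  have Qnat: "Q (real n *\<^sub>R \<kappa>)" if "Q \<kappa>" for \<kappa> n
  proof (induction n)
    case 0 then show ?case using Qfix[of 0] by simp
  next
    case (Suc n) then show ?case using Qadd[OF that Suc] by (simp add: algebra_simps)
  qed
  have Qint: "Q (c *\<^sub>R \<kappa>)" if "Q \<kappa>" "c \<in> \<int>" for \<kappa> c
  proof -
    obtain z where z: "c = of_int z" using \<open>c \<in> \<int>\<close> by (auto elim: Ints_cases)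
    show ?thesis
    proof (cases "z \<ge> 0")
      case True then show ?thesis using Qnat[OF that(1), of "nat z"] z by simp
    next
      case False then show ?thesis using Qneg[OF Qnat[OF that(1), of "nat (- z)"]] z by simp
    qed
  qed
  have Q1: "Q \<kappa>1" "Q \<kappa>2" unfolding Q_def E_def using l1 l2 E1 E2 by blast+
  define t where "t = pairing \<kappa>2 a"
  have t: "t \<in> \<int>" using l2 ab by (auto simp: t_def P_iff)
  have QP: "Q \<kappa>" if "\<kappa> \<in> P" for \<kappa>
  proof -
    \<comment> \<open>Triangular elimination: \<kappa>1 is orthogonal to b, so the pairing with b
      fixes the multiple of \<kappa>2, and what then remains at a fixes that of \<kappa>1.\<close>
    define n where "n = pairing \<kappa> b"
    define m where "m = pairing \<kappa> a - n * t"
    have i: "n \<in> \<int>" "m \<in> \<int>" using that ab t unfolding n_def m_def by (auto simp: P_iff)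
    let ?l0 = "\<kappa> - n *\<^sub>R \<kappa>2 - m *\<^sub>R \<kappa>1"
    have q0: "Q ?l0" using that l1 l2 i
      by (intro Qfix P_diff P_scale) (auto simp: n_def m_def t_def)
    then have "Q (?l0 + n *\<^sub>R \<kappa>2 + m *\<^sub>R \<kappa>1)"
      by (intro Qadd q0 Qint Q1 i)
    then show ?thesis by simp
  qed
  \<comment> \<open>Pairing 1 with a and b alone is enough here, since no other letters occur in the
    two words.\<close>
  define \<rho> where "\<rho> = \<kappa>2 + (1 - t) *\<^sub>R \<kappa>1"
  have r: "\<rho> \<in> P" unfolding \<rho>_def using l1 l2 t by (intro P_add P_scale) auto
  have "pairing \<rho> a = 1" "pairing \<rho> b = 1" using l1 l2 by (auto simp: t_def \<rho>_def)
  then have "pairing \<rho> c = 1" if "c \<in> set us \<union> set vs" for c using that us vs by auto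
  then have Er: "E (ex (- \<rho>)) = 0"
    unfolding E_def using Tw_sign[OF usB(1) r, of q] Tw_sign[OF usB(2) r, of q] len by simp
  have Eex: "E (ex \<mu>) = 0" if mP: "\<mu> \<in> P" for \<mu>
  proof -
    obtain \<nu> where n: "\<And>f. f \<in> \<O> UNIV \<Longrightarrow> E (ex (\<mu> + \<rho>) * f) = ex \<nu> * E f"
      using QP[OF P_add[OF mP r]] unfolding Q_def by blast
    have "ex \<mu> = ex (\<mu> + \<rho>) * ex (- \<rho>)" by (simp add: mult_single)
    then show ?thesis using n[of "ex (- \<rho>)"] Er r P_uminus by simp
  qed
  have "E f = 0" using f add_closed_UNIV
  proof (induction f rule: grp_over_induct)
    case zero
    then show ?case using Eex Tw_const_mult[OF usB(1), of 0 q 0] Tw_const_mult[OF usB(2), of 0 q 0]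
      by (simp add: E_def)
  next
    case (single \<mu> c)
    then have "E (sg 0 c * ex \<mu>) = sg 0 c * E (ex \<mu>)"
      by (simp add: E_def Tw_const_mult[OF usB(1)] Tw_const_mult[OF usB(2)] right_diff_distrib)
    then show ?case using Eex[OF single(1)] by (simp add: mult_single)
  next
    case (add f g)
    then show ?case by (simp add: E_def Tw_add[OF usB(1)] Tw_add[OF usB(2)])
  qed
  then show ?thesis by (simp add: E_def)
qed

lemma hecke_pair_Tq:
  assumes "a \<in> R" "b \<in> R"
  shows "hecke_pair (\<O> UNIV) (Tq R q a) (Tq R q b) (sg 0 q) (1 - sg 0 q)"
proof -
  have d: "Tq R q c (x - y) = Tq R q c x - Tq R q c y"
    if "c \<in> R" "x \<in> \<O> UNIV" "y \<in> \<O> UNIV" for c x y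
    using Tq_add[of c "x - y" y q] that by simp
  have k: "Tq R q c ((1 - sg 0 q) * x) = (1 - sg 0 q) * Tq R q c x"
    if "c \<in> R" "x \<in> \<O> UNIV" for c x
  proof -
    have e: "(1 - sg 0 q) * y = y - sg 0 q * y" for y :: "'a \<Rightarrow>\<^sub>0 Kv" by (simp add: left_diff_distrib)
    show ?thesis unfolding e using that by (simp add: d Tq_const_mult)
  qed
  show ?thesis
    by unfold_locales (use assms in \<open>auto simp: Tq_add d k Tq_const_mult Tq_quad\<close>)
qed

text \<open>\<open>us\<close> and \<open>vs\<close> are the two alternating words of maximal length in the dihedral group of \<open>a\<close>, \<open>b\<close>.\<close>
definition braid_words :: "'a \<Rightarrow> 'a \<Rightarrow> 'a list \<Rightarrow> 'a list \<Rightarrow> bool" where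
  "braid_words a b us vs \<longleftrightarrow> us \<noteq> [] \<and> vs \<noteq> [] \<and> hd us = a \<and> hd vs = b \<and> set us \<subseteq> B \<and> set vs \<subseteq> B \<and>
     length us = length vs \<and> wprod us = wprod vs \<and>
     (\<forall>w\<in>weyl B. ht (inv w a) < 0 \<and> ht (inv w b) < 0 \<longrightarrow> (\<forall>r\<in>set (roots_of us) \<union> set (roots_of vs). ht (inv w r) < 0)) \<and>
     (\<forall>q. \<forall>f\<in>\<O> UNIV. Tw q us f = Tw q vs f)"

lemma braid_words_sym: "braid_words a b us vs \<Longrightarrow> braid_words b a vs us"
  unfolding braid_words_def
proof (elim conjE, intro conjI)
  assume "\<forall>q. \<forall>f\<in>\<O> UNIV. Tw q us f = Tw q vs f"
  then show "\<forall>q. \<forall>f\<in>\<O> UNIV. Tw q vs f = Tw q us f" by metis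
next
  assume "\<forall>w\<in>weyl B. ht (inv w a) < 0 \<and> ht (inv w b) < 0 \<longrightarrow>
    (\<forall>r\<in>set (roots_of us) \<union> set (roots_of vs). ht (inv w r) < 0)"
  then show "\<forall>w\<in>weyl B. ht (inv w b) < 0 \<and> ht (inv w a) < 0 \<longrightarrow>
    (\<forall>r\<in>set (roots_of vs) \<union> set (roots_of us). ht (inv w r) < 0)" by blast
qed (assumption | rule sym, assumption)+

section \<open>The braid relation of two simple roots, type by type\<close>

context
  fixes a b :: 'a and n m :: real
  assumes ab: "a \<in> B" "b \<in> B" "a \<noteq> b" and pba: "pairing b a = - n" and pab: "pairing a b = - m"
begin

text \<open>A normal form in which both reflections only change two scalar coordinates, so that
  equality of the two braid words becomes arithmetic.\<close>

lemma refl_normal: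
  "refl a (y + x *\<^sub>R a + z *\<^sub>R b) = y + (n * z - x - pairing y a) *\<^sub>R a + z *\<^sub>R b"
  "refl b (y + x *\<^sub>R a + z *\<^sub>R b) = y + x *\<^sub>R a + (m * x - z - pairing y b) *\<^sub>R b"
proof -
  have "a \<noteq> 0" "b \<noteq> 0" using ab nonzero_root[of a] nonzero_root[of b] by auto
  then have "pairing (y + x *\<^sub>R a + z *\<^sub>R b) a = pairing y a + 2 * x - n * z"
    "pairing (y + x *\<^sub>R a + z *\<^sub>R b) b = pairing y b + 2 * z - m * x"
    by (simp_all add: pba pab)
  then have "refl a (y + x *\<^sub>R a + z *\<^sub>R b) = y + (x - (pairing y a + 2 * x - n * z)) *\<^sub>R a + z *\<^sub>R b"
    "refl b (y + x *\<^sub>R a + z *\<^sub>R b) = y + x *\<^sub>R a + (z - (pairing y b + 2 * z - m * x)) *\<^sub>R b"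
    unfolding refl_pairing by (simp_all only: scaleR_diff_left) (simp_all add: algebra_simps)
  moreover have "x - (pairing y a + 2 * x - n * z) = n * z - x - pairing y a"
    "z - (pairing y b + 2 * z - m * x) = m * x - z - pairing y b" by simp_all
  ultimately show "refl a (y + x *\<^sub>R a + z *\<^sub>R b) = y + (n * z - x - pairing y a) *\<^sub>R a + z *\<^sub>R b"
    "refl b (y + x *\<^sub>R a + z *\<^sub>R b) = y + x *\<^sub>R a + (m * x - z - pairing y b) *\<^sub>R b"
    by simp_all
qed

lemma refl_normal0:
  "refl a (x *\<^sub>R a + z *\<^sub>R b) = (n * z - x) *\<^sub>R a + z *\<^sub>R b"
  "refl b (x *\<^sub>R a + z *\<^sub>R b) = x *\<^sub>R a + (m * x - z) *\<^sub>R b"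
  using refl_normal[of 0 x z] by simp_all

lemma ht_inv_normal:
  "w \<in> weyl B \<Longrightarrow> ht (inv w (x *\<^sub>R a + z *\<^sub>R b)) = x * ht (inv w a) + z * ht (inv w b)"
  using weyl_linear[OF weyl_inv]
  by (simp add: linear_add linear_cmul linear_add[OF linear_ht] linear_cmul[OF linear_ht])

lemma fundamental_weight:
  obtains \<omega> where "\<omega> \<in> P" "pairing \<omega> a = 1" "pairing \<omega> b = 0"
proof -
  obtain \<omega> where "\<omega> \<in> P" "\<And>c. c \<in> B \<Longrightarrow> pairing \<omega> c = (if c = a then 1 else 0)"
    by (rule weight_exists[of "\<lambda>c. if c = a then 1 else 0"]) auto
  then show thesis using that[of \<omega>] ab by simp
qed

text \<open>The letters are written as combinations of a and b so that \<open>refl_normal0\<close>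
  applies to them.\<close>

lemma roots_normal:
  "roots_of (a # us) = (1 *\<^sub>R a + 0 *\<^sub>R b) # map (refl a) (roots_of us)"
  "roots_of (b # us) = (0 *\<^sub>R a + 1 *\<^sub>R b) # map (refl b) (roots_of us)"
  by simp_all


lemma pairings [simp]:
  "pairing a a = 2" "pairing b b = 2" "pairing b a = - n" "pairing a b = - m" "a \<in> R" "b \<in> R" "a \<in> P" "b \<in> P"
  using ab nonzero_root[of a] nonzero_root[of b] R_P by (auto simp: pba pab)

interpretation hecke_pair "\<O> UNIV" "Tq R q a" "Tq R q b" "sg 0 q" "1 - sg 0 q" for q
  by (rule hecke_pair_Tq) (use ab in auto)

lemma fixes_weightI: "c \<in> R \<Longrightarrow> \<mu> \<in> P \<Longrightarrow> pairing \<mu> c = 0 \<Longrightarrow> fixes_weight (Tq R q c) (ex \<mu>)"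
  unfolding fixes_weight_def using Tq_ex(1) by auto

lemma swaps_weightsI:
  assumes "c \<in> R" "\<mu> \<in> P" "pairing \<mu> c = 1" "\<nu> = \<mu> - c"
  shows "swaps_weights q (Tq R q c) (ex \<mu>) (ex \<nu>)"
proof -
  have c: "c \<in> P" using assms(1) R_P by blast
  have n: "\<nu> \<in> P" "pairing \<nu> c = -1" "\<nu> + c = \<mu>"
    using assms c nonzero_root[of c] by (auto intro: P_diff)
  show ?thesis unfolding swaps_weights_def
    using Tq_ex(2)[OF assms(1,2) _ assms(3), of _ q] Tq_ex(3)[OF assms(1) n(1) _ n(2), of _ q] n assms by auto
qed

lemma string_weightsI:
  assumes "c \<in> R" "\<mu> \<in> P" "pairing \<mu> c = 2" "\<nu>0 = \<mu> - c" "\<nu> = \<nu>0 - c"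
  shows "string_weights q (Tq R q c) (ex \<mu>) (ex \<nu>0) (ex \<nu>)"
proof -
  have c: "c \<in> P" using assms(1) R_P by blast
  have n: "\<nu>0 \<in> P" "pairing \<nu>0 c = 0" "\<nu> \<in> P" "pairing \<nu> c = -2" "\<nu> + c = \<nu>0" "\<nu>0 + c = \<mu>"
    using assms c nonzero_root[of c] by (auto intro: P_diff)
  show ?thesis unfolding string_weights_def
    using Tq_ex(4)[OF assms(1,2) _ assms(3), of _ q] Tq_ex(1)[OF assms(1) n(1) _ n(2), of _ q]
      Tq_ex(5)[OF assms(1) n(3) _ n(4), of _ q] n assms by auto
qed

text \<open>A checkable condition which ensures that \<open>inv w\<close> makes a root negative as
  soon as it does so for a and b.\<close>

definition pos_comb :: "'a \<Rightarrow> bool" where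
  "pos_comb r \<longleftrightarrow> (\<exists>x\<ge>0. \<exists>z\<ge>0. x + z > 0 \<and> r = x *\<^sub>R a + z *\<^sub>R b)"

lemma pos_combI: "x \<ge> 0 \<Longrightarrow> z \<ge> 0 \<Longrightarrow> x + z > 0 \<Longrightarrow> pos_comb (x *\<^sub>R a + z *\<^sub>R b)"
  unfolding pos_comb_def by blast

lemma pos_comb_neg:
  assumes "pos_comb r" "w \<in> weyl B" "ht (inv w a) < 0" "ht (inv w b) < 0"
  shows "ht (inv w r) < 0"
proof -
  obtain x z where x: "x \<ge> 0" "z \<ge> 0" "x + z > 0" "r = x *\<^sub>R a + z *\<^sub>R b"
    using assms(1) by (auto simp: pos_comb_def)
  have "x * ht (inv w a) \<le> 0" "z * ht (inv w b) \<le> 0"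
    using x assms by (simp_all add: mult_nonneg_nonpos)
  moreover have "x * ht (inv w a) < 0 \<or> z * ht (inv w b) < 0"
    using x assms by (cases "x > 0") (auto simp: mult_pos_neg)
  ultimately show ?thesis unfolding x(4) ht_inv_normal[OF assms(2)] by linarith
qed

lemma braid_wordsI:
  assumes "us \<noteq> []" "vs \<noteq> []" "hd us = a" "hd vs = b" "set us \<subseteq> {a, b}" "set vs \<subseteq> {a, b}" "length us = length vs"
    and "\<And>y x z. wprod us (y + x *\<^sub>R a + z *\<^sub>R b) = wprod vs (y + x *\<^sub>R a + z *\<^sub>R b)"
    and "list_all pos_comb (roots_of us)" "list_all pos_comb (roots_of vs)"
    and "\<And>q f. f \<in> \<O> UNIV \<Longrightarrow> Tw q us f = Tw q vs f"
  shows "braid_words a b us vs"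
  unfolding braid_words_def
proof (intro conjI ballI impI allI)
  show "set us \<subseteq> B" "set vs \<subseteq> B" using assms(5,6) ab by auto
  show "wprod us = wprod vs" using assms(8)[of _ 0 0] by (simp add: fun_eq_iff)
  fix w r assume "w \<in> weyl B" "ht (inv w a) < 0 \<and> ht (inv w b) < 0" "r \<in> set (roots_of us) \<union> set (roots_of vs)"
  then show "ht (inv w r) < 0" using pos_comb_neg assms(9,10) by (auto simp: list_all_iff)
qed (use assms in auto)

text \<open>The orbit of \<omega> contains no weight with pairing 1 at b, so a second fundamental
  weight is used, with the roles of a and b exchanged.\<close>

lemma braid_A1A1:
  assumes nm: "n = 0" "m = 0" shows "braid_words a b [a,b] [b,a]"
proof (rule braid_wordsI)
  obtain \<omega> where o: "\<omega> \<in> P" "pairing \<omega> a = 1" "pairing \<omega> b = 0" by (rule fundamental_weight)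
  obtain \<omega>' where o': "\<omega>' \<in> P" "pairing \<omega>' b = 1" "pairing \<omega>' a = 0"
    by (rule weight_exists[of "\<lambda>c. if c = b then 1 else 0"]) (use ab in auto)
  show "Tw q [a,b] f = Tw q [b,a] f" if "f \<in> \<O> UNIV" for q f
  proof (rule braid_from_commutators[of a b "[a,b]" "[b,a]" \<omega> \<omega>' q "\<omega> - a" "\<omega>' - b"])
    fix f :: "'a \<Rightarrow>\<^sub>0 Kv" assume f: "f \<in> \<O> UNIV"
    show "Tw q [a,b] (ex \<omega> * f) - Tw q [b,a] (ex \<omega> * f) = ex (\<omega> - a) * (Tw q [a,b] f - Tw q [b,a] f)"
      unfolding op_word_Cons op_word_Nil
      by (rule commutator_A1A1[OF swaps_weightsI fixes_weightI fixes_weightI])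
        (use f o nm in \<open>auto intro: P_diff\<close>)
    interpret r: hecke_pair "\<O> UNIV" "Tq R q b" "Tq R q a" "sg 0 q" "1 - sg 0 q"
      by (rule hecke_pair_Tq) auto
    have "Tw q [b,a] (ex \<omega>' * f) - Tw q [a,b] (ex \<omega>' * f) = ex (\<omega>' - b) * (Tw q [b,a] f - Tw q [a,b] f)"
      unfolding op_word_Cons op_word_Nil
      by (rule r.commutator_A1A1[OF swaps_weightsI fixes_weightI fixes_weightI])
        (use f o' nm in \<open>auto intro: P_diff\<close>)
    then show "Tw q [a,b] (ex \<omega>' * f) - Tw q [b,a] (ex \<omega>' * f) = ex (\<omega>' - b) * (Tw q [a,b] f - Tw q [b,a] f)"
      by (simp add: algebra_simps)
  qed (use ab o o' that in auto)
  show "wprod [a,b] (y + x *\<^sub>R a + z *\<^sub>R b) = wprod [b,a] (y + x *\<^sub>R a + z *\<^sub>R b)" for y x z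
    unfolding wprod_Cons wprod_Nil comp_apply id_apply refl_normal nm
    by (rule arg_cong2[where f = "\<lambda>u v. y + u *\<^sub>R a + v *\<^sub>R b"]) (simp_all add: algebra_simps)
  show "list_all pos_comb (roots_of [a,b])" "list_all pos_comb (roots_of [b,a])"
    unfolding roots_normal roots_of.simps(1) list.map refl_normal0 list.pred_inject nm
    by (intro conjI pos_combI TrueI; simp)+
qed simp_all

text \<open>As the pairing of a with b is -1, the weight \<omega> - a has pairing 1 with b. It
  serves as second generator here and in the two types that follow.\<close>

lemma braid_A2:
  assumes nm: "n = 1" "m = 1" shows "braid_words a b [a,b,a] [b,a,b]"
proof (rule braid_wordsI)
  obtain \<omega> where o: "\<omega> \<in> P" "pairing \<omega> a = 1" "pairing \<omega> b = 0" by (rule fundamental_weight)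
  define p2 where "p2 = \<omega> - a"
  define p3 where "p3 = p2 - b"
  note d = p2_def p3_def
  have P: "p2 \<in> P" "p3 \<in> P" using o by (auto simp: d intro!: P_diff)
  have w: "swaps_weights q (Tq R q a) (ex \<omega>) (ex p2)" "fixes_weight (Tq R q b) (ex \<omega>)"
    "swaps_weights q (Tq R q b) (ex p2) (ex p3)" "fixes_weight (Tq R q a) (ex p3)" for q
    by (intro swaps_weightsI fixes_weightI; use o P nm in \<open>simp add: d\<close>)+
  show "Tw q [a,b,a] f = Tw q [b,a,b] f" if "f \<in> \<O> UNIV" for q f
    by (rule braid_from_commutators[of a b "[a,b,a]" "[b,a,b]" \<omega> p2 q p3 p2, OF ab(1,2) _ _ _ o P(1) _ _ _ that])
      (use commutator_A2[OF w] o nm in \<open>simp_all add: d\<close>)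
  show "wprod [a,b,a] (y + x *\<^sub>R a + z *\<^sub>R b) = wprod [b,a,b] (y + x *\<^sub>R a + z *\<^sub>R b)" for y x z
    unfolding wprod_Cons wprod_Nil comp_apply id_apply refl_normal nm
    by (rule arg_cong2[where f = "\<lambda>u v. y + u *\<^sub>R a + v *\<^sub>R b"]) (simp_all add: algebra_simps)
  show "list_all pos_comb (roots_of [a,b,a])" "list_all pos_comb (roots_of [b,a,b])"
    unfolding roots_normal roots_of.simps(1) list.map refl_normal0 list.pred_inject nm
    by (intro conjI pos_combI TrueI; simp)+
qed simp_all

text \<open>a is the short root, so the orbit of \<omega> consists of four weights with pairings 0,
  1 and -1 only.\<close>

lemma braid_B2:
  assumes nm: "n = 2" "m = 1" shows "braid_words a b [a,b,a,b] [b,a,b,a]"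
proof (rule braid_wordsI)
  obtain \<omega> where o: "\<omega> \<in> P" "pairing \<omega> a = 1" "pairing \<omega> b = 0" by (rule fundamental_weight)
  define p2 where "p2 = \<omega> - a"
  define p3 where "p3 = p2 - b"
  define p4 where "p4 = p3 - a"
  note d = p2_def p3_def p4_def
  have P: "p2 \<in> P" "p3 \<in> P" "p4 \<in> P" using o by (auto simp: d intro!: P_diff)
  have w: "swaps_weights q (Tq R q a) (ex \<omega>) (ex p2)" "fixes_weight (Tq R q b) (ex \<omega>)"
    "swaps_weights q (Tq R q b) (ex p2) (ex p3)" "swaps_weights q (Tq R q a) (ex p3) (ex p4)"
    "fixes_weight (Tq R q b) (ex p4)" for q
    by (intro swaps_weightsI fixes_weightI; use o P nm in \<open>simp add: d\<close>)+
  show "Tw q [a,b,a,b] f = Tw q [b,a,b,a] f" if "f \<in> \<O> UNIV" for q f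
    by (rule braid_from_commutators[of a b "[a,b,a,b]" "[b,a,b,a]" \<omega> p2 q p4 p3, OF ab(1,2) _ _ _ o P(1) _ _ _ that])
      (use commutator_B2[OF w] o nm in \<open>simp_all add: d\<close>)
  show "wprod [a,b,a,b] (y + x *\<^sub>R a + z *\<^sub>R b) = wprod [b,a,b,a] (y + x *\<^sub>R a + z *\<^sub>R b)" for y x z
    unfolding wprod_Cons wprod_Nil comp_apply id_apply refl_normal nm
    by (rule arg_cong2[where f = "\<lambda>u v. y + u *\<^sub>R a + v *\<^sub>R b"]) (simp_all add: algebra_simps)
  show "list_all pos_comb (roots_of [a,b,a,b])" "list_all pos_comb (roots_of [b,a,b,a])"
    unfolding roots_normal roots_of.simps(1) list.map refl_normal0 list.pred_inject nm
    by (intro conjI pos_combI TrueI; simp)+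
qed simp_all

text \<open>The weights are those of the seven-dimensional representation, attached to the short
  root a. Besides the orbit of \<omega> it contains \<open>p4\<close>, orthogonal to a and b, in the
  middle of a string of three.\<close>

lemma braid_G2:
  assumes nm: "n = 3" "m = 1" shows "braid_words a b [a,b,a,b,a,b] [b,a,b,a,b,a]"
proof (rule braid_wordsI)
  obtain \<omega> where o: "\<omega> \<in> P" "pairing \<omega> a = 1" "pairing \<omega> b = 0" by (rule fundamental_weight)
  define p2 where "p2 = \<omega> - a"
  define p3 where "p3 = p2 - b"
  define p4 where "p4 = p3 - a"
  define p5 where "p5 = p4 - a"
  define p6 where "p6 = p5 - b"
  define p7 where "p7 = p6 - a"
  note d = p2_def p3_def p4_def p5_def p6_def p7_def
  have P: "p2 \<in> P" "p3 \<in> P" "p4 \<in> P" "p5 \<in> P" "p6 \<in> P" "p7 \<in> P"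
    using o by (auto simp: d intro!: P_diff)
  have w: "swaps_weights q (Tq R q a) (ex \<omega>) (ex p2)" "fixes_weight (Tq R q b) (ex \<omega>)"
    "swaps_weights q (Tq R q b) (ex p2) (ex p3)" "string_weights q (Tq R q a) (ex p3) (ex p4) (ex p5)"
    "fixes_weight (Tq R q b) (ex p4)" "swaps_weights q (Tq R q b) (ex p5) (ex p6)"
    "swaps_weights q (Tq R q a) (ex p6) (ex p7)" "fixes_weight (Tq R q b) (ex p7)" for q
    by (intro swaps_weightsI fixes_weightI string_weightsI; use o P nm in \<open>simp add: d\<close>)+
  show "Tw q [a,b,a,b,a,b] f = Tw q [b,a,b,a,b,a] f" if "f \<in> \<O> UNIV" for q f
    by (rule braid_from_commutators[of a b "[a,b,a,b,a,b]" "[b,a,b,a,b,a]" \<omega> p2 q p7 p6, OF ab(1,2) _ _ _ o P(1) _ _ _ that])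
      (use commutator_G2[OF w] o nm in \<open>simp_all add: d\<close>)
  show "wprod [a,b,a,b,a,b] (y + x *\<^sub>R a + z *\<^sub>R b) = wprod [b,a,b,a,b,a] (y + x *\<^sub>R a + z *\<^sub>R b)" for y x z
    unfolding wprod_Cons wprod_Nil comp_apply id_apply refl_normal nm
    by (rule arg_cong2[where f = "\<lambda>u v. y + u *\<^sub>R a + v *\<^sub>R b"]) (simp_all add: algebra_simps)
  show "list_all pos_comb (roots_of [a,b,a,b,a,b])" "list_all pos_comb (roots_of [b,a,b,a,b,a])"
    unfolding roots_normal roots_of.simps(1) list.map refl_normal0 list.pred_inject nm
    by (intro conjI pos_combI TrueI; simp)+
qed simp_all

end

text \<open>The four types above cover the pairs in which a is not longer than b; the rest follows
  by exchanging a and b.\<close>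

lemma braid_words_exist:
  assumes "a \<in> B" "b \<in> B" "a \<noteq> b"
  shows "\<exists>us vs. braid_words a b us vs"
proof -
  have short: "\<exists>us vs. braid_words a b us vs"
    if ab: "a \<in> B" "b \<in> B" "a \<noteq> b"
      and "(pairing a b, pairing b a) \<in> {(0,0), (-1,-1), (-1,-2), (-1,-3)}" for a b
  proof -
    have "(pairing a b = 0 \<and> pairing b a = 0) \<or> (pairing a b = -1 \<and> pairing b a = -1) \<or>
        (pairing a b = -1 \<and> pairing b a = -2) \<or> (pairing a b = -1 \<and> pairing b a = -3)"
      using that(4) by auto
    then show ?thesis
    proof (elim disjE conjE)
      assume "pairing a b = 0" "pairing b a = 0"
      then show ?thesis using braid_A1A1[OF ab, of 0 0] by auto
    next
      assume "pairing a b = -1" "pairing b a = -1"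
      then show ?thesis using braid_A2[OF ab, of 1 1] by auto
    next
      assume "pairing a b = -1" "pairing b a = -2"
      then show ?thesis using braid_B2[OF ab, of 2 1] by auto
    next
      assume "pairing a b = -1" "pairing b a = -3"
      then show ?thesis using braid_G2[OF ab, of 3 1] by auto
    qed
  qed
  show ?thesis
  proof (cases "(pairing a b, pairing b a) \<in> {(0,0), (-1,-1), (-1,-2), (-1,-3)}")
    case True then show ?thesis using short assms by blast
  next
    case False
    then have "(pairing b a, pairing a b) \<in> {(0,0), (-1,-1), (-1,-2), (-1,-3)}"
      using cartan_cases[OF assms] by auto
    from short[OF assms(2,1) assms(3)[symmetric] this] show ?thesis using braid_words_sym by blast
  qed
qed

text \<open>Matsumoto's argument: two reduced words of the same element with different first letters \<open>a\<close>, \<open>b\<close>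
  are linked by reduced words beginning with the two sides of the braid relation of \<open>a\<close>, \<open>b\<close>.\<close>
lemma Tw_reduced:
  assumes "red us" "red vs" "wprod us = wprod vs" "f \<in> \<O> UNIV"
  shows "Tw q us f = Tw q vs f"
  using assms
proof (induction "length us" arbitrary: us vs f rule: less_induct)
  case less
  have len: "length us = length vs" using less.prems reduced_len by metis
  show ?case
  proof (cases us)
    case Nil then show ?thesis using len by simp
  next
    case us: (Cons a us')
    then obtain b vs' where vs: "vs = b # vs'" using len by (cases vs) auto
    have ab: "a \<in> B" "b \<in> B" and r': "red us'" "red vs'"
      using less.prems reduced_ConsD us vs by auto
    \<comment> \<open>Words with a common first letter: cancel it and apply the induction hypothesis
      to the tails.\<close>
    have step: "Tw q xs f = Tw q ys f"
      if "red xs" "red ys" "wprod xs = wprod us" "wprod ys = wprod us" "xs \<noteq> []" "ys \<noteq> []" "hd xs = hd ys" for xs ys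
    proof -
      obtain c xs' where x: "xs = c # xs'" using \<open>xs \<noteq> []\<close> by (cases xs) auto
      then obtain ys' where y: "ys = c # ys'" using \<open>ys \<noteq> []\<close> \<open>hd xs = hd ys\<close> by (cases ys) auto
      have "refl c \<circ> wprod xs' = refl c \<circ> wprod ys'" using that(3,4) unfolding x y wprod_Cons by simp
      then have e: "wprod xs' = wprod ys'" by (metis refl_comp_left)
      have "length xs = length us" using that(1,3) less.prems(1) reduced_len by metis
      then have "Tw q xs' f = Tw q ys' f"
        using less.hyps[of xs' ys' f] reduced_ConsD(1) that(1,2) less.prems(4) e unfolding x y by simp
      then show ?thesis unfolding x y by simp
    qed
    show ?thesis
    proof (cases "a = b")
      case True
      then show ?thesis using step[of us vs] less.prems us vs by simp
    next
      case False
      obtain ds es where br: "braid_words a b ds es" using braid_words_exist[OF ab False] by blast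
      then have d: "ds \<noteq> []" "es \<noteq> []" "hd ds = a" "hd es = b" "set ds \<subseteq> B" "set es \<subseteq> B"
        "length ds = length es" "wprod ds = wprod es"
        by (auto simp: braid_words_def)
      let ?w = "wprod us"
      have w: "?w \<in> weyl B" using reduced_B[OF less.prems(1)] by simp
      have "ht (inv ?w a) < 0"
      proof (rule descent_imp_neg[OF w ab(1)])
        show "len (refl a \<circ> ?w) < len ?w"
          using reduced_len[OF less.prems(1)] reduced_len[OF r'(1)] us by simp
      qed
      moreover have "ht (inv ?w b) < 0"
      proof (rule descent_imp_neg[OF w ab(2)])
        show "len (refl b \<circ> ?w) < len ?w"
          using reduced_len[OF less.prems(2)] reduced_len[OF r'(2)] vs less.prems(3) by simp
      qed
      ultimately have "\<forall>r\<in>set (roots_of ds). ht (inv ?w r) < 0"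
        using br w unfolding braid_words_def by blast
      from strip_descents[OF w d(5) this]
      have l: "len (wprod (rev ds) \<circ> ?w) + length ds = len ?w" .
      have "wprod (rev ds) \<circ> ?w \<in> weyl B" by (rule weyl_comp[OF weyl_wprod w]) (use d(5) in simp)
      \<comment> \<open>\<open>rs\<close> is what remains of the element after either side of the
        braid relation is split off.\<close>
      then obtain rs where rs: "red rs" "wprod rs = wprod (rev ds) \<circ> ?w" using reduced_exists by blast
      have p: "wprod (ds @ rs) = ?w" "wprod (es @ rs) = ?w"
        using rs(2) d(8)[symmetric] by (simp_all add: fun_eq_iff wprod_rev_right)
      have rB: "set rs \<subseteq> B" using rs reduced_B by blast
      have red: "red (ds @ rs)" "red (es @ rs)"
        using l reduced_len[OF rs(1)] rs(2) d rB p by (auto intro!: reducedI)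
      have "Tw q us f = Tw q (ds @ rs) f"
        using step[of us "ds @ rs"] less.prems(1) red p d us by simp
      also have "\<dots> = Tw q (es @ rs) f"
        using br rB less.prems(4) unfolding op_word_append braid_words_def by simp
      also have "\<dots> = Tw q vs f"
        using step[of "es @ rs" vs] less.prems(2,3) red p d vs by simp
      finally show ?thesis .
    qed
  qed
qed

end

section \<open>Linear independence of the operators\<close>

lemma map_poly_of_int:
  "map_poly of_int (p + q) = (map_poly of_int p + map_poly of_int q :: complex poly)"
  "map_poly of_int (p * q) = (map_poly of_int p * map_poly of_int q :: complex poly)"
  "map_poly of_int (- p) = (- map_poly of_int p :: complex poly)"
  by (auto intro!: poly_eqI simp: coeff_map_poly coeff_mult)

definition int_coeffs :: "Kv set" where
  "int_coeffs = range (\<lambda>p::int poly. Fract (map_poly of_int p) 1)"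

lemma int_coeffsI: "Fract (map_poly of_int p) 1 \<in> int_coeffs"
  by (auto simp: int_coeffs_def)

lemma subring_int_coeffs: "is_subring int_coeffs"
  unfolding is_subring_def
proof (intro conjI ballI)
  show "0 \<in> int_coeffs" using int_coeffsI[of 0] by (simp add: Zero_fract_def)
  show "1 \<in> int_coeffs" using int_coeffsI[of 1] by (simp add: One_fract_def)
next
  fix x y assume "x \<in> int_coeffs" "y \<in> int_coeffs"
  then obtain p r where "x = Fract (map_poly of_int p) 1" "y = Fract (map_poly of_int r) 1"
    by (auto simp: int_coeffs_def)
  then show "x + y \<in> int_coeffs" "x * y \<in> int_coeffs"
    using int_coeffsI[of "p + r"] int_coeffsI[of "p * r"] by (simp_all add: map_poly_of_int)
next
  fix x assume "x \<in> int_coeffs"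
  then obtain p where "x = Fract (map_poly of_int p) 1" by (auto simp: int_coeffs_def)
  then show "- x \<in> int_coeffs" using int_coeffsI[of "- p"] by (simp add: map_poly_of_int)
qed

lemma vv_int_coeffs: "vv \<in> int_coeffs"
  using int_coeffsI[of "[:0,1:]"] by (simp add: vv_def map_poly_pCons)

context based_root_system
begin

lemma ZvZP_eq: "ZvZP R = \<O> int_coeffs"
  by (auto simp: ZvZP_def grp_over_def int_coeffs_def)

text \<open>\<rho> has positive inner product with every positive root. If w is not the identity,
  the last letter a of a reduced word has \<open>w a\<close> negative; but if w fixes \<rho>, the
  products of \<rho> with \<open>w a\<close> and with a agree.\<close>

lemma regular_weight:
  obtains \<rho> where "\<rho> \<in> P" "\<And>w. w \<in> weyl B \<Longrightarrow> w \<rho> = \<rho> \<Longrightarrow> w = id"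
proof -
  obtain \<rho> where r: "\<rho> \<in> P" "\<And>a. a \<in> B \<Longrightarrow> pairing \<rho> a = 1" by (rule weight_exists[of "\<lambda>_. 1"]) auto
  have base: "\<rho> \<bullet> a > 0" if "a \<in> B" for a
    using r(2)[OF that] nonzero_root[of a] that inner_gt_zero_iff[of a]
    by (auto simp: pairing_def field_simps)
  have pos: "\<rho> \<bullet> \<alpha> > 0" if a: "\<alpha> \<in> R" "ht \<alpha> > 0" for \<alpha>
  proof -
    have "\<exists>\<gamma>\<in>B. coef \<gamma> \<alpha> > 0"
    proof (rule ccontr)
      assume "\<not> ?thesis"
      then have "ht \<alpha> \<le> 0" unfolding ht_def by (intro sum_nonpos) force
      then show False using a by simp
    qed
    then obtain \<gamma> where g: "\<gamma> \<in> B" "coef \<gamma> \<alpha> > 0" by blast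
    have "\<rho> \<bullet> \<alpha> = (\<Sum>\<gamma>\<in>B. coef \<gamma> \<alpha> * (\<rho> \<bullet> \<gamma>))"
      by (subst coef_expand[of \<alpha>, symmetric]) (simp add: inner_sum_right)
    also have "\<dots> > 0"
    proof (rule sum_pos2[OF finite_B g(1)])
      show "0 < coef \<gamma> \<alpha> * (\<rho> \<bullet> \<gamma>)" using g base by simp
      show "0 \<le> coef \<delta> \<alpha> * (\<rho> \<bullet> \<delta>)" if "\<delta> \<in> B" for \<delta>
        using coef_nonneg[OF a that] base[OF that] by simp
    qed
    finally show ?thesis .
  qed
  have "w = id" if w: "w \<in> weyl B" "w \<rho> = \<rho>" for w
  proof (rule ccontr)
    assume "w \<noteq> id"
    obtain ws where ws: "red ws" "wprod ws = w" using reduced_exists[OF w(1)] by blast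
    then have "ws \<noteq> []" using \<open>w \<noteq> id\<close> by auto
    then obtain us a where u: "ws = us @ [a]" by (metis append_butlast_last_id)
    have a: "a \<in> B" "set us \<subseteq> B" using reduced_B[OF ws(1)] u by auto
    have "w \<circ> refl a = wprod us" unfolding ws(2)[symmetric] u by (simp add: fun_eq_iff)
    then have "len (w \<circ> refl a) < len w"
      using len_le[OF a(2)] reduced_len[OF ws(1)] ws(2) u by simp
    then have "\<not> ht (w a) > 0" using len_refl_greater[OF w(1), of a] a by auto
    then have "ht (- w a) > 0" using ht_nonzero[OF weyl_R[OF w(1), of a]] a by auto
    then have "\<rho> \<bullet> (- w a) > 0" using pos uminus_R weyl_R[OF w(1)] a by blast
    moreover have "\<rho> \<bullet> w a = \<rho> \<bullet> a"
      using weyl_orthogonal[OF w(1)] w(2) unfolding orthogonal_transformation_def by metis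
    ultimately show False using base[OF a(1)] by simp
  qed
  then show thesis using that r(1) by blast
qed

text \<open>For large \<open>N\<close> the supports of the \<open>b\<^sub>w e\<^bsup>w(N\<rho>)\<^esup>\<close> are disjoint.\<close>
lemma weyl_independent:
  assumes "\<And>f. f \<in> \<O> UNIV \<Longrightarrow> (\<Sum>w\<in>weyl B. b w * wact w f) = 0" "u \<in> weyl B"
  shows "b u = 0"
proof (rule ccontr)
  assume "b u \<noteq> 0"
  then obtain \<nu> where nu: "Poly_Mapping.lookup (b u) \<nu> \<noteq> 0" by (metis lookup_zero poly_mapping_eqI)
  obtain \<rho> where r: "\<rho> \<in> P" "\<And>w. w \<in> weyl B \<Longrightarrow> w \<rho> = \<rho> \<Longrightarrow> w = id" by (rule regular_weight) blast
  have ne: "u \<rho> \<noteq> w \<rho>" if "w \<in> weyl B" "w \<noteq> u" for w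
  proof
    assume "u \<rho> = w \<rho>"
    then have "(inv u \<circ> w) \<rho> = \<rho>" using assms(2) weyl_inv_left[OF assms(2), of \<rho>] by simp
    then have "inv u \<circ> w = id" using r(2) weyl_comp[OF weyl_inv[OF assms(2)] that(1)] by blast
    then have "w y = u y" for y using weyl_inv_right[OF assms(2), of "w y"] by (metis comp_apply id_apply)
    then show False using that(2) by auto
  qed
  \<comment> \<open>The multiples n for which the summand of w reaches the point \<nu> + n u\<rho>.
    Each set is finite because u\<rho> and w\<rho> differ, so some N avoids all of them.\<close>
  let ?bad = "\<lambda>w. {n::nat. \<nu> + real n *\<^sub>R (u \<rho> - w \<rho>) \<in> Poly_Mapping.keys (b w)}"
  have "finite (?bad w)" if "w \<in> weyl B - {u}" for w
  proof -
    have "inj (\<lambda>n::nat. \<nu> + real n *\<^sub>R (u \<rho> - w \<rho>))"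
      using ne[of w] that by (intro injI) auto
    from finite_vimageI[OF finite_keys this, of "b w"] show ?thesis by (simp add: vimage_def)
  qed
  then have "finite (\<Union>w\<in>weyl B - {u}. ?bad w)" using finite_weyl by auto
  then obtain N where N: "N \<notin> (\<Union>w\<in>weyl B - {u}. ?bad w)"
    using ex_new_if_finite[OF infinite_UNIV_nat] by blast
  let ?k = "\<nu> + real N *\<^sub>R u \<rho>"
  have l: "Poly_Mapping.lookup (b w * wact w (ex (real N *\<^sub>R \<rho>))) ?k
      = Poly_Mapping.lookup (b w) (\<nu> + real N *\<^sub>R (u \<rho> - w \<rho>))" if "w \<in> weyl B" for w
    using lookup_single_mult[of "real N *\<^sub>R w \<rho>" 1 "b w" ?k] linear_cmul[OF weyl_linear[OF that]]
    by (simp add: mult.commute algebra_simps)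
  have "(\<Sum>w\<in>weyl B. b w * wact w (ex (real N *\<^sub>R \<rho>))) = 0"
    using r(1) by (intro assms(1) OU_single P_scale) auto
  from arg_cong[OF this, of "\<lambda>p. Poly_Mapping.lookup p ?k"]
  have "0 = (\<Sum>w\<in>weyl B. Poly_Mapping.lookup (b w * wact w (ex (real N *\<^sub>R \<rho>))) ?k)"
    unfolding lookup_sum lookup_zero by (rule sym)
  also have "\<dots> = (\<Sum>w\<in>weyl B. Poly_Mapping.lookup (b w) (\<nu> + real N *\<^sub>R (u \<rho> - w \<rho>)))"
    by (rule sum.cong[OF HOL.refl l])
  also have "\<dots> = (\<Sum>w\<in>weyl B. if w = u then Poly_Mapping.lookup (b u) \<nu> else 0)"
    using N by (intro sum.cong) (auto simp: in_keys_iff)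
  also have "\<dots> = Poly_Mapping.lookup (b u) \<nu>" using finite_weyl assms(2) by simp
  finally show False using nu by simp
qed

lemma nzd_wact: "u \<in> weyl B \<Longrightarrow> nzd g \<Longrightarrow> nzd (wact u g)"
  unfolding nzd_def
proof (intro allI impI)
  fix h assume u: "u \<in> weyl B" and g: "\<forall>h. g * h = 0 \<longrightarrow> h = 0" and h: "wact u g * h = 0"
  have e: "inv u \<circ> u = id" "u \<circ> inv u = id" using u by (auto simp: fun_eq_iff)
  have "g * wact (inv u) h = wact (inv u) (wact u g * h)"
    using weyl_linear[OF weyl_inv[OF u]] by (simp add: wact_mult wact_comp e)
  then have "wact (inv u) h = 0" using g h by simp
  then have "wact u (wact (inv u) h) = 0" by simp
  then show "h = 0" by (simp add: wact_comp e)
qed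

lemma sum_weyl_left:
  assumes "a \<in> B" shows "(\<Sum>x\<in>weyl B. h (refl a \<circ> x)) = (\<Sum>x\<in>weyl B. h x)"
  by (rule sum.reindex_bij_witness[of _ "\<lambda>x. refl a \<circ> x" "\<lambda>x. refl a \<circ> x"])
    (use assms refl_comp_left weyl_Cons in auto)

text \<open>Based on (1 - e^(-a)) D_a = e^(-a) (1 - s_a). Each letter can raise the lengths by at
  most one, and the coefficient at the full product comes from the leading term of the tail alone,
  so it remains a non-zero-divisor.\<close>

lemma D_expansion:
  assumes "red ws"
  shows "\<exists>g c. nzd g \<and> nzd (c (wprod ws)) \<and> (\<forall>y\<in>weyl B. c y \<noteq> 0 \<longrightarrow> y = wprod ws \<or> len y < length ws) \<and>
    (\<forall>f\<in>\<O> UNIV. g * Tw 0 ws f = (\<Sum>y\<in>weyl B. c y * wact y f))"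
  using assms
proof (induction ws)
  case Nil
  have "(\<Sum>y\<in>weyl B. (if y = id then 1 else 0) * wact y f) = (\<Sum>y\<in>weyl B. if y = id then f else 0)" for f :: "'a \<Rightarrow>\<^sub>0 Kv"
    by (intro sum.cong) auto
  then show ?case unfolding wprod_Nil op_word_Nil
    using finite_weyl weyl_id
    by (intro exI[of _ 1] exI[of _ "\<lambda>y. if y = id then 1 else 0"]) (simp add: id_def)
next
  case (Cons a ws)
  have r: "red ws" and a: "a \<in> B" using reduced_ConsD Cons.prems by auto
  have wsB: "set ws \<subseteq> B" using reduced_B r by blast
  obtain g c where g: "nzd g" "nzd (c (wprod ws))"
    and c: "\<And>y. y \<in> weyl B \<Longrightarrow> c y \<noteq> 0 \<Longrightarrow> y = wprod ws \<or> len y < length ws"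
    and eq: "\<And>f. f \<in> \<O> UNIV \<Longrightarrow> g * Tw 0 ws f = (\<Sum>y\<in>weyl B. c y * wact y f)"
    using Cons.IH[OF r] by blast
  let ?s = "wact (refl a)" and ?e = "ex (-a)" and ?w = "wprod ws"
  \<comment> \<open>The reflection also acts on the old denominator, so both \<open>g\<close> and
    its reflected copy are needed as factors.\<close>
  let ?g = "?s g * g * (1 - ?e)" and ?c = "\<lambda>y. ?e * (?s g * c y - g * ?s (c (refl a \<circ> y)))"
  have W: "refl a \<circ> ?w \<in> weyl B" "?w \<in> weyl B" using a wsB by simp_all
  have l: "len ?w < len (refl a \<circ> ?w)" "len ?w = length ws"
    using reduced_Cons_iff[OF r a] Cons.prems reduced_len[OF r] by auto
  have "c (refl a \<circ> ?w) = 0" using c[OF W(1)] l by fastforce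
  then have "?c (wprod (a # ws)) = - (?e * g * ?s (c ?w))" unfolding wprod_Cons refl_comp_left by simp
  then have 1: "nzd (?c (wprod (a # ws)))"
    using g nzd_wact[OF weyl_refl_base[OF a]] by (simp only: nzd_uminus nzd_mult nzd_ex)
  have 2: "nzd ?g"
    using g nzd_wact[OF weyl_refl_base[OF a]] nonzero_root[of a] a by (intro nzd_mult nzd_one_minus_ex) auto
  have 3: "y = wprod (a # ws) \<or> len y < length (a # ws)" if y: "y \<in> weyl B" "?c y \<noteq> 0" for y
  proof (cases "c y = 0")
    case False
    then show ?thesis using c[OF y(1)] l by auto
  next
    case True
    then have "c (refl a \<circ> y) \<noteq> 0" using y(2) by auto
    then have "refl a \<circ> y = ?w \<or> len (refl a \<circ> y) < length ws" using c weyl_Cons[OF a y(1)] by blast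
    then show ?thesis
    proof
      assume e: "refl a \<circ> y = ?w"
      have "refl a \<circ> ?w = y" unfolding e[symmetric] by (rule refl_comp_left)
      then show ?thesis unfolding wprod_Cons by blast
    next
      assume "len (refl a \<circ> y) < length ws"
      then show ?thesis by (rule_tac left_len_cases[OF y(1) a]) auto
    qed
  qed
  have 4: "?g * Tw 0 (a # ws) f = (\<Sum>y\<in>weyl B. ?c y * wact y f)" if f: "f \<in> \<O> UNIV" for f
  proof -
    let ?h = "Tw 0 ws f"
    have h: "?h \<in> \<O> UNIV" using wsB f by blast
    have "(1 - ?e) * Tq R 0 a ?h = (1 - ?e) * dem R a ?h - (1 - ?e) * ?h"
      by (simp add: Tq_def right_diff_distrib)
    also have "\<dots> = ?e * (?h - ?s ?h)"
      using dem_eq[OF B_R'[OF a] h] by (simp add: algebra_simps)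
    finally have "?g * Tq R 0 a ?h = ?s g * g * (?e * (?h - ?s ?h))" by (simp only: mult.assoc)
    also have "\<dots> = ?e * (?s g * (g * ?h)) - ?e * (g * ?s (g * ?h))"
      unfolding wact_mult[OF linear_refl] by (simp add: algebra_simps)
    also have "?s (g * ?h) = (\<Sum>y\<in>weyl B. ?s (c y) * wact (refl a \<circ> y) f)"
      unfolding eq[OF f] wact_sum wact_mult[OF linear_refl] wact_comp ..
    also have "\<dots> = (\<Sum>y\<in>weyl B. ?s (c (refl a \<circ> y)) * wact y f)"
      using sum_weyl_left[OF a, of "\<lambda>y. ?s (c (refl a \<circ> y)) * wact y f"] unfolding refl_comp_left by simp
    finally show ?thesis
      unfolding eq[OF f] op_word_Cons
      by (simp add: sum_distrib_left sum_subtractf[symmetric] algebra_simps)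
  qed
  show ?case using 1 2 3 4 by (intro exI[of _ ?g] exI[of _ ?c]) blast
qed

text \<open>The word that \<open>op_elem\<close> selects.\<close>

definition rw :: "('a \<Rightarrow> 'a) \<Rightarrow> 'a list" where
  "rw w = (SOME ws. red ws \<and> wprod ws = w)"

lemma rw: "w \<in> weyl B \<Longrightarrow> red (rw w)" "w \<in> weyl B \<Longrightarrow> wprod (rw w) = w"
  using someI_ex[OF reduced_exists[of w]] unfolding rw_def by auto

lemma op_elem_rw: "op_elem B F w = op_word F (rw w)"
  unfolding op_elem_def rw_def ..

abbreviation DE :: "('a \<Rightarrow> 'a) \<Rightarrow> ('a \<Rightarrow>\<^sub>0 Kv) \<Rightarrow> ('a \<Rightarrow>\<^sub>0 Kv)" where "DE x \<equiv> Tw 0 (rw x)"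

lemma DE_OU: "x \<in> weyl B \<Longrightarrow> f \<in> \<O> UNIV \<Longrightarrow> DE x f \<in> \<O> UNIV"
  using Tw_OU reduced_B rw by blast

text \<open>Among the elements with non-zero coefficient take u of maximal length. After clearing
  denominators, only the summand of u contributes to the Weyl element u, and its factor is not a
  zero divisor.\<close>

lemma DE_independent:
  assumes "\<And>f. f \<in> \<O> UNIV \<Longrightarrow> (\<Sum>x\<in>weyl B. c x * DE x f) = 0" "x \<in> weyl B"
  shows "c x = 0"
proof (rule ccontr)
  assume "c x \<noteq> 0"
  let ?A = "{x \<in> weyl B. c x \<noteq> 0}"
  have A: "finite (len ` ?A)" "len ` ?A \<noteq> {}" using finite_weyl \<open>c x \<noteq> 0\<close> assms(2) by auto
  from Max_in[OF this] obtain u where u': "u \<in> ?A" "Max (len ` ?A) = len u" by (rule imageE) blast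
  then have u: "u \<in> weyl B" "c u \<noteq> 0" by auto
  have max: "len y \<le> len u" if "y \<in> weyl B" "c y \<noteq> 0" for y
    using Max_ge[OF A(1), of "len y"] that u'(2) by simp
  have "\<forall>x\<in>weyl B. \<exists>gd. nzd (fst gd) \<and> nzd (snd gd x) \<and> (\<forall>y\<in>weyl B. snd gd y \<noteq> 0 \<longrightarrow> y = x \<or> len y < len x) \<and>
    (\<forall>f\<in>\<O> UNIV. fst gd * DE x f = (\<Sum>y\<in>weyl B. snd gd y * wact y f))"
  proof
    fix x assume x: "x \<in> weyl B"
    from D_expansion[OF rw(1)[OF x]] rw(2)[OF x] reduced_len[OF rw(1)[OF x]]
    show "\<exists>gd. nzd (fst gd) \<and> nzd (snd gd x) \<and> (\<forall>y\<in>weyl B. snd gd y \<noteq> 0 \<longrightarrow> y = x \<or> len y < len x) \<and>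
      (\<forall>f\<in>\<O> UNIV. fst gd * DE x f = (\<Sum>y\<in>weyl B. snd gd y * wact y f))"
      by auto
  qed
  from bchoice[OF this] obtain gd where gd: "\<forall>x\<in>weyl B. nzd (fst (gd x)) \<and> nzd (snd (gd x) x) \<and>
      (\<forall>y\<in>weyl B. snd (gd x) y \<noteq> 0 \<longrightarrow> y = x \<or> len y < len x) \<and>
      (\<forall>f\<in>\<O> UNIV. fst (gd x) * DE x f = (\<Sum>y\<in>weyl B. snd (gd x) y * wact y f))" ..
  define g where "g x = fst (gd x)" for x
  define d where "d x = snd (gd x)" for x
  note gdx = bspec[OF gd, folded g_def d_def]
  have g: "nzd (g x)" and d: "nzd (d x x)" if "x \<in> weyl B" for x
    using gdx[OF that] by simp_all
  have dl: "y = x \<or> len y < len x" if "x \<in> weyl B" "y \<in> weyl B" "d x y \<noteq> 0" for x y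
    using bspec[OF conjunct1[OF conjunct2[OF conjunct2[OF gdx[OF that(1)]]]] that(2)] that(3) by (rule mp)
  have eq: "g x * DE x f = (\<Sum>y\<in>weyl B. d x y * wact y f)" if "x \<in> weyl B" "f \<in> \<O> UNIV" for x f
    by (rule bspec[OF conjunct2[OF conjunct2[OF conjunct2[OF gdx[OF that(1)]]]] that(2)])
  \<comment> \<open>The product of the other denominators, so that \<open>G x * g x\<close> is the
    same for all x.\<close>
  define G where "G x = (\<Prod>y\<in>weyl B - {x}. g y)" for x
  have nG: "nzd (G x)" for x
  proof -
    have "finite A \<Longrightarrow> A \<subseteq> weyl B \<Longrightarrow> nzd (prod g A)" for A
      by (induction A rule: finite_induct) (auto intro: nzd_mult g)
    then show ?thesis unfolding G_def using finite_weyl by auto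
  qed
  have Gg: "(\<Prod>y\<in>weyl B. g y) = G x * g x" if "x \<in> weyl B" for x
    unfolding G_def using prod.remove[OF finite_weyl that, of g] by (simp add: mult.commute)
  have "(\<Sum>x\<in>weyl B. c x * G x * d x u) = 0"
  proof (rule weyl_independent[OF _ u(1)])
    fix f :: "'a \<Rightarrow>\<^sub>0 Kv" assume f: "f \<in> \<O> UNIV"
    have "(\<Sum>y\<in>weyl B. (\<Sum>x\<in>weyl B. c x * G x * d x y) * wact y f)
        = (\<Sum>x\<in>weyl B. c x * G x * (\<Sum>y\<in>weyl B. d x y * wact y f))"
      unfolding sum_distrib_right sum_distrib_left by (subst sum.swap) (simp only: mult.assoc)
    also have "\<dots> = (\<Sum>x\<in>weyl B. (\<Prod>y\<in>weyl B. g y) * (c x * DE x f))"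
    proof (rule sum.cong[OF HOL.refl])
      fix x assume x: "x \<in> weyl B"
      show "c x * G x * (\<Sum>y\<in>weyl B. d x y * wact y f) = (\<Prod>y\<in>weyl B. g y) * (c x * DE x f)"
        unfolding Gg[OF x] eq[OF x f, symmetric] by (simp only: ac_simps)
    qed
    also have "\<dots> = 0" unfolding sum_distrib_left[symmetric] assms(1)[OF f] by simp
    finally show "(\<Sum>y\<in>weyl B. (\<Sum>x\<in>weyl B. c x * G x * d x y) * wact y f) = 0" .
  qed
  also have "(\<Sum>x\<in>weyl B. c x * G x * d x u) = (\<Sum>x\<in>weyl B. if x = u then c u * G u * d u u else 0)"
  proof (rule sum.cong[OF HOL.refl])
    fix x assume x: "x \<in> weyl B"
    have "c x = 0 \<or> d x u = 0" if "x \<noteq> u" using dl[OF x u(1)] max[OF x] that by force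
    then show "c x * G x * d x u = (if x = u then c u * G u * d u u else 0)" by auto
  qed
  finally have "G u * d u u * c u = 0" using finite_weyl u(1) by (simp add: ac_simps)
  then show False using nzd_mult[OF nG d[OF u(1)]] u(2) unfolding nzd_def by blast
qed

section \<open>The coefficients\<close>

text \<open>The recursion for the coefficients read along a word. Independence of the word is a
  consequence of \<open>cwx_eq_cc\<close>.\<close>

primrec coeff_rec :: "'a list \<Rightarrow> ('a \<Rightarrow> 'a) \<Rightarrow> ('a \<Rightarrow>\<^sub>0 Kv)" where
  "coeff_rec [] x = (if x = id then 1 else 0)"
| "coeff_rec (a # ws) x = Tq R vv a (coeff_rec ws x) +
     (if len (refl a \<circ> x) < len x
      then (1 - sg (-a) vv) * wact (refl a) (coeff_rec ws (refl a \<circ> x) - coeff_rec ws x) else 0)"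

lemma cc_OS: "is_subring S \<Longrightarrow> vv \<in> S \<Longrightarrow> set ws \<subseteq> B \<Longrightarrow> coeff_rec ws x \<in> \<O> S"
proof (induction ws arbitrary: x)
  case Nil then show ?case using OS_one OS_zero by simp
next
  case (Cons a ws)
  have a: "a \<in> B" "-a \<in> P" using Cons.prems by (auto intro: P_uminus R_P)
  have IH: "coeff_rec ws y \<in> \<O> S" for y using Cons by simp
  have 1: "Tq R vv a (coeff_rec ws x) \<in> \<O> S" using Tq_OS[OF Cons.prems(1,2)] a IH by blast
  have 2: "(1 - sg (-a) vv) * wact (refl a) (coeff_rec ws (refl a \<circ> x) - coeff_rec ws x) \<in> \<O> S"
    using Cons.prems(1,2) a IH by (intro OS_mult OS_diff OS_one OS_single OS_wact weyl_refl_base)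
  show ?case using 1 2 OS_add[OF Cons.prems(1)] by simp
qed

lemma cc_OU: "set ws \<subseteq> B \<Longrightarrow> coeff_rec ws x \<in> \<O> UNIV"
  by (rule cc_OS) auto

text \<open>Going up, both words are reduced and \<open>Tw_reduced\<close> compares them. Going
  down, D_x begins with D_a, and D_a squared is -D_a.\<close>

lemma D_DE:
  assumes "a \<in> B" "x \<in> weyl B" "f \<in> \<O> UNIV"
  shows "Tq R 0 a (DE x f) = (if len x < len (refl a \<circ> x) then DE (refl a \<circ> x) f else - DE x f)"
proof -
  have up: "Tq R 0 a (DE y f) = DE (refl a \<circ> y) f" if y: "y \<in> weyl B" "len y < len (refl a \<circ> y)" for y
  proof -
    have "red (a # rw y)" using reduced_Cons_iff[OF rw(1)[OF y(1)] assms(1)] rw(2)[OF y(1)] y(2) by simp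
    moreover have "wprod (a # rw y) = wprod (rw (refl a \<circ> y))"
      unfolding wprod_Cons rw(2)[OF y(1)] rw(2)[OF weyl_Cons[OF assms(1) y(1)]] ..
    ultimately have "Tw 0 (a # rw y) f = DE (refl a \<circ> y) f"
      using Tw_reduced[OF _ rw(1)[OF weyl_Cons[OF assms(1) y(1)]] _ assms(3)] by blast
    then show ?thesis by simp
  qed
  show ?thesis
  proof (cases "len x < len (refl a \<circ> x)")
    case True then show ?thesis using up assms by simp
  next
    case False
    let ?y = "refl a \<circ> x"
    have y: "?y \<in> weyl B" using assms by simp
    have "len ?y < len x" using False by (rule_tac left_len_cases[OF assms(2,1)]) auto
    then have "Tq R 0 a (DE ?y f) = DE x f" using up[OF y] unfolding refl_comp_left by simp
    moreover have "Tq R 0 a (Tq R 0 a (DE ?y f)) = - Tq R 0 a (DE ?y f)"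
      using Tq_quad[OF _ DE_OU[OF y assms(3)], of a 0] assms by simp
    ultimately show ?thesis using False by simp
  qed
qed

text \<open>Move each operator past its coefficient by \<open>Tq_mult_D\<close>. The terms in which
  D_a goes up are reindexed by x \<mapsto> s_a x; those going down give the negative terms, so both
  are attached to the x with s_a x < x.\<close>

lemma cc_expansion:
  assumes "set ws \<subseteq> B" "f \<in> \<O> UNIV"
  shows "Tw vv ws f = (\<Sum>x\<in>weyl B. coeff_rec ws x * DE x f)"
  using assms
proof (induction ws)
  case Nil
  have "rw id = []" using rw[of id] reduced_len[of "rw id"] reduced_len[of "[]"] by simp
  then have "(\<Sum>x\<in>weyl B. coeff_rec [] x * DE x f) = (\<Sum>x\<in>weyl B. if x = id then f else 0)"
    by (intro sum.cong) auto
  then show ?case using finite_weyl by simp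
next
  case (Cons a ws)
  have a: "a \<in> B" "a \<in> R" and wsB: "set ws \<subseteq> B" using Cons.prems by auto
  let ?b = "1 - sg (-a) vv" and ?s = "wact (refl a)"
  let ?up = "\<lambda>x. len x < len (refl a \<circ> x)" and ?down = "\<lambda>x. len (refl a \<circ> x) < len x"
  have ud: "\<not> ?up x \<longleftrightarrow> ?down x" if "x \<in> weyl B" for x
    by (rule left_len_cases[OF that a(1)]) auto
  have "Tw vv (a # ws) f = (\<Sum>x\<in>weyl B. Tq R vv a (coeff_rec ws x * DE x f))"
    unfolding op_word_Cons Cons.IH[OF wsB Cons.prems(2)]
    by (intro Tq_sum a OS_mult[OF subring_UNIV] cc_OU wsB DE_OU Cons.prems(2))
  also have "\<dots> = (\<Sum>x\<in>weyl B. Tq R vv a (coeff_rec ws x) * DE x f) + (\<Sum>x\<in>weyl B. ?b * ?s (coeff_rec ws x) * Tq R 0 a (DE x f))"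
    unfolding sum.distrib[symmetric]
    by (intro sum.cong HOL.refl Tq_mult_D a cc_OU wsB DE_OU Cons.prems(2))
  also have "(\<Sum>x\<in>weyl B. ?b * ?s (coeff_rec ws x) * Tq R 0 a (DE x f)) =
      (\<Sum>x\<in>weyl B. (if ?up x then ?b * ?s (coeff_rec ws x) * DE (refl a \<circ> x) f else 0)) -
      (\<Sum>x\<in>weyl B. (if ?down x then ?b * ?s (coeff_rec ws x) * DE x f else 0))"
    unfolding sum_subtractf[symmetric]
    by (intro sum.cong HOL.refl) (use D_DE[OF a(1) _ Cons.prems(2)] ud in auto)
  also have "(\<Sum>x\<in>weyl B. (if ?up x then ?b * ?s (coeff_rec ws x) * DE (refl a \<circ> x) f else 0)) =
      (\<Sum>x\<in>weyl B. (if ?down x then ?b * ?s (coeff_rec ws (refl a \<circ> x)) * DE x f else 0))"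
    using sum_weyl_left[OF a(1), of "\<lambda>x. if ?down x then ?b * ?s (coeff_rec ws (refl a \<circ> x)) * DE x f else 0"]
    unfolding refl_comp_left .
  finally show ?case
    unfolding sum_subtractf[symmetric] sum.distrib[symmetric]
    by (simp only:) (intro sum.cong HOL.refl, auto simp: wact_diff algebra_simps)
qed

text \<open>A non-zero value comes from x or s_a x below the tail, and \<open>bruhat_mult_up\<close>
  places x below the whole word.\<close>

lemma cc_support: "red ws \<Longrightarrow> coeff_rec ws x \<noteq> 0 \<Longrightarrow> x \<preceq> wprod ws"
proof (induction ws arbitrary: x)
  case Nil
  then have "x = id" by (auto split: if_splits)
  then show ?case unfolding wprod_Nil using bruhat_refl[OF weyl_id] by blast
next
  case (Cons a ws)
  have r: "red ws" and a: "a \<in> B" using reduced_ConsD Cons.prems by auto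
  note up = bruhat_Cons[OF Cons.prems(1)]
  show ?case
  proof (cases "coeff_rec ws x = 0")
    case False
    then show ?thesis using bruhat_trans[OF Cons.IH[OF r] up] by blast
  next
    case True
    then have "coeff_rec ws (refl a \<circ> x) \<noteq> 0" using Cons.prems(2) a by (auto split: if_splits)
    from bruhat_mult_up[OF Cons.IH[OF r this] a] have "x \<preceq> wprod ws \<or> x \<preceq> wprod (a # ws)"
      unfolding wprod_Cons refl_comp_left .
    then show ?thesis using bruhat_trans[OF _ up] by blast
  qed
qed

text \<open>\<open>cc_expansion\<close> shows that the recursion solves the conditions in
  \<open>cwx\<close>; \<open>DE_independent\<close>, applied to the difference of two solutions,
  shows that nothing else does.\<close>

lemma cwx_eq_cc:
  assumes "red ws" shows "cwx R B (wprod ws) = coeff_rec ws"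
  unfolding cwx_def
proof (rule the_equality)
  let ?w = "wprod ws"
  have wsB: "set ws \<subseteq> B" and w: "?w \<in> weyl B" using reduced_B assms by auto
  have sub: "{x. x \<preceq> ?w} \<subseteq> weyl B" using bruhat_weyl by blast
  have T: "op_elem B (Top R) ?w f = Tw vv ws f" if "f \<in> \<O> UNIV" for f
    unfolding op_elem_rw Top_eq using Tw_reduced[OF rw(1)[OF w] assms rw(2)[OF w] that] .
  have D: "op_elem B (Dop R) x = DE x" for x unfolding op_elem_rw Dop_eq ..
  \<comment> \<open>Coefficients vanish off the lower interval, so sums can run over the whole
    group.\<close>
  have S: "(\<Sum>x\<in>{x. x \<preceq> ?w}. c x * DE x f) = (\<Sum>x\<in>weyl B. c x * DE x f)"
    if "\<And>x. \<not> x \<preceq> ?w \<Longrightarrow> c x = 0" for c f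
    by (rule sum.mono_neutral_left[OF finite_weyl sub]) (use that in auto)
  have s: "\<not> x \<preceq> ?w \<Longrightarrow> coeff_rec ws x = 0" for x using cc_support assms by blast
  show "(\<forall>x. x \<preceq> ?w \<longrightarrow> coeff_rec ws x \<in> ZvZP R) \<and> (\<forall>x. \<not> x \<preceq> ?w \<longrightarrow> coeff_rec ws x = 0) \<and>
      (\<forall>f\<in>Ov R. op_elem B (Top R) ?w f = (\<Sum>x\<in>{x. x \<preceq> ?w}. coeff_rec ws x * op_elem B (Dop R) x f))"
    unfolding ZvZP_eq Ov_eq D
    using cc_OS[OF subring_int_coeffs vv_int_coeffs wsB] s T S[OF s] cc_expansion[OF wsB] by simp
  fix c assume c: "(\<forall>x. x \<preceq> ?w \<longrightarrow> c x \<in> ZvZP R) \<and> (\<forall>x. \<not> x \<preceq> ?w \<longrightarrow> c x = 0) \<and>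
      (\<forall>f\<in>Ov R. op_elem B (Top R) ?w f = (\<Sum>x\<in>{x. x \<preceq> ?w}. c x * op_elem B (Dop R) x f))"
  then have c0: "\<And>x. \<not> x \<preceq> ?w \<Longrightarrow> c x = 0" by blast
  have "c x - coeff_rec ws x = 0" if "x \<in> weyl B" for x
  proof (rule DE_independent[OF _ that])
    fix f :: "'a \<Rightarrow>\<^sub>0 Kv" assume f: "f \<in> \<O> UNIV"
    have "(\<Sum>x\<in>weyl B. c x * DE x f) = op_elem B (Top R) ?w f"
      using c f S[OF c0] unfolding D Ov_eq by simp
    also have "\<dots> = (\<Sum>x\<in>weyl B. coeff_rec ws x * DE x f)" unfolding T[OF f] cc_expansion[OF wsB f] ..
    finally show "(\<Sum>x\<in>weyl B. (c x - coeff_rec ws x) * DE x f) = 0"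
      by (simp add: left_diff_distrib sum_subtractf)
  qed
  moreover have "c x = coeff_rec ws x" if "x \<notin> weyl B" for x
  proof -
    have "\<not> x \<preceq> ?w" using bruhat_weyl(1)[of x ?w] that by blast
    then show ?thesis using c0 s by simp
  qed
  ultimately show "c = coeff_rec ws" unfolding fun_eq_iff eq_iff_diff_eq_0[of "c x" for x] by fastforce
qed

section \<open>The recursion for f_1 and its comparison with the coefficients\<close>

lemma beta_i_del_pos: "i \<le> length ws \<Longrightarrow> beta_i ws I i = wprod (del_pos (take i ws) I) (ws ! i)"
proof -
  assume i: "i \<le> length ws"
  have "concat (map (\<lambda>j. if j \<notin> I then [ws ! j] else []) [0..<i])
      = concat (map (\<lambda>j. if j \<notin> I then [take i ws ! j] else []) [0..<i])"
    by (intro arg_cong[where f = concat] map_cong) auto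
  then show ?thesis using i by (simp add: beta_i_def del_pos_def min_absorb2)
qed

lemma beta_i_0: "beta_i (a # ws) I 0 = a"
  by (simp add: beta_i_del_pos)

lemma beta_i_Suc:
  "i < length ws \<Longrightarrow> beta_i (a # ws) I (Suc i) = (if 0 \<in> I then id else refl a) (beta_i ws {i. Suc i \<in> I} i)"
  by (simp add: beta_i_del_pos del_pos_Cons)

lemma beta_i_R: "set ws \<subseteq> B \<Longrightarrow> i < length ws \<Longrightarrow> beta_i ws I i \<in> R"
proof -
  assume ws: "set ws \<subseteq> B" "i < length ws"
  have "set (del_pos (take i ws) I) \<subseteq> B"
    using set_del_pos_subset[of "take i ws" I] set_take_subset[of i ws] ws by blast
  moreover have "ws ! i \<in> R" using ws nth_mem[of i ws] B_R by blast
  ultimately show ?thesis using wprod_R ws by (simp add: beta_i_del_pos)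
qed

definition f_step :: "'a list \<Rightarrow> nat set \<Rightarrow> nat \<Rightarrow> ('a \<Rightarrow>\<^sub>0 Kv) \<Rightarrow> ('a \<Rightarrow>\<^sub>0 Kv)" where
  "f_step ws I i g = (if i \<in> I then Tq R vv (beta_i ws I i) g else (1 - sg (- beta_i ws I i) vv) * g)"

lemma f_rec_eq: "f_rec R ws I = foldr (f_step ws I) [0..<length ws] 1"
  unfolding f_rec_def Top_eq f_step_def[abs_def] ..

lemma f_step_OU: "set ws \<subseteq> B \<Longrightarrow> i < length ws \<Longrightarrow> g \<in> \<O> UNIV \<Longrightarrow> f_step ws I i g \<in> \<O> UNIV"
  using beta_i_R[of ws i I] P_uminus[OF R_P[of "beta_i ws I i"]] by (simp add: f_step_def)

text \<open>The first letter, when kept, reflects all later roots. The Weyl action conjugates each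
  operator of the fold into the one for the reflected root, so it can be taken out of the whole
  fold.\<close>

lemma f_rec_Cons:
  assumes "set (a # ws) \<subseteq> B"
  shows "f_rec R (a # ws) I = (if 0 \<in> I then Tq R vv a (f_rec R ws {i. Suc i \<in> I})
    else (1 - sg (-a) vv) * wact (refl a) (f_rec R ws {i. Suc i \<in> I}))"
proof -
  let ?I = "{i. Suc i \<in> I}"
  define u where "u = (if 0 \<in> I then id else refl a)"
  have wsB: "set ws \<subseteq> B" and u: "u \<in> weyl B" using assms weyl_refl_base by (auto simp: u_def)
  note lin = weyl_linear[OF u]
  have fold: "foldr (\<lambda>i. f_step (a # ws) I (Suc i)) xs 1 = wact u (foldr (f_step ws ?I) xs 1) \<and>
      foldr (f_step ws ?I) xs 1 \<in> \<O> UNIV" if "set xs \<subseteq> {..<length ws}" for xs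
    using that
  proof (induction xs)
    case Nil then show ?case using wact_one[OF lin] OU by simp
  next
    case (Cons i xs)
    let ?g = "foldr (f_step ws ?I) xs 1"
    have i: "i < length ws" and g: "?g \<in> \<O> UNIV"
      and IH: "foldr (\<lambda>i. f_step (a # ws) I (Suc i)) xs 1 = wact u ?g" using Cons by auto
    have b: "beta_i (a # ws) I (Suc i) = u (beta_i ws ?I i)" unfolding u_def by (rule beta_i_Suc[OF i])
    have "f_step (a # ws) I (Suc i) (wact u h) = wact u (f_step ws ?I i h)" if "h \<in> \<O> UNIV" for h
    proof (cases "Suc i \<in> I")
      case True
      then show ?thesis
        unfolding f_step_def b using Tq_conj[OF u beta_i_R[OF wsB i, of ?I] that, of vv] by simp
    next
      case False
      then show ?thesis
        unfolding f_step_def b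
        by (simp add: wact_mult[OF lin] wact_diff wact_one[OF lin] linear_neg[OF lin])
    qed
    from this[OF g] have "f_step (a # ws) I (Suc i) (wact u ?g) = wact u (f_step ws ?I i ?g)" .
    then show ?case using f_step_OU[OF wsB i g] IH by simp
  qed
  have "set [0..<length ws] \<subseteq> {..<length ws}" by auto
  then have "foldr (\<lambda>i. f_step (a # ws) I (Suc i)) [0..<length ws] 1 = wact u (f_rec R ws ?I)"
    unfolding f_rec_eq using fold by blast
  moreover have "[0..<length (a # ws)] = 0 # map Suc [0..<length ws]"
    by (simp add: map_Suc_upt upt_conv_Cons del: upt_Suc)
  ultimately have "f_rec R (a # ws) I = f_step (a # ws) I 0 (wact u (f_rec R ws ?I))"
    unfolding f_rec_eq[of "a # ws"] by (simp add: foldr_map comp_def)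
  then show ?thesis by (simp add: f_step_def beta_i_0 u_def)
qed

text \<open>Deleting a later position leaves s_a u with u below the tail, and the lifting property
  removes s_a. In the last case x is not below u, because it is not below the tail, so s_a x \<le> u
  forces x \<le> s_a u.\<close>

lemma lam_set_Cons:
  assumes "red (a # ws)" "x \<in> weyl B"
  shows "0 \<in> lam_set R B x (a # ws) \<longleftrightarrow> x \<preceq> wprod ws"
    and "len x < len (refl a \<circ> x) \<Longrightarrow> {i. Suc i \<in> lam_set R B x (a # ws)} = lam_set R B x ws"
    and "len (refl a \<circ> x) < len x \<Longrightarrow> \<not> x \<preceq> wprod ws \<Longrightarrow>
      {i. Suc i \<in> lam_set R B x (a # ws)} = lam_set R B (refl a \<circ> x) ws"
proof -
  have a: "a \<in> B" and r: "red ws" using assms reduced_ConsD by auto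
  have s: "{i. Suc i \<in> {0}} = {}" "{j. Suc j \<in> {Suc i}} = {i}" for i :: nat by auto
  have d: "del_pos (a # ws) {0} = ws" "del_pos (a # ws) {Suc i} = a # del_pos ws {i}" for i
    unfolding del_pos_Cons s by simp_all
  show "0 \<in> lam_set R B x (a # ws) \<longleftrightarrow> x \<preceq> wprod ws"
    unfolding lam_set_def mem_Collect_eq d by simp
  have m: "Suc i \<in> lam_set R B x (a # ws) \<longleftrightarrow> i < length ws \<and> x \<preceq> refl a \<circ> wprod (del_pos ws {i})" for i
    unfolding lam_set_def mem_Collect_eq d wprod_Cons by simp
  have m': "i \<in> lam_set R B y ws \<longleftrightarrow> i < length ws \<and> y \<preceq> wprod (del_pos ws {i})" for i y
    unfolding lam_set_def by simp
  {
    assume up: "len x < len (refl a \<circ> x)"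
    have "x \<preceq> refl a \<circ> u \<longleftrightarrow> x \<preceq> u" for u
      using lifting_ascent[OF _ a up, of "refl a \<circ> u"] lifting_ascent[OF _ a up, of u]
      unfolding refl_comp_left by blast
    then show "{i. Suc i \<in> lam_set R B x (a # ws)} = lam_set R B x ws"
      using m m' by auto
  next
    assume down: "len (refl a \<circ> x) < len x" and no: "\<not> x \<preceq> wprod ws"
    have "x \<preceq> refl a \<circ> u \<longleftrightarrow> refl a \<circ> x \<preceq> u" if "u \<preceq> wprod ws" for u
    proof
      assume "x \<preceq> refl a \<circ> u"
      from lifting_descent[OF this a down] show "refl a \<circ> x \<preceq> u" unfolding refl_comp_left .
    next
      assume "refl a \<circ> x \<preceq> u"
      from bruhat_mult_up[OF this a] have "x \<preceq> u \<or> x \<preceq> refl a \<circ> u" unfolding refl_comp_left .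
      then show "x \<preceq> refl a \<circ> u" using no bruhat_trans[OF _ that] by blast
    qed
    then show "{i. Suc i \<in> lam_set R B x (a # ws)} = lam_set R B (refl a \<circ> x) ws"
      using m m' subword_bruhat[OF subseq_del_pos r] by auto
  }
qed

lemma cc_eq_f_rec:
  assumes "red ws" "dec_deletable ws I" "x = wprod (del_pos ws I)" "lam_set R B x ws = I \<or> inc_deletable ws I"
  shows "coeff_rec ws x = f_rec R ws I"
  using assms
proof (induction ws arbitrary: I x)
  case Nil
  have "x = id" using Nil.prems(3) unfolding del_pos_Nil wprod_Nil .
  then show ?case by (simp add: f_rec_def id_def)
next
  case (Cons a ws)
  let ?I = "{i. Suc i \<in> I}" and ?u = "wprod (del_pos ws {i. Suc i \<in> I})"
  have a: "a \<in> B" and r: "red ws" and aB: "set (a # ws) \<subseteq> B" using Cons.prems reduced_ConsD reduced_B by auto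
  note D = dec_ConsD[OF Cons.prems(2)]
  have uW: "?u \<in> weyl B" using reduced_B[OF dec_red[OF D(1)]] by simp
  have xW: "x \<in> weyl B" using Cons.prems(3) reduced_B[OF dec_red[OF Cons.prems(2)]] by simp
  have z: "0 \<in> I \<longleftrightarrow> len x < len (refl a \<circ> x)" by (rule dec_zero_iff[OF Cons.prems(2,3)])
  show ?case
  proof (cases "0 \<in> I")
    case True
    have x: "x = ?u" using Cons.prems(3) True by (simp add: del_pos_Cons)
    have up: "len x < len (refl a \<circ> x)" using z True by blast
    have "lam_set R B x ws = ?I \<or> inc_deletable ws ?I"
      using Cons.prems(4) lam_set_Cons(2)[OF Cons.prems(1) xW up] inc_ConsD by blast
    from Cons.IH[OF r D(1) x this] show ?thesis
      unfolding f_rec_Cons[OF aB] using True up by simp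
  next
    case False
    have x: "x = refl a \<circ> ?u"
      unfolding Cons.prems(3) del_pos_Cons using False by (simp add: fun_eq_iff)
    have ax: "refl a \<circ> x = ?u" unfolding x by (rule refl_comp_left)
    have down: "len (refl a \<circ> x) < len x"
      using z False by (rule_tac left_len_cases[OF xW a]) auto
    have no: "\<not> x \<preceq> wprod ws"
      using Cons.prems(4)
    proof
      assume "lam_set R B x (a # ws) = I"
      then show ?thesis using lam_set_Cons(1)[OF Cons.prems(1) xW] False by blast
    next
      assume inc_deletable: "inc_deletable (a # ws) I"
      show ?thesis
      proof
        assume "x \<preceq> wprod ws"
        then obtain J where J: "inc_deletable ws J" "wprod (del_pos ws J) = x" using inc_exists[OF r] by blast
        let ?J = "insert 0 (Suc ` J)"
        have s: "{i. Suc i \<in> ?J} = J" by auto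
        have "wprod (del_pos (a # ws) ?J) = wprod (del_pos (a # ws) I)"
          unfolding Cons.prems(3)[symmetric] del_pos_Cons[of a ws ?J] s using J(2) by simp
        then have "?J = I" using inc_unique[OF inc_insert_0[OF J(1) Cons.prems(1)] inc_deletable] by blast
        then show False using False by blast
      qed
    qed
    have "lam_set R B ?u ws = ?I \<or> inc_deletable ws ?I"
      using Cons.prems(4) lam_set_Cons(3)[OF Cons.prems(1) xW down no] inc_ConsD unfolding ax by blast
    from Cons.IH[OF r D(1) HOL.refl this] have IH: "coeff_rec ws (refl a \<circ> x) = f_rec R ws ?I" unfolding ax .
    \<comment> \<open>This removes both the T-term and the subtracted term of the recursion.\<close>
    have "coeff_rec ws x = 0" using cc_support[OF r] no by blast
    then show ?thesis unfolding f_rec_Cons[OF aB] coeff_rec.simps IH using False down a by simp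
  qed
qed

end

theorem theorem5p5:
  fixes R B :: "'a::euclidean_space set"
    and x :: "'a \<Rightarrow> 'a" and ws :: "'a list" and "is" :: "nat list"
  assumes "root_system R" and "irreducible_rs R" and "is_base R B"
    and "reduced_word B ws"
    and "bruhat R B x (wprod ws)"
    and "is = rev (chain_label ws (chain_minus R B x ws))"
    and "sorted_list_of_set (lam_set R B x ws) = is
         \<or> chain_label ws (chain_plus R B x ws) = is"
  shows "cwx R B (wprod ws) x = f_rec R ws (set is)"
proof -
  interpret based_root_system R B by unfold_locales (use assms in auto)
  note minus = chain_minus_label[OF assms(4,5) HOL.refl]
  note plus = chain_plus_label[OF assms(4,5) HOL.refl]
  have s: "set is = set (chain_label ws (chain_minus R B x ws))" using assms(6) by simp
  have dec_deletable: "dec_deletable ws (set is)" and x: "wprod (del_pos ws (set is)) = x"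
    unfolding s using minus by blast+
  have "finite (lam_set R B x ws)" by (simp add: lam_set_def)
  \<comment> \<open>Both alternatives become conditions on the set of positions, the form that the
    induction can pass to the tail.\<close>
  then have "lam_set R B x ws = set is \<or> inc_deletable ws (set is)"
    using assms(7) plus(2) by (metis set_sorted_list_of_set)
  then have "coeff_rec ws x = f_rec R ws (set is)" by (rule cc_eq_f_rec[OF assms(4) dec_deletable x[symmetric]])
  then show ?thesis unfolding cwx_eq_cc[OF assms(4)] .
qed

end
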